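(* Let $p>1$, $s\in(0,1)$, $N>p$, $T>0$ and $m\in[0,p-1)$. In the case $m>0$, assume that the real parameters $\delta,\gamma$ satisfy $\delta\in(0,m)$ and $2\delta-\mathbf d\,\gamma>2m-1$ for some $\mathbf d>N$. Let $u$ and $\tilde u$ be weak solutions of problem $(E_T)$ (see context) corresponding to the same nonnegative initial datum $u_0\in L^{2(m+1)}(\Omega)$ and the same function $g\in L^2(Q_T)$. Then $u\equiv\tilde u$ in $Q_T$.
   Context: $\Omega\subset\mathbb R^N$ is a bounded domain with smooth boundary, $d(x)=\operatorname{dist}(x,\partial\Omega)$, $Q_T=(0,T)\times\Omega$, $\Gamma_T=(0,T)\times(\mathbb R^N\setminus\Omega)$. Notation: $[a]^{p-1}:=|a|^{p-2}a$. $\Delta_p u=\operatorname{div}(|\nabla u|^{p-2}\nabla u)$ and $(-\Delta)^s_pu(x)=2\,\mathrm{P.V.}\int_{\mathbb R^N}\frac{[u(x)-u(y)]^{p-1}}{|x-y|^{N+sp}}dy$. Functions in $W^{1,p}_0(\Omega)$ are extended by zero to $\mathbb R^N$. Problem $(E_T)$: $u^m\partial_t(u^{m+1})-\Delta_pu+(-\Delta)^s_pu=g(t,x)u^m+m\,d(x)^{-\gamma}u^\delta$ in $Q_T$, $u>0$ in $Q_T$, $u=0$ on $\Gamma_T$, $u(0,\cdot)=u_0$ in $\Omega$ (the term with factor $m$ is absent if $m=0$). A weak solution of $(E_T)$ is a nonnegative $u\in L^\infty(0,T;W^{1,p}_0(\Omega))\cap L^\infty(Q_T)$ with $u>0$ in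 $Q_T$, $\partial_t(u^{m+1})\in L^2(Q_T)$, $u(0,\cdot)=u_0$ a.e. in $\Omega$, and for every $t\in(0,T]$ $$\int_0^t\!\!\int_\Omega u^m\partial_t(u^{m+1})\varphi\,dxd\tau+\int_0^t\!\!\int_\Omega|\nabla u|^{p-2}\nabla u\cdot\nabla\varphi\,dxd\tau+\int_0^t\!\!\iint_{\mathbb R^{2N}}\frac{[u(\tau,x)-u(\tau,y)]^{p-1}(\varphi(\tau,x)-\varphi(\tau,y))}{|x-y|^{N+sp}}dxdyd\tau=\int_0^t\!\!\int_\Omega\big(g\,u^m+m\,d(x)^{-\gamma}u^\delta\big)\varphi\,dxd\tau$$ for all $\varphi\in L^2(Q_T)\cap L^1(0,T;W^{1,p}_0(\Omega))$. *)

theory Defs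
  imports "HOL-Analysis.Analysis"
begin

section \<open>Smooth functions and smooth bounded domains\<close>

text \<open>\<open>Ck_on k S f\<close> and \<open>smooth_on S f\<close> are meant for open sets \<open>S\<close>.\<close>

primrec Ck_on :: "nat \<Rightarrow> 'a::euclidean_space set \<Rightarrow> ('a \<Rightarrow> real) \<Rightarrow> bool" where
  "Ck_on 0 S f \<longleftrightarrow> continuous_on S f"
| "Ck_on (Suc k) S f \<longleftrightarrow> (\<forall>x\<in>S. f differentiable (at x)) \<and>
     (\<forall>b\<in>Basis. Ck_on k S (\<lambda>x. frechet_derivative f (at x) b))"

definition smooth_on :: "'a::euclidean_space set \<Rightarrow> ('a \<Rightarrow> real) \<Rightarrow> bool" where
  "smooth_on S f \<longleftrightarrow> (\<forall>k. Ck_on k S f)"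

definition grad :: "('a::euclidean_space \<Rightarrow> real) \<Rightarrow> 'a \<Rightarrow> 'a" where
  "grad f x = (\<Sum>b\<in>Basis. frechet_derivative f (at x) b *\<^sub>R b)"

definition time_deriv :: "(real \<times> 'a::euclidean_space \<Rightarrow> real) \<Rightarrow> real \<times> 'a \<Rightarrow> real" where
  "time_deriv f z = frechet_derivative f (at z) (1, 0)"

text \<open>\<open>C\<^sub>c\<^sup>\<infinity>(S)\<close> for open \<open>S\<close>; the functions are defined on the whole space.\<close>

definition test_functions :: "'a::euclidean_space set \<Rightarrow> ('a \<Rightarrow> real) set" where
  "test_functions S = {\<psi>. smooth_on UNIV \<psi> \<and>
     compact (closure {x. \<psi> x \<noteq> 0}) \<and> closure {x. \<psi> x \<noteq> 0} \<subseteq> S}"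

text \<open>Near each boundary point, \<open>\<Omega>\<close> is the sublevel set of a smooth function without
  critical points; in particular \<open>\<Omega>\<close> lies locally on one side of its boundary.\<close>

definition smooth_boundary :: "'a::euclidean_space set \<Rightarrow> bool" where
  "smooth_boundary \<Omega> \<longleftrightarrow> (\<forall>z\<in>frontier \<Omega>. \<exists>U \<rho>. open U \<and> z \<in> U \<and> smooth_on U \<rho> \<and>
     (\<forall>x\<in>U. grad \<rho> x \<noteq> 0) \<and> \<Omega> \<inter> U = {x \<in> U. \<rho> x < 0})"

definition smooth_bounded_domain :: "'a::euclidean_space set \<Rightarrow> bool" where
  "smooth_bounded_domain \<Omega> \<longleftrightarrow>
     \<Omega> \<noteq> {} \<and> open \<Omega> \<and> connected \<Omega> \<and> bounded \<Omega> \<and> smooth_boundary \<Omega>"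


section \<open>Lebesgue and Sobolev spaces\<close>

text \<open>Elements of function spaces are represented by functions, not by equivalence classes;
  accordingly, identities between them are stated almost everywhere.\<close>

definition Lp_space :: "real \<Rightarrow> 'a::euclidean_space set \<Rightarrow> ('a \<Rightarrow> 'b::euclidean_space) set" where
  "Lp_space q S = {f. f \<in> borel_measurable (lebesgue_on S) \<and>
     integrable (lebesgue_on S) (\<lambda>x. norm (f x) powr q)}"

definition Linf_space :: "'a::euclidean_space set \<Rightarrow> ('a \<Rightarrow> real) set" where
  "Linf_space S = {f. f \<in> borel_measurable (lebesgue_on S) \<and>
     (\<exists>C. AE x in lebesgue_on S. \<bar>f x\<bar> \<le> C)}"

text \<open>The weak gradient on the whole space: \<open>\<integral> f \<nabla>\<psi> = - \<integral> \<psi> F\<close>.\<close>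

definition is_weak_gradient :: "('a::euclidean_space \<Rightarrow> real) \<Rightarrow> ('a \<Rightarrow> 'a) \<Rightarrow> bool" where
  "is_weak_gradient f F \<longleftrightarrow> (\<forall>\<psi>\<in>test_functions UNIV.
     (LINT x|lebesgue. f x *\<^sub>R grad \<psi> x) = - (LINT x|lebesgue. \<psi> x *\<^sub>R F x))"

definition W1p_norm :: "real \<Rightarrow> ('a::euclidean_space \<Rightarrow> real) \<Rightarrow> ('a \<Rightarrow> 'a) \<Rightarrow> real" where
  "W1p_norm p f F = ((LINT x|lebesgue. \<bar>f x\<bar> powr p) + (LINT x|lebesgue. norm (F x) powr p)) powr (1 / p)"

text \<open>\<open>in_W01p \<Omega> p f F\<close>: the function \<open>f\<close> on the whole space is the extension by zero of an
  element of \<open>W\<^sub>0\<^sup>1\<^sup>,\<^sup>p(\<Omega>)\<close>, and \<open>F\<close> is its weak gradient. As extension by zero is isometric, these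
  are the elements of the closure of \<open>C\<^sub>c\<^sup>\<infinity>(\<Omega>)\<close> in the \<open>W\<^sup>1\<^sup>,\<^sup>p\<close>-norm of the whole space; the
  approximation forces \<open>f = 0\<close> and \<open>F = 0\<close> almost everywhere outside \<open>\<Omega>\<close>.\<close>

definition in_W01p ::
  "'a::euclidean_space set \<Rightarrow> real \<Rightarrow> ('a \<Rightarrow> real) \<Rightarrow> ('a \<Rightarrow> 'a) \<Rightarrow> bool" where
  "in_W01p \<Omega> p f F \<longleftrightarrow>
     f \<in> Lp_space p UNIV \<and> F \<in> Lp_space p UNIV \<and> is_weak_gradient f F \<and>
     (\<forall>\<epsilon>>0. \<exists>\<psi>\<in>test_functions \<Omega>. W1p_norm p (\<lambda>x. f x - \<psi> x) (\<lambda>x. F x - grad \<psi> x) < \<epsilon>)"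

text \<open>Measurable functions from \<open>(0,T)\<close> to \<open>W\<^sub>0\<^sup>1\<^sup>,\<^sup>p(\<Omega>)\<close>, written as functions of \<open>t\<close> and \<open>x\<close>, with
  their spatial gradient \<open>G\<close>. As this space is separable and reflexive for \<open>p > 1\<close>, joint
  measurability amounts to strong (Bochner) measurability, and a jointly measurable version
  of the gradient exists.\<close>

definition time_W01p ::
  "'a::euclidean_space set \<Rightarrow> real \<Rightarrow> real \<Rightarrow> (real \<Rightarrow> 'a \<Rightarrow> real) \<Rightarrow> (real \<Rightarrow> 'a \<Rightarrow> 'a) \<Rightarrow> bool" where
  "time_W01p \<Omega> p T u G \<longleftrightarrow>
     (\<lambda>(t, x). u t x) \<in> borel_measurable (lebesgue_on ({0<..<T} \<times> UNIV)) \<and>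
     (\<lambda>(t, x). G t x) \<in> borel_measurable (lebesgue_on ({0<..<T} \<times> UNIV)) \<and>
     (AE t in lebesgue_on {0<..<T}. in_W01p \<Omega> p (u t) (G t))"

text \<open>\<open>L\<^sup>\<infinity>(0,T;W\<^sub>0\<^sup>1\<^sup>,\<^sup>p(\<Omega>))\<close> and \<open>L\<^sup>1(0,T;W\<^sub>0\<^sup>1\<^sup>,\<^sup>p(\<Omega>))\<close>\<close>

definition in_Linf_W01p ::
  "'a::euclidean_space set \<Rightarrow> real \<Rightarrow> real \<Rightarrow> (real \<Rightarrow> 'a \<Rightarrow> real) \<Rightarrow> (real \<Rightarrow> 'a \<Rightarrow> 'a) \<Rightarrow> bool" where
  "in_Linf_W01p \<Omega> p T u G \<longleftrightarrow> time_W01p \<Omega> p T u G \<and>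
     (\<exists>C. AE t in lebesgue_on {0<..<T}. W1p_norm p (u t) (G t) \<le> C)"

definition in_L1_W01p ::
  "'a::euclidean_space set \<Rightarrow> real \<Rightarrow> real \<Rightarrow> (real \<Rightarrow> 'a \<Rightarrow> real) \<Rightarrow> (real \<Rightarrow> 'a \<Rightarrow> 'a) \<Rightarrow> bool" where
  "in_L1_W01p \<Omega> p T u G \<longleftrightarrow> time_W01p \<Omega> p T u G \<and>
     integrable (lebesgue_on {0<..<T}) (\<lambda>t. W1p_norm p (u t) (G t))"

text \<open>Distributional time derivative on an open set \<open>Q\<close> of space-time\<close>

definition is_weak_time_derivative ::
  "(real \<times> 'a::euclidean_space) set \<Rightarrow> (real \<times> 'a \<Rightarrow> real) \<Rightarrow> (real \<times> 'a \<Rightarrow> real) \<Rightarrow> bool" where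
  "is_weak_time_derivative Q w v \<longleftrightarrow> (\<forall>\<psi>\<in>test_functions Q.
     (LINT z:Q|lebesgue. w z * time_deriv \<psi> z) = - (LINT z:Q|lebesgue. v z * \<psi> z))"


section \<open>Weak solutions\<close>

text \<open>The notation \<open>[a]\<^sup>p\<^sup>-\<^sup>1 = |a|\<^sup>p\<^sup>-\<^sup>2 a\<close>\<close>

definition spow :: "real \<Rightarrow> real \<Rightarrow> real" where
  "spow p a = \<bar>a\<bar> powr (p - 2) * a"

text \<open>The condition \<open>u(0,\<cdot>) = u\<^sub>0\<close> cannot be read off from an arbitrary representative of \<open>u\<close>.
  Since \<open>u\<^sup>m\<^sup>+\<^sup>1\<close> and its time derivative are square integrable, \<open>u\<close> has a representative \<open>U\<close> for
  which \<open>U\<^sup>m\<^sup>+\<^sup>1\<close> is continuous from \<open>[0,T]\<close> to \<open>L\<^sup>2(\<Omega>)\<close>, and \<open>u(0,\<cdot>)\<close> stands for \<open>U(0,\<cdot>)\<close>.\<close>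

definition has_initial_value ::
  "'a::euclidean_space set \<Rightarrow> real \<Rightarrow> real \<Rightarrow> (real \<Rightarrow> 'a \<Rightarrow> real) \<Rightarrow> ('a \<Rightarrow> real) \<Rightarrow> bool" where
  "has_initial_value \<Omega> T m u u0 \<longleftrightarrow> (\<exists>U.
     (AE t in lebesgue_on {0<..<T}. AE x in lebesgue_on \<Omega>. U t x = u t x) \<and>
     (\<forall>t\<in>{0..T}. (AE x in lebesgue_on \<Omega>. 0 \<le> U t x) \<and> (\<lambda>x. U t x powr (m + 1)) \<in> Lp_space 2 \<Omega>) \<and>
     (\<forall>t\<in>{0..T}. ((\<lambda>r. LINT x:\<Omega>|lebesgue. (U r x powr (m + 1) - U t x powr (m + 1))\<^sup>2) \<longlongrightarrow> 0)
        (at t within {0..T})) \<and>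
     (AE x in lebesgue_on \<Omega>. U 0 x = u0 x))"

text \<open>Here \<open>G\<close> is \<open>\<nabla>u\<close>, \<open>v\<close> is \<open>\<partial>\<^sub>t(u\<^sup>m\<^sup>+\<^sup>1)\<close> and \<open>H\<close> is \<open>\<nabla>\<phi>\<close>, all unique up to null sets. The
  Bochner integral being total, the existence of the four integrals is required explicitly; this
  is a restriction only for the term with \<open>d\<^sup>-\<^sup>\<gamma> u\<^sup>\<delta>\<close>. The condition \<open>u = 0\<close> outside \<open>\<Omega>\<close> is part
  of \<open>in_Linf_W01p\<close>; with \<open>u > 0\<close> in \<open>(0,T) \<times> \<Omega>\<close> it makes \<open>u\<close> nonnegative.\<close>

definition weak_solution ::
  "'a::euclidean_space set \<Rightarrow> real \<Rightarrow> real \<Rightarrow> real \<Rightarrow> real \<Rightarrow> real \<Rightarrow> real \<Rightarrow>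
   (real \<Rightarrow> 'a \<Rightarrow> real) \<Rightarrow> ('a \<Rightarrow> real) \<Rightarrow> (real \<Rightarrow> 'a \<Rightarrow> real) \<Rightarrow> bool" where
  "weak_solution \<Omega> T p s m \<delta> \<gamma> g u0 u \<longleftrightarrow> (\<exists>G v.
     in_Linf_W01p \<Omega> p T u G \<and>
     (\<lambda>(t, x). u t x) \<in> Linf_space ({0<..<T} \<times> \<Omega>) \<and>
     (AE (t, x) in lebesgue_on ({0<..<T} \<times> \<Omega>). 0 < u t x) \<and>
     is_weak_time_derivative ({0<..<T} \<times> \<Omega>) (\<lambda>(t, x). u t x powr (m + 1)) (\<lambda>(t, x). v t x) \<and>
     (\<lambda>(t, x). v t x) \<in> Lp_space 2 ({0<..<T} \<times> \<Omega>) \<and>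
     has_initial_value \<Omega> T m u u0 \<and>
     (\<forall>t\<in>{0<..T}. \<forall>\<phi> H.
        (\<lambda>(\<tau>, x). \<phi> \<tau> x) \<in> Lp_space 2 ({0<..<T} \<times> \<Omega>) \<and> in_L1_W01p \<Omega> p T \<phi> H \<longrightarrow>
        (let Q = {0<..<t} \<times> \<Omega>;
             Q2 = {0<..<t} \<times> (UNIV :: ('a \<times> 'a) set);
             A = (\<lambda>(\<tau>, x). u \<tau> x powr m * v \<tau> x * \<phi> \<tau> x);
             B = (\<lambda>(\<tau>, x). norm (G \<tau> x) powr (p - 2) * (G \<tau> x \<bullet> H \<tau> x));
             K = (\<lambda>(\<tau>, x, y). spow p (u \<tau> x - u \<tau> y) * (\<phi> \<tau> x - \<phi> \<tau> y)
                    / norm (x - y) powr (real DIM('a) + s * p));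
             R = (\<lambda>(\<tau>, x). (g \<tau> x * u \<tau> x powr m
                    + m * infdist x (frontier \<Omega>) powr (- \<gamma>) * u \<tau> x powr \<delta>) * \<phi> \<tau> x)
         in set_integrable lebesgue Q A \<and> set_integrable lebesgue Q B \<and>
            set_integrable lebesgue Q2 K \<and> set_integrable lebesgue Q R \<and>
            (LINT z:Q|lebesgue. A z) + (LINT z:Q|lebesgue. B z) + (LINT z:Q2|lebesgue. K z)
              = (LINT z:Q|lebesgue. R z))))"

end

theory Submission
  imports Defs
begin

text \<open>Write \<open>q = m + 1\<close> and let \<open>u\<close>, \<open>w\<close> be two solutions. The equation for \<open>u\<close> is tested with
  \<open>((u + \<epsilon>)\<^sup>q - (w + \<epsilon>)\<^sup>q) / (u + \<epsilon>)\<^sup>m\<close> and the one for \<open>w\<close> with the same expression after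
  exchanging \<open>u\<close> and \<open>w\<close>. In the sum, the local and the nonlocal diffusion terms are nonnegative by
  the Picone inequalities, since \<open>q < p\<close>. As \<open>\<epsilon> \<rightarrow> 0\<close> the terms with \<open>g\<close> cancel, and the
  singular terms have a nonpositive limit because \<open>\<delta> < m\<close>. So \<open>z = u\<^sup>q - w\<^sup>q\<close> satisfies
  \<open>\<integral>\<^sub>0\<^sup>t \<integral> z \<partial>\<^sub>tz \<le> 0\<close> for all \<open>t\<close>, and \<open>z\<close> vanishes at time \<open>0\<close>. The left-hand side
  is half the integral of \<open>z(t)\<^sup>2\<close>, hence \<open>z = 0\<close>.\<close>


section \<open>Smooth functions\<close>

text \<open>Dividing by powers of \<open>u\<close> itself is not possible: there is no lower bound
  for \<open>u\<close> near the boundary, and the nonlocal form also sees the complement of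
  \<Omega>, where both solutions vanish. The shift leaves gradients and differences unchanged, so
  the Picone inequalities apply to the shifted functions, and outside \<Omega> the test function is
  \<epsilon> - \<epsilon> = 0. The price is paid on the right: for fixed \<epsilon> the terms with
  \<open>g\<close> need not cancel and the singular term has no sign. Its majorant comes from the
  equation itself: tested with the solution, it makes
  \<open>m * d powr (- \<gamma>) * u powr (\<delta> + 1)\<close> integrable. A second obstacle is
  admissibility, since the Sobolev space is a closure of smooth functions: the nonlinearity is
  replaced by a smooth one that is constant off a compact interval and unchanged on the range of the
  solutions, and its chain rule passes to the closure. A third is the energy identity for a merely
  weak time derivative: \<open>z\<close> is identified with the primitive of that derivative
  starting from 0, and for a primitive the identity is Fubini's theorem at almost every space
  point.\<close>

lemma Ck_on_UNIV_SucI: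
  assumes "\<And>x. (f has_derivative D x) (at x)"
    and "\<And>b. b \<in> Basis \<Longrightarrow> Ck_on k UNIV (\<lambda>x. D x b)"
  shows "Ck_on (Suc k) UNIV f"
proof -
  have "frechet_derivative f (at x) = D x" for x
    using frechet_derivative_at[OF assms(1)] by simp
  then show ?thesis using assms by (auto simp: differentiable_def)
qed

lemma Ck_on_UNIV_real_SucI:
  fixes f :: "real \<Rightarrow> real"
  assumes "\<And>x. (f has_real_derivative f' x) (at x)" and "Ck_on k UNIV f'"
  shows "Ck_on (Suc k) UNIV f"
  using assms by (intro Ck_on_UNIV_SucI[where D = "\<lambda>x h. f' x * h"]) (auto simp: has_field_derivative_def)

lemma Ck_on_SucD: "Ck_on (Suc k) S f \<Longrightarrow> Ck_on k S f"
proof (induction k arbitrary: f)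
  case 0
  then show ?case
    by (auto intro!: continuous_at_imp_continuous_on differentiable_imp_continuous_within)
next
  case (Suc k)
  then show ?case by (metis Ck_on.simps(2))
qed

lemma Ck_on_UNIV_has_derivative:
  "Ck_on (Suc k) UNIV f \<Longrightarrow> (f has_derivative frechet_derivative f (at x)) (at x)"
  by (simp add: frechet_derivative_works)

lemma Ck_on_const: "Ck_on k UNIV (\<lambda>x::'a::euclidean_space. c)"
proof (induction k arbitrary: c)
  case (Suc k)
  show ?case by (rule Ck_on_UNIV_SucI[where D = "\<lambda>x h. 0"]) (auto simp: Suc)
qed simp

lemma Ck_on_bounded_linear:
  fixes f :: "'a::euclidean_space \<Rightarrow> real"
  assumes "bounded_linear f" shows "Ck_on k UNIV f"
proof (cases k)
  case 0
  then show ?thesis using assms linear_continuous_on by auto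
next
  case (Suc j)
  show ?thesis unfolding Suc
    by (rule Ck_on_UNIV_SucI[where D = "\<lambda>x. f"])
      (auto intro: bounded_linear_imp_has_derivative assms Ck_on_const)
qed

lemma Ck_on_add:
  assumes "Ck_on k UNIV f" "Ck_on k UNIV g" shows "Ck_on k UNIV (\<lambda>x. f x + g x)"
  using assms
proof (induction k arbitrary: f g)
  case 0 then show ?case by (auto intro: continuous_intros)
next
  case (Suc k)
  show ?case
    by (rule Ck_on_UNIV_SucI[where D = "\<lambda>x h. frechet_derivative f (at x) h + frechet_derivative g (at x) h"])
      (use Suc in \<open>auto intro!: derivative_eq_intros Ck_on_UNIV_has_derivative[of k]\<close>)
qed

lemma Ck_on_mult:
  assumes "Ck_on k UNIV f" "Ck_on k UNIV g" shows "Ck_on k UNIV (\<lambda>x. f x * g x)"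
  using assms
proof (induction k arbitrary: f g)
  case 0 then show ?case by (auto intro: continuous_intros)
next
  case (Suc k)
  show ?case
  proof (rule Ck_on_UNIV_SucI)
    show "((\<lambda>x. f x * g x) has_derivative (\<lambda>h. f x * frechet_derivative g (at x) h + frechet_derivative f (at x) h * g x)) (at x)" for x
      using Suc.prems by (intro has_derivative_mult Ck_on_UNIV_has_derivative[of k])
    show "Ck_on k UNIV (\<lambda>x. f x * frechet_derivative g (at x) b + frechet_derivative f (at x) b * g x)"
      if "b \<in> Basis" for b
      using Suc.prems Ck_on_SucD[OF Suc.prems(1)] Ck_on_SucD[OF Suc.prems(2)] that
      by (intro Ck_on_add Suc.IH) auto
  qed
qed

text \<open>The directional derivative of the composition is that of \<open>f\<close> times the
  derivative of \<open>g\<close> at \<open>f x\<close>. The latter is again a composition, with one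
  order of smoothness less, so the induction applies to it.\<close>

lemma Ck_on_compose:
  fixes g :: "real \<Rightarrow> real"
  assumes "Ck_on k UNIV f" "Ck_on k UNIV g" shows "Ck_on k UNIV (\<lambda>x. g (f x))"
  using assms
proof (induction k arbitrary: f g)
  case 0 then show ?case by (auto intro: continuous_on_compose2)
next
  case (Suc k)
  show ?case
  proof (rule Ck_on_UNIV_SucI)
    have g: "frechet_derivative g (at y) h = h * frechet_derivative g (at y) 1" for y h
      using linear_scale[OF has_derivative_linear[OF Ck_on_UNIV_has_derivative[OF Suc.prems(2)]], of y h 1] by simp
    show "((\<lambda>x. g (f x)) has_derivative (\<lambda>h. frechet_derivative f (at x) h * frechet_derivative g (at (f x)) 1)) (at x)" for x
      using has_derivative_compose[OF Ck_on_UNIV_has_derivative[OF Suc.prems(1)] Ck_on_UNIV_has_derivative[OF Suc.prems(2)]]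
      by (subst (asm) g)
    show "Ck_on k UNIV (\<lambda>x. frechet_derivative f (at x) b * frechet_derivative g (at (f x)) 1)"
      if "b \<in> Basis" for b
      using Suc.prems that Ck_on_SucD[OF Suc.prems(1)]
      by (intro Ck_on_mult Suc.IH[where g = "\<lambda>y. frechet_derivative g (at y) 1"]) auto
  qed
qed

text \<open>Differentiation reproduces the same shape with exponent \<open>c - 1\<close>, hence the
  induction with \<open>c\<close> arbitrary. Positivity of \<open>f\<close> keeps the base away from
  0, the only point where a real power may fail to be smooth.\<close>

lemma Ck_on_powr:
  assumes "Ck_on k UNIV f" "\<And>x. 0 < f x" shows "Ck_on k UNIV (\<lambda>x. f x powr c)"
  using assms(1)
proof (induction k arbitrary: c)
  case 0
  then show ?case using assms(2) by (auto intro!: continuous_intros simp: less_imp_neq[symmetric])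
next
  case (Suc k)
  show ?case
  proof (rule Ck_on_UNIV_SucI)
    show "((\<lambda>x. f x powr c) has_derivative (\<lambda>h. (c * f x powr (c - 1)) * frechet_derivative f (at x) h)) (at x)" for x
      using has_derivative_compose[OF Ck_on_UNIV_has_derivative[OF Suc.prems]
          has_real_derivative_powr[OF assms(2), of c, unfolded has_field_derivative_def]]
      by simp
    show "Ck_on k UNIV (\<lambda>x. (c * f x powr (c - 1)) * frechet_derivative f (at x) b)"
      if "b \<in> Basis" for b
      using Suc.prems that Ck_on_SucD[OF Suc.prems] by (intro Ck_on_mult Ck_on_const Suc.IH) auto
  qed
qed

lemma Ck_on_prod:
  assumes "finite I" "\<And>i. i \<in> I \<Longrightarrow> Ck_on k UNIV (f i)" shows "Ck_on k UNIV (\<lambda>x. \<Prod>i\<in>I. f i x)"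
  using assms by (induction I rule: finite_induct) (auto intro: Ck_on_const Ck_on_mult)

section \<open>Closure properties of smooth functions and their gradients\<close>

lemma smooth_onI: "(\<And>k. Ck_on k S f) \<Longrightarrow> smooth_on S f" and smooth_onD: "smooth_on S f \<Longrightarrow> Ck_on k S f"
  by (auto simp: smooth_on_def)

lemmas smooth_intros =
  smooth_onI[OF Ck_on_const] smooth_onI[OF Ck_on_add[OF smooth_onD smooth_onD]]
  smooth_onI[OF Ck_on_mult[OF smooth_onD smooth_onD]] 
  smooth_onI[OF Ck_on_powr[OF smooth_onD]]

lemma smooth_on_id: "smooth_on UNIV (\<lambda>x::real. x)"
  by (intro smooth_onI Ck_on_bounded_linear bounded_linear_ident)

lemma smooth_on_prod:
  assumes "finite I" "\<And>i. i \<in> I \<Longrightarrow> smooth_on UNIV (f i)" shows "smooth_on UNIV (\<lambda>x. \<Prod>i\<in>I. f i x)"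
  by (rule smooth_onI, rule Ck_on_prod[OF assms(1) smooth_onD[OF assms(2)]])

lemma smooth_on_bounded_linear: "bounded_linear f \<Longrightarrow> smooth_on UNIV f"
  by (rule smooth_onI, rule Ck_on_bounded_linear)

lemma smooth_on_compose:
  fixes g :: "real \<Rightarrow> real"
  shows "smooth_on UNIV f \<Longrightarrow> smooth_on UNIV g \<Longrightarrow> smooth_on UNIV (\<lambda>x. g (f x))"
  by (auto simp: smooth_on_def intro: Ck_on_compose)

lemma smooth_on_diff:
  "smooth_on UNIV f \<Longrightarrow> smooth_on UNIV g \<Longrightarrow> smooth_on UNIV (\<lambda>x. f x - g x)"
  using smooth_intros(2)[of f "\<lambda>x. (-1) * g x"] smooth_intros(3)[OF smooth_intros(1)[of "-1"], of g] by simp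

lemma smooth_on_continuous: "smooth_on UNIV f \<Longrightarrow> continuous_on UNIV f"
  using smooth_onD[of UNIV f 0] by simp

lemma smooth_on_has_derivative:
  "smooth_on UNIV f \<Longrightarrow> (f has_derivative frechet_derivative f (at x)) (at x)"
  using Ck_on_UNIV_has_derivative[OF smooth_onD[of UNIV f "Suc 0"]] .

lemma smooth_on_frechet_derivative:
  "smooth_on UNIV f \<Longrightarrow> b \<in> Basis \<Longrightarrow> smooth_on UNIV (\<lambda>x. frechet_derivative f (at x) b)"
  by (metis Ck_on.simps(2) smooth_on_def)

lemma smooth_on_real_has_derivative:
  fixes f :: "real \<Rightarrow> real"
  assumes "smooth_on UNIV f"
  obtains f' where "smooth_on UNIV f'" "\<And>x. (f has_real_derivative f' x) (at x)"
proof
  show "smooth_on UNIV (\<lambda>x. frechet_derivative f (at x) 1)"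
    by (rule smooth_on_frechet_derivative[OF assms]) simp
  show "(f has_real_derivative frechet_derivative f (at x) 1) (at x)" for x
    using smooth_on_has_derivative[OF assms, of x] 
      linear_scale[OF has_derivative_linear[OF smooth_on_has_derivative[OF assms]], of x _ 1]
    unfolding has_field_derivative_def by (metis (no_types, lifting) ext mult.commute mult.right_neutral real_scaleR_def)
qed

lemma grad_continuous: "smooth_on UNIV f \<Longrightarrow> continuous_on UNIV (grad f)"
  unfolding grad_def[abs_def]
  by (intro continuous_intros smooth_on_continuous smooth_on_frechet_derivative) auto

lemma frechet_derivative_grad:
  assumes "(f has_derivative D) (at x)" shows "D h = grad f x \<bullet> h"
proof -
  have "D h = D (\<Sum>b\<in>Basis. (h \<bullet> b) *\<^sub>R b)" by (simp add: euclidean_representation)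
  also have "\<dots> = (\<Sum>b\<in>Basis. (h \<bullet> b) * D b)"
    using has_derivative_linear[OF assms] by (simp add: linear_sum linear_cmul)
  finally show ?thesis
    unfolding grad_def frechet_derivative_at[OF assms, symmetric] inner_sum_left inner_scaleR_left
    by (simp add: inner_commute mult.commute)
qed

lemma grad_eqI: "(f has_derivative (\<lambda>h. v \<bullet> h)) (at x) \<Longrightarrow> grad f x = v"
  by (metis frechet_derivative_grad vector_eq_rdot)

lemma smooth_on_has_derivative_grad:
  "smooth_on UNIV f \<Longrightarrow> (f has_derivative (\<lambda>h. grad f x \<bullet> h)) (at x)"
  using smooth_on_has_derivative[of f x] frechet_derivative_grad[OF smooth_on_has_derivative, of f]
  by (metis (no_types, lifting) ext)

section \<open>Flat functions and bumps\<close>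

text \<open>The classical flat function exp(-1/x) together with its quotients by powers of x. The
  family is closed under differentiation up to linear combinations, so smoothness follows by
  induction without formulas for higher derivatives.\<close>

definition flat :: "nat \<Rightarrow> real \<Rightarrow> real" where
  "flat n x = (if 0 < x then exp (- 1 / x) / x ^ n else 0)"

lemma flat_tendsto_0: "(flat n \<longlongrightarrow> 0) (at 0)"
proof -
  have "((\<lambda>x. (inverse x) ^ n / exp (inverse x)) \<longlongrightarrow> 0) (at_right (0::real))"
    by (rule filterlim_compose[OF tendsto_power_div_exp_0 filterlim_inverse_at_top_right])
  then have "(flat n \<longlongrightarrow> 0) (at_right 0)"
    by (rule Lim_transform_eventually)
      (auto simp: eventually_at_filter flat_def field_simps exp_minus)
  moreover have "(flat n \<longlongrightarrow> 0) (at_left 0)"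
    by (rule Lim_transform_eventually[OF tendsto_const]) (auto simp: eventually_at_filter flat_def)
  ultimately show ?thesis by (simp add: filterlim_split_at)
qed

lemma flat_has_derivative:
  "(flat n has_real_derivative flat (n + 2) x - n * flat (n + 1) x) (at x)"
proof -
  consider "x < 0" | "x = 0" | "0 < x" by linarith
  then show ?thesis
  proof cases
    case 1
    have "((\<lambda>x. 0) has_real_derivative 0) (at x)" by simp
    then have "(flat n has_real_derivative 0) (at x)"
      by (rule has_field_derivative_transform_within_open[where S = "{..<0}"]) (use 1 in \<open>auto simp: flat_def\<close>)
    then show ?thesis using 1 by (simp add: flat_def)
  next
    case 2
    \<comment> \<open>At the origin the difference quotient of \<open>flat n\<close> is
      \<open>flat (Suc n)\<close>, whose limit is already known to be 0.\<close>
    have "((\<lambda>h. (flat n (0 + h) - flat n 0) / h) \<longlongrightarrow> 0) (at 0)"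
      by (rule Lim_transform_eventually[OF flat_tendsto_0[of "Suc n"]])
        (auto simp: flat_def eventually_at_filter field_simps)
    then show ?thesis unfolding DERIV_def using 2 by (simp add: flat_def)
  next
    case 3
    \<comment> \<open>In the variable 1/x the function is exp(-y) y^n; the inner derivative -y^2
      raises the exponents to n + 2 and n + 1.\<close>
    define y where "y = inverse x"
    have "((\<lambda>y. exp (- y) * y ^ n) has_real_derivative exp (- y) * (n * y ^ (n - 1)) - exp (- y) * y ^ n) (at y)"
      by (auto intro!: derivative_eq_intros)
    from DERIV_chain2[OF this[unfolded y_def] DERIV_inverse] 
    have "((\<lambda>x. exp (- inverse x) * inverse x ^ n) has_real_derivative
        (exp (- y) * (n * y ^ (n - 1)) - exp (- y) * y ^ n) * - (y ^ 2)) (at x)"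
      using 3 by (simp add: y_def numeral_2_eq_2)
    then have "(flat n has_real_derivative (exp (- y) * (n * y ^ (n - 1)) - exp (- y) * y ^ n) * - (y ^ 2)) (at x)"
      by (rule has_field_derivative_transform_within_open[where S = "{0<..}"])
        (use 3 in \<open>auto simp: flat_def field_simps\<close>)
    also have "(exp (- y) * (n * y ^ (n - 1)) - exp (- y) * y ^ n) * - (y ^ 2) = flat (n + 2) x - n * flat (n + 1) x"
      using 3 by (cases n) (auto simp: flat_def y_def divide_inverse power_inverse power_add power2_eq_square algebra_simps)
    finally show ?thesis .
  qed
qed

lemma Ck_on_flat: "Ck_on k UNIV (flat n)"
proof (induction k arbitrary: n)
  case 0
  show ?case using DERIV_continuous[OF flat_has_derivative]
    by (auto intro!: continuous_at_imp_continuous_on)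
next
  case (Suc k)
  have "Ck_on k UNIV (\<lambda>x. flat (n + 2) x + (- real n) * flat (n + 1) x)"
    by (intro Ck_on_add Ck_on_mult Ck_on_const Suc)
  then show ?case by (intro Ck_on_UNIV_real_SucI[OF flat_has_derivative]) simp
qed

text \<open>The usual smooth transition from 0 on x \<le> 0 to 1 on x \<ge> 1. The reciprocal is
  written as a power so that \<open>Ck_on_powr\<close> applies; the denominator is positive because
  x and 1 - x are never both nonpositive.\<close>

definition smooth_step :: "real \<Rightarrow> real" where
  "smooth_step x = flat 0 x * (flat 0 x + flat 0 (1 - x)) powr (- 1)"

lemma flat_nonneg: "0 \<le> flat n x" and flat_pos: "0 < x \<Longrightarrow> 0 < flat n x"
  by (auto simp: flat_def)

lemma smooth_step_denom_pos: "0 < flat 0 x + flat 0 (1 - x)"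
  using flat_nonneg[of 0 x] flat_nonneg[of 0 "1 - x"] flat_pos[of x 0] flat_pos[of "1 - x" 0]
  by (cases "0 < x") auto

lemma smooth_step_0: "x \<le> 0 \<Longrightarrow> smooth_step x = 0"
  and smooth_step_1: "1 \<le> x \<Longrightarrow> smooth_step x = 1"
  and smooth_step_bounds: "0 \<le> smooth_step x" "smooth_step x \<le> 1"
  using smooth_step_denom_pos[of x] flat_nonneg[of 0 x] flat_nonneg[of 0 "1 - x"]
  by (auto simp: smooth_step_def powr_minus_divide flat_def powr_one divide_le_eq abs_of_pos)

lemma smooth_step_smooth: "smooth_on UNIV smooth_step"
proof -
  have "smooth_on UNIV (\<lambda>x. 1 - x :: real)"
    by (intro smooth_on_diff smooth_intros smooth_on_id)
  from smooth_on_compose[OF this] have "smooth_on UNIV (\<lambda>x. flat 0 (1 - x))"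
    by (simp add: smooth_on_def Ck_on_flat)
  then show ?thesis unfolding smooth_step_def[abs_def]
    by (intro smooth_intros smooth_step_denom_pos) (auto simp: smooth_on_def Ck_on_flat)
qed

text \<open>For n > 0 this is a smooth function that vanishes off (c, d) and equals 1 on
  [c + 1/n, d - 1/n]. As n grows it tends to the indicator of the open interval, which lets
  identities for smooth test functions pass to indicators.\<close>

definition bump :: "nat \<Rightarrow> real \<Rightarrow> real \<Rightarrow> real \<Rightarrow> real" where
  "bump n c d t = smooth_step (real n * (t - c)) * smooth_step (real n * (d - t))"

lemma bump_bounds: "0 \<le> bump n c d t" "bump n c d t \<le> 1"
  using smooth_step_bounds by (auto simp: bump_def mult_le_one)

lemma bump_0: "t \<notin> {c<..<d} \<Longrightarrow> bump n c d t = 0"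
proof -
  assume "t \<notin> {c<..<d}"
  then have "real n * (t - c) \<le> 0 \<or> real n * (d - t) \<le> 0" by (auto simp: mult_le_0_iff)
  then show ?thesis by (auto simp: bump_def smooth_step_0)
qed

lemma bump_smooth: "smooth_on UNIV (bump n c d)"
  unfolding bump_def[abs_def]
  by (intro smooth_intros smooth_on_compose[OF _ smooth_step_smooth] smooth_on_diff smooth_on_id)

lemma bump_tendsto: "(\<lambda>n. bump n c d t) \<longlonglongrightarrow> indicator {c<..<d} t"
proof (cases "t \<in> {c<..<d}")
  case True
  then obtain N where N: "real N * min (t - c) (d - t) > 1"
    using ex_less_of_nat_mult[of "min (t - c) (d - t)" 1] by auto
  have "bump n c d t = 1" if "n \<ge> N" for n
  proof -
    have "real N * min (t - c) (d - t) \<le> real n * min (t - c) (d - t)"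
      using that True by (intro mult_right_mono) auto
    also have "\<dots> \<le> real n * (t - c)" "real n * min (t - c) (d - t) \<le> real n * (d - t)" 
      by (auto intro!: mult_left_mono)
    ultimately have "1 \<le> real n * (t - c)" "1 \<le> real n * (d - t)" using N by linarith+
    then show ?thesis by (simp add: bump_def smooth_step_1)
  qed
  then show ?thesis using True
    by (intro tendsto_eventually eventually_sequentiallyI[of N]) auto
next
  case False
  then show ?thesis by (simp add: bump_0)
qed

section \<open>Lebesgue measure on product spaces\<close>

text \<open>Lebesgue measure on a product is not a product measure but the completion of one.
  Completion does not change almost everywhere statements, so they can be sliced over
  \<open>lborel\<close>.\<close>

lemma AE_lebesgue_Pair:
  fixes P :: "'a::euclidean_space \<times> 'b::euclidean_space \<Rightarrow> bool"
  assumes "AE z in lebesgue. P z"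
  shows "AE x in lebesgue. AE y in lebesgue. P (x, y)"
proof -
  have "AE z in lborel \<Otimes>\<^sub>M lborel. P z" using assms by (simp only: AE_completion_iff lborel_prod)
  from lborel_pair.AE_pair[OF this] show ?thesis by (simp add: AE_completion_iff)
qed

text \<open>The functions differ only inside a null set, and every subset of a null set is
  measurable in the completion.\<close>

lemma borel_measurable_completion_AE:
  assumes g: "g \<in> borel_measurable (completion M)" and ae: "AE x in M. f x = g x"
  shows "f \<in> borel_measurable (completion M)"
proof (rule borel_measurableI)
  fix S :: "'b set" assume "open S"
  then have g: "g -` S \<inter> space (completion M) \<in> sets (completion M)"
    by (intro measurable_sets[OF g]) auto
  from AE_completion[OF ae] obtain N where N: "{x \<in> space (completion M). f x \<noteq> g x} \<subseteq> N" "N \<in> null_sets (completion M)"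
    unfolding eventually_ae_filter by blast
  have f: "f -` S \<inter> N \<inter> space (completion M) \<in> sets (completion M)"
    by (rule completion.complete[OF _ N(2)]) auto
  have eq: "f -` S \<inter> space (completion M) = (g -` S \<inter> space (completion M) - N) \<union> (f -` S \<inter> N \<inter> space (completion M))"
    using N(1) by auto
  show "f -` S \<inter> space (completion M) \<in> sets (completion M)"
    unfolding eq by (rule sets.Un[OF sets.Diff[OF g null_setsD2[OF N(2)]] f])
qed

text \<open>Slices of null measure alone say nothing about a nonmeasurable set, so measurability is
  assumed. A Borel version of the indicator then brings the statement within reach of the product
  measure.\<close>

lemma AE_lebesgue_PairI:
  fixes P :: "'a::euclidean_space \<times> 'b::euclidean_space \<Rightarrow> bool"
  assumes "{z. P z} \<in> sets lebesgue" and ae: "AE x in lebesgue. AE y in lebesgue. P (x, y)"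
  shows "AE z in lebesgue. P z"
proof -
  have "indicat_real {z. P z} \<in> borel_measurable lebesgue" using assms(1) by simp
  from completion_ex_borel_measurable_real[OF this]
  obtain g :: "'a \<times> 'b \<Rightarrow> real" where g[measurable]: "g \<in> borel_measurable borel" 
    and eq: "AE z in lborel. indicat_real {z. P z} z = g z" by auto
  have "AE x in lebesgue. AE y in lebesgue. indicat_real {z. P z} (x, y) = g (x, y)"
    using AE_lebesgue_Pair[OF AE_completion[OF eq]] .
  with ae have "AE x in lebesgue. AE y in lebesgue. g (x, y) = 1"
    by eventually_elim (auto simp: indicator_def elim: eventually_elim2)
  then have "AE x in lborel. AE y in lborel. g (x, y) = 1" by (simp add: AE_completion_iff)
  then have "AE z in lborel. g z = 1"
    using lborel_pair.AE_pair_measure[of "\<lambda>z. g z = 1"] unfolding lborel_prod by auto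
  with eq have "AE z in lborel. P z" by eventually_elim (auto simp: indicator_def split: if_splits)
  then show ?thesis by (rule AE_completion)
qed

lemma AE_lebesgue_borel_superset:
  assumes "AE z in lebesgue. P z"
  obtains N :: "'a::euclidean_space set" where "N \<in> sets borel" "\<And>z. z \<notin> N \<Longrightarrow> P z" "AE z in lebesgue. z \<notin> N"
proof -
  have "AE z in lborel. P z" using assms by (simp add: AE_completion_iff)
  then obtain N where N: "N \<in> null_sets lborel" "{z \<in> space lborel. \<not> P z} \<subseteq> N" unfolding eventually_ae_filter by blast
  then have "AE z in lebesgue. z \<notin> N" by (auto intro: AE_completion AE_not_in)
  with N show ?thesis by (intro that[of N]) (auto simp: null_sets_def)
qed

text \<open>Carries bounds that hold at almost every (t, x) over to both space points of almost
  every (t, x, y), as the nonlocal term requires. The exceptional set is enlarged to a Borel null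
  set so that its preimages under the two projections are measurable; slicing in t and then in (x,
  y) shows that they are null.\<close>

lemma AE_lebesgue_triple:
  fixes P :: "'t::euclidean_space \<times> 'a::euclidean_space \<Rightarrow> bool"
  assumes "AE z in lebesgue. P z"
  shows "AE w::'t \<times> 'a \<times> 'a in lebesgue. P (fst w, fst (snd w)) \<and> P (fst w, snd (snd w))"
proof -
  obtain N where N: "N \<in> sets borel" "\<And>z. z \<notin> N \<Longrightarrow> P z" "AE z in lebesgue. z \<notin> N"
    using AE_lebesgue_borel_superset[OF assms] by blast
  have "(\<lambda>w::'t\<times>'a\<times>'a. (fst w, fst (snd w))) \<in> borel_measurable borel"
       "(\<lambda>w::'t\<times>'a\<times>'a. (fst w, snd (snd w))) \<in> borel_measurable borel"
    by (intro borel_measurable_continuous_onI continuous_intros)+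
  then have "{w::'t\<times>'a\<times>'a. (fst w, fst (snd w)) \<notin> N} \<in> sets borel" "{w::'t\<times>'a\<times>'a. (fst w, snd (snd w)) \<notin> N} \<in> sets borel"
    using measurable_sets_borel[OF _ borel_comp[OF N(1)]] by (auto simp: vimage_def)
  then have "{w::'t\<times>'a\<times>'a. (fst w, fst (snd w)) \<notin> N} \<inter> {w. (fst w, snd (snd w)) \<notin> N} \<in> sets borel" by blast
  then have S: "{w::'t\<times>'a\<times>'a. (fst w, fst (snd w)) \<notin> N \<and> (fst w, snd (snd w)) \<notin> N} \<in> sets lebesgue"
    by (auto intro: sets_completionI_sets simp: Int_def)
  have "AE t in lebesgue. AE x in lebesgue. (t, x) \<notin> N" by (rule AE_lebesgue_Pair[OF N(3)])
  then have "AE t in lebesgue. AE w::'a\<times>'a in lebesgue. (t, fst w) \<notin> N \<and> (t, snd w) \<notin> N"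
  proof eventually_elim
    case (elim t)
    have "(\<lambda>w::'a\<times>'a. (t, fst w)) \<in> borel_measurable borel" "(\<lambda>w::'a\<times>'a. (t, snd w)) \<in> borel_measurable borel"
      by (intro borel_measurable_continuous_onI continuous_intros)+
    then have "{w::'a\<times>'a. (t, fst w) \<notin> N} \<in> sets borel" "{w::'a\<times>'a. (t, snd w) \<notin> N} \<in> sets borel"
      using measurable_sets_borel[OF _ borel_comp[OF N(1)]] by (auto simp: vimage_def)
    then have "{w::'a\<times>'a. (t, fst w) \<notin> N} \<inter> {w. (t, snd w) \<notin> N} \<in> sets borel" by blast
    then have S: "{w::'a\<times>'a. (t, fst w) \<notin> N \<and> (t, snd w) \<notin> N} \<in> sets lebesgue"
      by (auto intro: sets_completionI_sets simp: Int_def)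
    show ?case by (rule AE_lebesgue_PairI[OF S]) (use elim in auto)
  qed
  then have "AE t in lebesgue. AE w in lebesgue. (fst (t, w), fst (snd (t, w))) \<notin> N \<and> (fst (t, w), snd (snd (t, w))) \<notin> N"
    by (simp only: fst_conv snd_conv)
  from AE_lebesgue_PairI[OF S this] have AE: "AE w in lebesgue. (fst w, fst (snd w)) \<notin> N \<and> (fst w, snd (snd w)) \<notin> N" .
  show ?thesis
  proof (rule eventually_mono[OF AE])
    fix w assume "(fst w, fst (snd w)) \<notin> N \<and> (fst w, snd (snd w)) \<notin> N"
    then show "P (fst w, fst (snd w)) \<and> P (fst w, snd (snd w))"
      by (intro conjI N(2)) (erule conjunct1 conjunct2)+
  qed
qed

lemma borel_version:
  fixes f :: "'a::euclidean_space \<Rightarrow> real"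
  assumes "f \<in> borel_measurable (lebesgue_on S)" "S \<in> sets lebesgue"
  obtains f' where "f' \<in> borel_measurable borel" "AE x in lebesgue. f' x = indicator S x * f x"
proof -
  have "(\<lambda>x. indicator S x *\<^sub>R f x) \<in> borel_measurable lebesgue"
    using assms(1) by (subst (asm) borel_measurable_restrict_space_iff) (use assms(2) in auto)
  then have "(\<lambda>x. indicator S x * f x) \<in> borel_measurable lebesgue"
    by (simp only: real_scaleR_def)
  from completion_ex_borel_measurable_real[OF this] obtain g
    where g: "g \<in> borel_measurable lborel" "AE x in lborel. indicator S x * f x = g x" by blast
  have "AE x in lebesgue. g x = indicator S x * f x" 
    by (rule eventually_mono[OF AE_completion[OF g(2)]]) (rule sym)
  moreover have "g \<in> borel_measurable borel" using g(1) by simp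
  ultimately show ?thesis using that by blast
qed

text \<open>Serves the measurability in time of spatial norms. A Borel version is inserted because
  the slices of a Lebesgue measurable function are known to be measurable only for almost every
  t.\<close>

lemma borel_measurable_lebesgue_integral_Pair:
  fixes f :: "'t::euclidean_space \<times> 'a::euclidean_space \<Rightarrow> real"
  assumes "f \<in> borel_measurable lebesgue"
  shows "(\<lambda>t. LINT x|lebesgue. f (t, x)) \<in> borel_measurable lebesgue"
proof -
  from completion_ex_borel_measurable_real[OF assms]
  obtain g :: "'t \<times> 'a \<Rightarrow> real" where g[measurable]: "g \<in> borel_measurable borel" 
    and eq: "AE z in lborel. f z = g z" by auto
  have gm: "(\<lambda>x. g (t, x)) \<in> borel_measurable borel" for t
    by (rule measurable_compose[OF _ g]) (intro borel_measurable_continuous_onI continuous_intros)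
  have "(\<lambda>t. LINT x|lborel. g (t, x)) \<in> borel_measurable lborel"
    by (intro lborel.borel_measurable_lebesgue_integral) (unfold case_prod_eta lborel_prod, simp)
  then have 1: "(\<lambda>t. LINT x|lborel. g (t, x)) \<in> borel_measurable lebesgue" by (rule measurable_completion)
  have "AE t in lebesgue. AE x in lebesgue. f (t, x) = g (t, x)"
    using AE_lebesgue_Pair[OF AE_completion[OF eq]] .
  then have "AE t in lebesgue. (LINT x|lebesgue. f (t, x)) = (LINT x|lborel. g (t, x))"
  proof eventually_elim
    case (elim t)
    have gl: "(\<lambda>x. g (t, x)) \<in> borel_measurable lborel" using gm[of t] by simp
    have gc: "(\<lambda>x. g (t, x)) \<in> borel_measurable lebesgue" by (rule measurable_completion[OF gl])
    have "(\<lambda>x. f (t, x)) \<in> borel_measurable lebesgue"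
      by (rule borel_measurable_completion_AE[OF gc]) (use elim in \<open>simp add: AE_completion_iff\<close>)
    from integral_cong_AE[OF this gc elim]
    have "(LINT x|lebesgue. f (t, x)) = (LINT x|lebesgue. g (t, x))" .
    then show ?case using gm by (simp add: integral_completion)
  qed
  then show ?thesis by (intro borel_measurable_completion_AE[OF 1]) (simp add: AE_completion_iff)
qed

section \<open>Test functions\<close>

lemma continuous_compact_support_integrable:
  fixes f :: "'a::euclidean_space \<Rightarrow> 'b::euclidean_space"
  assumes "continuous_on UNIV f" "compact K" "\<And>x. x \<notin> K \<Longrightarrow> f x = 0"
  shows "integrable lebesgue f"
proof -
  have "integrable lborel (\<lambda>x. indicator K x *\<^sub>R f x)"
    using assms by (intro borel_integrable_compact) (auto intro: continuous_on_subset)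
  also have "(\<lambda>x. indicator K x *\<^sub>R f x) = f" using assms(3) by (auto simp: indicator_def)
  finally show ?thesis using integrable_completion[of f lborel] by auto
qed

lemma continuous_compact_support_bounded:
  fixes f :: "'a::euclidean_space \<Rightarrow> 'b::euclidean_space"
  assumes "continuous_on UNIV f" "compact K" "\<And>x. x \<notin> K \<Longrightarrow> f x = 0"
  obtains C where "0 \<le> C" "\<And>x. norm (f x) \<le> C"
proof -
  have "compact (f ` K)" using assms by (intro compact_continuous_image) (auto intro: continuous_on_subset)
  then obtain C where C: "\<And>x. x \<in> K \<Longrightarrow> norm (f x) \<le> C" 
    by (meson bounded_iff compact_imp_bounded image_eqI)
  show ?thesis by (rule that[of "max 0 C"]) (use C assms(3) in \<open>force simp: le_max_iff_disj\<close>)+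
qed

lemma grad_eq_0:
  assumes "x \<notin> closure {x. \<psi> x \<noteq> 0}" shows "grad \<psi> x = 0"
proof (rule grad_eqI)
  have "((\<lambda>x. 0) has_derivative (\<lambda>h. 0 \<bullet> h)) (at x)" by simp
  then show "(\<psi> has_derivative (\<lambda>h. 0 \<bullet> h)) (at x)"
    by (rule has_derivative_transform_within_open[where s = "- closure {x. \<psi> x \<noteq> 0}"])
      (use assms closure_subset[of "{x. \<psi> x \<noteq> 0}"] in auto)
qed

lemma test_functionsD:
  assumes "\<psi> \<in> test_functions S"
  shows "smooth_on UNIV \<psi>" "compact (closure {x. \<psi> x \<noteq> 0})" "closure {x. \<psi> x \<noteq> 0} \<subseteq> S"
    "x \<notin> closure {x. \<psi> x \<noteq> 0} \<Longrightarrow> \<psi> x = 0" "x \<notin> S \<Longrightarrow> \<psi> x = 0"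
  using assms closure_subset[of "{x. \<psi> x \<noteq> 0}"] by (auto simp: test_functions_def)

lemma test_functions_support:
  assumes "\<psi> \<in> test_functions S"
  obtains K where "compact K" "K \<subseteq> S" "\<And>x. x \<notin> K \<Longrightarrow> \<psi> x = 0" "\<And>x. x \<notin> K \<Longrightarrow> grad \<psi> x = 0"
  by (rule that[OF test_functionsD(2)[OF assms] test_functionsD(3)[OF assms] test_functionsD(4)[OF assms] grad_eq_0])

lemma test_functionsI:
  assumes "smooth_on UNIV \<psi>" "compact K" "K \<subseteq> S" "\<And>x. x \<notin> K \<Longrightarrow> \<psi> x = 0"
  shows "\<psi> \<in> test_functions S"
proof -
  have "closure {x. \<psi> x \<noteq> 0} \<subseteq> K"
    using assms by (intro closure_minimal) (auto intro: compact_imp_closed)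
  then have "compact (closure {x. \<psi> x \<noteq> 0})"
    using assms(2) by (meson bounded_closure bounded_subset closed_closure compact_eq_bounded_closed)
  with \<open>closure _ \<subseteq> K\<close> assms show ?thesis by (auto simp: test_functions_def)
qed

text \<open>Difference quotients in direction \<open>b\<close> integrate to zero by translation
  invariance, and they converge to the directional derivative. This treats all directions at once,
  without iterated integration along coordinates.\<close>

lemma integral_grad_test:
  fixes w :: "'a::euclidean_space \<Rightarrow> real"
  assumes w: "w \<in> test_functions UNIV"
  shows "(LINT x|lborel. grad w x \<bullet> b) = 0"
proof -
  note smooth = test_functionsD(1)[OF w]
  obtain K where K: "compact K" "\<And>x. x \<notin> K \<Longrightarrow> w x = 0" "\<And>x. x \<notin> K \<Longrightarrow> grad w x = 0"
    by (rule test_functions_support[OF w]) blast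
  obtain C where C: "0 \<le> C" "\<And>x. norm (grad w x) \<le> C"
    using continuous_compact_support_bounded[OF grad_continuous[OF smooth] K(1,3)] by blast
  obtain R where R: "K \<subseteq> cball 0 R" using bounded_subset_ballD[OF compact_imp_bounded[OF K(1)], of 0] ball_subset_cball by blast
  define d where "d n x = (w (x + b /\<^sub>R real (Suc n)) - w x) * real (Suc n)" for n x
  have [measurable]: "w \<in> borel_measurable borel"
    by (intro borel_measurable_continuous_onI smooth_on_continuous smooth)
  have [measurable]: "grad w \<in> borel_measurable borel"
    by (intro borel_measurable_continuous_onI grad_continuous smooth)
  have int: "integrable lborel w"
    using continuous_compact_support_integrable[OF smooth_on_continuous[OF smooth] K(1,2)]
      integrable_completion[of w lborel] by simp
  have shift: "integrable lborel (\<lambda>x. w (x + c))" "(LINT x|lborel. w (x + c)) = (LINT x|lborel. w x)" for c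
  proof -
    have eq: "(\<lambda>x. w (x + c)) = (\<lambda>x. w (c + x))" by (simp add: add.commute)
    have "integrable (distr lborel borel ((+) c)) w" using int by (simp add: lborel_distr_plus)
    then show "integrable lborel (\<lambda>x. w (x + c))" unfolding eq by (subst (asm) integrable_distr_eq) auto
    have "(LINT x|distr lborel borel ((+) c). w x) = (LINT x|lborel. w (c + x))" by (rule integral_distr) auto
    then show "(LINT x|lborel. w (x + c)) = (LINT x|lborel. w x)" unfolding eq by (simp add: lborel_distr_plus)
  qed
  have "(\<lambda>n. LINT x|lborel. d n x) \<longlonglongrightarrow> (LINT x|lborel. grad w x \<bullet> b)"
  \<comment> \<open>The mean value inequality bounds the quotients by C |b|. They vanish outside the
    ball of radius R + |b| because the steps b/(n + 1) are no longer than b.\<close>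
  proof (rule integral_dominated_convergence[where w = "\<lambda>x. indicator (cball 0 (R + norm b)) x * (C * norm b)"])
    show "integrable lborel (\<lambda>x::'a. indicator (cball 0 (R + norm b)) x * (C * norm b))"
      by (intro integrable_mult_left integrable_real_indicator emeasure_lborel_cball_finite) simp
    show "AE x in lborel. (\<lambda>n. d n x) \<longlonglongrightarrow> grad w x \<bullet> b"
    proof (intro AE_I2)
      fix x
      have "((\<lambda>t. x + t *\<^sub>R b) has_derivative (\<lambda>t. t *\<^sub>R b)) (at (0::real))"
        by (auto intro!: derivative_eq_intros)
      from has_derivative_compose[OF this, of w "\<lambda>h. grad w x \<bullet> h"] smooth_on_has_derivative_grad[OF smooth, of x]
      have "((\<lambda>t. w (x + t *\<^sub>R b)) has_real_derivative grad w x \<bullet> b) (at 0)"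
        by (simp add: has_field_derivative_def mult_commute_abs)
      then have "((\<lambda>h. (w (x + h *\<^sub>R b) - w x) / h) \<longlongrightarrow> grad w x \<bullet> b) (at 0)"
        by (simp add: DERIV_def)
      moreover have "filterlim (\<lambda>n. inverse (real (Suc n))) (at 0) sequentially"
        using LIMSEQ_inverse_real_of_nat by (intro filterlim_atI) auto
      ultimately have "(\<lambda>n. (w (x + inverse (real (Suc n)) *\<^sub>R b) - w x) / inverse (real (Suc n))) \<longlonglongrightarrow> grad w x \<bullet> b"
        by (rule filterlim_compose)
      then show "(\<lambda>n. d n x) \<longlonglongrightarrow> grad w x \<bullet> b" by (simp add: d_def divide_inverse)
    qed
    show "AE x in lborel. norm (d n x) \<le> indicator (cball 0 (R + norm b)) x * (C * norm b)" for n
    proof (intro AE_I2)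
      fix x
      have b: "norm (b /\<^sub>R real (Suc n)) \<le> norm b"
        using mult_left_mono[of 1 "1 + real n" "norm b"] by (simp add: divide_simps)
      show "norm (d n x) \<le> indicator (cball 0 (R + norm b)) x * (C * norm b)"
      proof (cases "x \<in> cball 0 (R + norm b)")
        case True
        have "norm (w (x + b /\<^sub>R real (Suc n)) - w x) \<le> C * norm (x + b /\<^sub>R real (Suc n) - x)"
        proof (rule differentiable_bound[OF convex_UNIV])
          show "(w has_derivative (\<lambda>h. grad w y \<bullet> h)) (at y within UNIV)" for y
            by (rule smooth_on_has_derivative_grad[OF smooth])
          show "onorm (\<lambda>h. grad w y \<bullet> h) \<le> C" for y
            using order_trans[OF Cauchy_Schwarz_ineq2 mult_right_mono[OF C(2) norm_ge_zero]] by (intro onorm_le) simp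
        qed auto
        then have "norm (d n x) \<le> C * norm (b /\<^sub>R real (Suc n)) * real (Suc n)"
          by (simp add: d_def abs_mult mult_right_mono del: of_nat_Suc)
        also have "\<dots> = C * norm b" by (simp del: of_nat_Suc)
        finally show ?thesis using True by simp
      next
        case False
        then have "norm x > R + norm b" by simp
        then have "x \<notin> K" "x + b /\<^sub>R real (Suc n) \<notin> K"
          using R b norm_triangle_ineq4[of "x + b /\<^sub>R real (Suc n)" "b /\<^sub>R real (Suc n)"] norm_ge_zero[of b]
          by (auto simp del: norm_ge_zero of_nat_Suc dest!: subsetD)
        then show ?thesis using False K(2) by (simp add: d_def)
      qed
    qed
  qed (auto simp: d_def)
  moreover have "(LINT x|lborel. d n x) = 0" for n
    unfolding d_def using shift int by simp
  ultimately show ?thesis by (simp add: LIMSEQ_const_iff)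
qed

text \<open>The product has compact support because \<theta> has, so the gradient of the product
  integrates to zero in every direction.\<close>

lemma test_integration_by_parts:
  fixes \<psi> \<theta> :: "'a::euclidean_space \<Rightarrow> real"
  assumes \<psi>: "smooth_on UNIV \<psi>" and \<theta>: "\<theta> \<in> test_functions UNIV"
  shows "(LINT x|lebesgue. \<psi> x *\<^sub>R grad \<theta> x) = - (LINT x|lebesgue. \<theta> x *\<^sub>R grad \<psi> x)"
proof -
  note s = \<psi> test_functionsD(1)[OF \<theta>]
  obtain K where K: "compact K" "\<And>x. x \<notin> K \<Longrightarrow> \<theta> x = 0" "\<And>x. x \<notin> K \<Longrightarrow> grad \<theta> x = 0"
    by (rule test_functions_support[OF \<theta>]) blast
  have w: "(\<lambda>x. \<psi> x * \<theta> x) \<in> test_functions UNIV"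
    using s K by (intro test_functionsI[where K = K] smooth_intros) auto
  have gr: "grad (\<lambda>x. \<psi> x * \<theta> x) x = \<psi> x *\<^sub>R grad \<theta> x + \<theta> x *\<^sub>R grad \<psi> x" for x
    using has_derivative_mult[OF s[THEN smooth_on_has_derivative_grad]]
    by (intro grad_eqI) (simp add: inner_add_left algebra_simps)
  have i: "integrable lebesgue (\<lambda>x. \<psi> x *\<^sub>R grad \<theta> x)" "integrable lebesgue (\<lambda>x. \<theta> x *\<^sub>R grad \<psi> x)"
    using K by (intro continuous_compact_support_integrable[where K = K] continuous_intros smooth_on_continuous grad_continuous s; simp)+
  have "(LINT x|lebesgue. grad (\<lambda>x. \<psi> x * \<theta> x) x) \<bullet> b = 0" for b
  proof -
    have i': "integrable lebesgue (grad (\<lambda>x. \<psi> x * \<theta> x))" using i by (simp add: gr[abs_def])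
    have m: "grad (\<lambda>x. \<psi> x * \<theta> x) \<in> borel_measurable borel"
      by (intro borel_measurable_continuous_onI grad_continuous test_functionsD(1)[OF w])
    have "(LINT x|lebesgue. grad (\<lambda>x. \<psi> x * \<theta> x) x) \<bullet> b = (LINT x|lebesgue. grad (\<lambda>x. \<psi> x * \<theta> x) x \<bullet> b)"
      by (rule integral_inner_left[symmetric]) (use i' in auto)
    also have "\<dots> = (LINT x|lborel. grad (\<lambda>x. \<psi> x * \<theta> x) x \<bullet> b)"
      using m by (intro integral_completion) simp
    finally show ?thesis using integral_grad_test[OF w] by simp
  qed
  then have "(LINT x|lebesgue. grad (\<lambda>x. \<psi> x * \<theta> x) x) = 0" by (metis inner_eq_zero_iff)
  then show ?thesis using i by (simp add: gr add_eq_0_iff)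
qed

section \<open>Convergence in $L^p$\<close>

lemma Lp_space_UNIV:
  "f \<in> Lp_space p UNIV \<longleftrightarrow> f \<in> borel_measurable lebesgue \<and> integrable lebesgue (\<lambda>x. norm (f x) powr p)"
  by (simp add: Lp_space_def lebesgue_on_UNIV_eq)

lemma powr_norm_add_le:
  fixes a b :: "'a::real_normed_vector"
  assumes "0 \<le> p" shows "norm (a + b) powr p \<le> 2 powr p * (norm a powr p + norm b powr p)"
proof -
  have "norm (a + b) powr p \<le> (2 * max (norm a) (norm b)) powr p"
    using norm_triangle_ineq[of a b] assms by (intro powr_mono2) auto
  also have "\<dots> = 2 powr p * max (norm a powr p) (norm b powr p)"
    using assms by (auto simp: powr_mult max_def powr_mono2 antisym)
  also have "\<dots> \<le> 2 powr p * (norm a powr p + norm b powr p)" by (intro mult_left_mono) auto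
  finally show ?thesis .
qed

text \<open>The single estimate behind sums, differences, bounded multiples and limits in L^p:
  pointwise domination up to a constant, with the crude factor \<open>2 powr p\<close> taking the
  place of Minkowski's inequality.\<close>

lemma Lp_space_bound:
  fixes h :: "'a::euclidean_space \<Rightarrow> 'b::euclidean_space" and f :: "'a \<Rightarrow> 'c::euclidean_space" and g :: "'a \<Rightarrow> 'd::euclidean_space"
  assumes f: "f \<in> Lp_space p UNIV" and g: "g \<in> Lp_space p UNIV" and h: "h \<in> borel_measurable lebesgue"
    and p: "0 \<le> p" and C: "0 \<le> C" and le: "\<And>x. norm (h x) \<le> C * (norm (f x) + norm (g x))"
  shows "h \<in> Lp_space p UNIV"
    and "(LINT x|lebesgue. norm (h x) powr p) \<le> (2 * C) powr p * ((LINT x|lebesgue. norm (f x) powr p) + (LINT x|lebesgue. norm (g x) powr p))"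
proof -
  have b: "norm (h x) powr p \<le> (2 * C) powr p * (norm (f x) powr p + norm (g x) powr p)" for x
  proof -
    have "norm (h x) powr p \<le> (C * (norm (f x) + norm (g x))) powr p" using le p by (intro powr_mono2) auto
    also have "\<dots> = C powr p * norm (norm (f x) + norm (g x)) powr p" using C by (simp add: powr_mult)
    also have "\<dots> \<le> C powr p * (2 powr p * (norm (norm (f x)) powr p + norm (norm (g x)) powr p))"
      by (intro mult_left_mono powr_norm_add_le p) auto
    finally show ?thesis using C by (simp add: powr_mult algebra_simps)
  qed
  have i: "integrable lebesgue (\<lambda>x. (2 * C) powr p * (norm (f x) powr p + norm (g x) powr p))"
    using f g by (simp add: Lp_space_UNIV)
  then have i': "integrable lebesgue (\<lambda>x. norm (h x) powr p)"
    using h b by (rule_tac Bochner_Integration.integrable_bound[OF i]) (auto intro!: AE_I2)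
  then show "h \<in> Lp_space p UNIV" using h by (simp add: Lp_space_UNIV)
  have "(LINT x|lebesgue. norm (h x) powr p) \<le> (LINT x|lebesgue. (2 * C) powr p * (norm (f x) powr p + norm (g x) powr p))"
    by (intro integral_mono i i' b)
  then show "(LINT x|lebesgue. norm (h x) powr p) \<le> (2 * C) powr p * ((LINT x|lebesgue. norm (f x) powr p) + (LINT x|lebesgue. norm (g x) powr p))"
    using f g by (simp add: Lp_space_UNIV)
qed

lemma Lp_space_diff:
  assumes f: "f \<in> Lp_space p UNIV" and g: "g \<in> Lp_space p UNIV" and p: "0 \<le> p"
  shows "(\<lambda>x. f x - g x) \<in> Lp_space p UNIV"
proof (rule Lp_space_bound(1)[OF f g _ p zero_le_one])
  show "(\<lambda>x. f x - g x) \<in> borel_measurable lebesgue"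
    using f g by (intro borel_measurable_diff) (simp_all add: Lp_space_UNIV)
  show "norm (f x - g x) \<le> 1 * (norm (f x) + norm (g x))" for x
    by (simp add: norm_triangle_ineq4)
qed

lemma Lp_space_add:
  assumes f: "f \<in> Lp_space p UNIV" and g: "g \<in> Lp_space p UNIV" and p: "0 \<le> p"
  shows "(\<lambda>x. f x + g x) \<in> Lp_space p UNIV"
proof (rule Lp_space_bound(1)[OF f g _ p zero_le_one])
  show "(\<lambda>x. f x + g x) \<in> borel_measurable lebesgue"
    using f g by (intro borel_measurable_add) (simp_all add: Lp_space_UNIV)
  show "norm (f x + g x) \<le> 1 * (norm (f x) + norm (g x))" for x
    by (simp add: norm_triangle_ineq)
qed

lemma Lp_space_scaleR:
  assumes "f \<in> Lp_space p UNIV" "c \<in> borel_measurable lebesgue" "\<And>x. \<bar>c x\<bar> \<le> C" "0 \<le> p"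
  shows "(\<lambda>x. c x *\<^sub>R f x) \<in> Lp_space p UNIV"
proof -
  have C: "0 \<le> C" by (rule order_trans[OF abs_ge_zero assms(3)])
  have m: "(\<lambda>x. c x *\<^sub>R f x) \<in> borel_measurable lebesgue"
    using assms(1,2) by (intro borel_measurable_scaleR) (simp_all add: Lp_space_UNIV)
  have le: "norm (c x *\<^sub>R f x) \<le> C * (norm (f x) + norm (f x))" for x
  proof -
    have "norm (c x *\<^sub>R f x) \<le> C * norm (f x)" using assms(3)[of x] by (simp add: mult_right_mono)
    also have "\<dots> \<le> C * (norm (f x) + norm (f x))" using C by (intro mult_left_mono) auto
    finally show ?thesis .
  qed
  show ?thesis by (rule Lp_space_bound(1)[OF assms(1,1) m assms(4) C le])
qed

text \<open>Convergence is measured by the p-th power of the norm, which spares roots; additivity up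
  to a constant is enough for limits. The codomain is Euclidean so that functions and gradients are
  treated alike.\<close>

definition Lp_tendsto ::
  "real \<Rightarrow> (nat \<Rightarrow> 'a::euclidean_space \<Rightarrow> 'b::euclidean_space) \<Rightarrow> ('a \<Rightarrow> 'b) \<Rightarrow> bool" where
  "Lp_tendsto p F f \<longleftrightarrow> (\<forall>n. F n \<in> Lp_space p UNIV) \<and> f \<in> Lp_space p UNIV \<and>
     (\<lambda>n. LINT x|lebesgue. norm (F n x - f x) powr p) \<longlonglongrightarrow> 0"

lemma Lp_tendsto_bound:
  fixes H :: "nat \<Rightarrow> 'a::euclidean_space \<Rightarrow> 'b::euclidean_space"
  assumes "Lp_tendsto p F f" "Lp_tendsto p G g"
    and h: "\<And>n. H n \<in> Lp_space p UNIV" "h \<in> Lp_space p UNIV" and p: "0 \<le> p" and C: "0 \<le> C"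
    and le: "\<And>n x. norm (H n x - h x) \<le> C * (norm (F n x - f x) + norm (G n x - g x))"
  shows "Lp_tendsto p H h"
  unfolding Lp_tendsto_def
proof (intro conjI allI h)
  have "(\<lambda>n. (2 * C) powr p * ((LINT x|lebesgue. norm (F n x - f x) powr p) + (LINT x|lebesgue. norm (G n x - g x) powr p)))
     \<longlonglongrightarrow> (2 * C) powr p * (0 + 0)"
    using assms by (intro tendsto_intros) (auto simp: Lp_tendsto_def)
  then show "(\<lambda>n. LINT x|lebesgue. norm (H n x - h x) powr p) \<longlonglongrightarrow> 0"
  proof (rule Lim_null_comparison[rotated, OF tendsto_eq_rhs])
    show "\<forall>\<^sub>F n in sequentially. norm (LINT x|lebesgue. norm (H n x - h x) powr p) \<le>
      (2 * C) powr p * ((LINT x|lebesgue. norm (F n x - f x) powr p) + (LINT x|lebesgue. norm (G n x - g x) powr p))"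
    proof (intro always_eventually allI)
      fix n
      have m: "(\<lambda>x. H n x - h x) \<in> borel_measurable lebesgue"
        using h(1)[of n] h(2) by (intro borel_measurable_diff) (simp_all add: Lp_space_UNIV)
      show "norm (LINT x|lebesgue. norm (H n x - h x) powr p) \<le>
      (2 * C) powr p * ((LINT x|lebesgue. norm (F n x - f x) powr p) + (LINT x|lebesgue. norm (G n x - g x) powr p))"
        using Lp_space_bound(2)[of "\<lambda>x. F n x - f x" p "\<lambda>x. G n x - g x", OF _ _ m p C le] assms(1,2) p
        by (auto simp: Lp_tendsto_def intro!: Lp_space_diff)
    qed
  qed simp
qed

lemma Lp_tendsto_add:
  assumes "Lp_tendsto p F f" "Lp_tendsto p G g" "0 \<le> p"
  shows "Lp_tendsto p (\<lambda>n x. F n x + G n x) (\<lambda>x. f x + g x)"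
  by (rule Lp_tendsto_bound[OF assms(1,2), where C = 1])
    (use assms norm_triangle_ineq in \<open>auto simp: Lp_tendsto_def add_diff_add intro!: Lp_space_add\<close>)

lemma Lp_tendsto_subseq: "Lp_tendsto p F f \<Longrightarrow> strict_mono r \<Longrightarrow> Lp_tendsto p (\<lambda>n. F (r n)) f"
  unfolding Lp_tendsto_def using LIMSEQ_subseq_LIMSEQ[of "\<lambda>n. LINT x|lebesgue. norm (F n x - f x) powr p" 0 r]
  by (auto simp: o_def)

text \<open>The p-th powers of the differences tend to 0 in L^1, hence almost everywhere along a
  subsequence; the p-th root then gives the differences themselves.\<close>

lemma Lp_tendsto_AE_subseq:
  assumes F: "Lp_tendsto p F f" and p: "0 < p"
  obtains r :: "nat \<Rightarrow> nat" where "strict_mono r" "AE x in lebesgue. (\<lambda>n. F (r n) x) \<longlonglongrightarrow> f x"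
proof -
  have "(\<lambda>x. F n x - f x) \<in> Lp_space p UNIV" for n
    using F p by (intro Lp_space_diff) (auto simp: Lp_tendsto_def)
  then have "\<exists>r::nat\<Rightarrow>nat. strict_mono r \<and> (AE x in lebesgue. (\<lambda>n. norm (F (r n) x - f x) powr p) \<longlonglongrightarrow> 0)"
    using F by (intro tendsto_L1_AE_subseq) (auto simp: Lp_tendsto_def Lp_space_UNIV)
  then obtain r where r: "strict_mono r" "AE x in lebesgue. (\<lambda>n. norm (F (r n) x - f x) powr p) \<longlonglongrightarrow> 0" by blast
  from r(2) have "AE x in lebesgue. (\<lambda>n. F (r n) x) \<longlonglongrightarrow> f x"
  proof eventually_elim
    case (elim x)
    have "(\<lambda>n. (norm (F (r n) x - f x) powr p) powr (1 / p)) \<longlonglongrightarrow> 0 powr (1 / p)"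
      using p by (intro tendsto_powr'[OF elim tendsto_const]) auto
    then have "(\<lambda>n. norm (F (r n) x - f x)) \<longlonglongrightarrow> 0" using p by (simp add: powr_powr)
    then show ?case using LIM_zero_cancel tendsto_norm_zero_iff by blast
  qed
  with r(1) that show ?thesis by blast
qed

text \<open>Split the difference into c (F - f) and (c - d) f along the sequence: the first part is
  small because the factors are bounded, the second by dominated convergence. In the chain rule the
  factors are derivatives of the outer function, which converge only almost everywhere.\<close>

lemma Lp_tendsto_scaleR:
  assumes F: "Lp_tendsto p F f" and p: "0 < p"
    and c: "\<And>n. c n \<in> borel_measurable lebesgue" "d \<in> borel_measurable lebesgue"
    and C: "\<And>n x. \<bar>c n x\<bar> \<le> C" "\<And>x. \<bar>d x\<bar> \<le> C"
    and lim: "AE x in lebesgue. (\<lambda>n. c n x) \<longlonglongrightarrow> d x"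
  shows "Lp_tendsto p (\<lambda>n x. c n x *\<^sub>R F n x) (\<lambda>x. d x *\<^sub>R f x)"
proof -
  have C0: "0 \<le> C" by (rule order_trans[OF abs_ge_zero C(2)])
  note Lp = F[unfolded Lp_tendsto_def]
  have f: "f \<in> borel_measurable lebesgue" "integrable lebesgue (\<lambda>x. norm (f x) powr p)"
    using Lp by (auto simp: Lp_space_UNIV)
  have "(\<lambda>n. LINT x|lebesgue. norm (c n x *\<^sub>R f x - d x *\<^sub>R f x) powr p) \<longlonglongrightarrow> (LINT x|(lebesgue::'a measure). 0)"
  proof (rule integral_dominated_convergence[where w = "\<lambda>x. (2 * C) powr p * norm (f x) powr p"])
    show "AE x in lebesgue. (\<lambda>n. norm (c n x *\<^sub>R f x - d x *\<^sub>R f x) powr p) \<longlonglongrightarrow> 0"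
      using lim
    proof eventually_elim
      case (elim x)
      have "(\<lambda>n. norm (c n x *\<^sub>R f x - d x *\<^sub>R f x) powr p) \<longlonglongrightarrow> norm (d x *\<^sub>R f x - d x *\<^sub>R f x) powr p"
        using p by (intro tendsto_powr' tendsto_intros elim) auto
      then show ?case by simp
    qed
    show "AE x in lebesgue. norm (norm (c n x *\<^sub>R f x - d x *\<^sub>R f x) powr p) \<le> (2 * C) powr p * norm (f x) powr p" for n
    proof (intro AE_I2)
      fix x
      have "norm (c n x *\<^sub>R f x - d x *\<^sub>R f x) = \<bar>c n x - d x\<bar> * norm (f x)"
        by (metis norm_scaleR scaleR_left_diff_distrib)
      also have "\<dots> \<le> 2 * C * norm (f x)" using C(1)[of n x] C(2)[of x] by (intro mult_right_mono) auto
      finally have "norm (c n x *\<^sub>R f x - d x *\<^sub>R f x) powr p \<le> (2 * C * norm (f x)) powr p"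
        using p by (intro powr_mono2) auto
      then show "norm (norm (c n x *\<^sub>R f x - d x *\<^sub>R f x) powr p) \<le> (2 * C) powr p * norm (f x) powr p"
        using C0 by (simp add: powr_mult)
    qed
  qed (use c f in auto)
  then have 1: "Lp_tendsto p (\<lambda>n x. c n x *\<^sub>R f x) (\<lambda>x. d x *\<^sub>R f x)"
    unfolding Lp_tendsto_def using Lp c C p by (auto intro!: Lp_space_scaleR)
  show ?thesis
  proof (rule Lp_tendsto_bound[OF F 1, where C = "max 1 C"])
    fix n x
    have "norm (c n x *\<^sub>R F n x - d x *\<^sub>R f x) \<le> norm (c n x *\<^sub>R (F n x - f x)) + norm (c n x *\<^sub>R f x - d x *\<^sub>R f x)"
      using norm_triangle_ineq[of "c n x *\<^sub>R (F n x - f x)" "c n x *\<^sub>R f x - d x *\<^sub>R f x"] by (simp add: algebra_simps)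
    also have "\<dots> \<le> max 1 C * norm (F n x - f x) + max 1 C * norm (c n x *\<^sub>R f x - d x *\<^sub>R f x)"
      using C(1)[of n x] mult_right_mono[of 1 "max 1 C" "norm (c n x *\<^sub>R f x - d x *\<^sub>R f x)"]
      by (intro add_mono) (auto intro!: mult_right_mono)
    finally show "norm (c n x *\<^sub>R F n x - d x *\<^sub>R f x) \<le> max 1 C * (norm (F n x - f x) + norm (c n x *\<^sub>R f x - d x *\<^sub>R f x))"
      by (simp add: algebra_simps)
  qed (use Lp c C p in \<open>auto intro!: Lp_space_scaleR\<close>)
qed

text \<open>In place of Hoelder's inequality, the elementary bound
  \<open>a \<le> \<delta> + \<delta> powr (1 - p) * a powr p\<close> is integrated over K. Choosing
  \<delta> small before taking n large gives the limit.\<close>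

lemma Lp_tendsto_L1_local:
  assumes F: "Lp_tendsto p F f" and p: "1 < p" and K: "compact K"
  shows "\<And>n. integrable lebesgue (\<lambda>x. indicator K x * norm (F n x - f x))"
    and "integrable lebesgue (\<lambda>x. indicator K x * norm (f x))"
    and "(\<lambda>n. LINT x|lebesgue. indicator K x * norm (F n x - f x)) \<longlonglongrightarrow> 0"
proof -
  have young: "a \<le> \<delta> + \<delta> powr (1 - p) * a powr p" if "0 \<le> a" "0 < \<delta>" for a \<delta> :: real
  proof (cases "a \<le> \<delta>")
    case False
    then have "a = a powr (1 - p) * a powr p" using that by (simp flip: powr_add)
    also have "\<dots> \<le> \<delta> powr (1 - p) * a powr p"
      using False that p by (intro mult_right_mono powr_mono2') auto
    finally show ?thesis using that by simp
  qed (use that in \<open>auto intro: add_increasing2\<close>)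
  have K': "integrable lebesgue (indicat_real K)" "K \<in> sets lebesgue"
    using fmeasurableD[OF lmeasurable_compact[OF K]] fmeasurableD2[OF lmeasurable_compact[OF K]]
    by (auto simp: less_top)
  have main: "integrable lebesgue (\<lambda>x. indicator K x * norm (h x))"
       "(LINT x|lebesgue. indicator K x * norm (h x)) \<le> \<delta> * measure lebesgue K + \<delta> powr (1 - p) * (LINT x|lebesgue. norm (h x) powr p)"
    if h: "h \<in> Lp_space p UNIV" and d: "0 < \<delta>" for h :: "'a \<Rightarrow> 'b" and \<delta>
  proof -
    have b: "indicator K x * norm (h x) \<le> \<delta> * indicator K x + \<delta> powr (1 - p) * norm (h x) powr p" for x
      using young[of "norm (h x)" \<delta>] d by (auto simp: indicator_def)
    have i: "integrable lebesgue (\<lambda>x. \<delta> * indicator K x + \<delta> powr (1 - p) * norm (h x) powr p)"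
      using h K' by (auto simp: Lp_space_UNIV)
    show i': "integrable lebesgue (\<lambda>x. indicator K x * norm (h x))"
      using h b K' by (intro Bochner_Integration.integrable_bound[OF i]) (auto simp: Lp_space_UNIV intro!: AE_I2 order_trans[OF _ abs_ge_self])
    have "(LINT x|lebesgue. indicator K x * norm (h x)) \<le> (LINT x|lebesgue. \<delta> * indicator K x + \<delta> powr (1 - p) * norm (h x) powr p)"
      by (intro integral_mono i i' b)
    also have "\<dots> = \<delta> * measure lebesgue K + \<delta> powr (1 - p) * (LINT x|lebesgue. norm (h x) powr p)"
      using h K' by (simp add: Lp_space_UNIV)
    finally show "(LINT x|lebesgue. indicator K x * norm (h x)) \<le> \<delta> * measure lebesgue K + \<delta> powr (1 - p) * (LINT x|lebesgue. norm (h x) powr p)" .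
  qed
  have Lp: "(\<lambda>x. F n x - f x) \<in> Lp_space p UNIV" "f \<in> Lp_space p UNIV" for n
    using F p by (auto intro!: Lp_space_diff simp: Lp_tendsto_def)
  show "integrable lebesgue (\<lambda>x. indicator K x * norm (F n x - f x))" for n
    by (rule main(1)[OF Lp(1) zero_less_one])
  show "integrable lebesgue (\<lambda>x. indicator K x * norm (f x))" by (rule main(1)[OF Lp(2) zero_less_one])
  show "(\<lambda>n. LINT x|lebesgue. indicator K x * norm (F n x - f x)) \<longlonglongrightarrow> 0"
  proof (rule LIMSEQ_I)
    fix e :: real assume e: "0 < e"
    \<comment> \<open>The summand 1 keeps M positive when K is a null set and makes \<delta> times
      the measure of K strictly smaller than e/2.\<close>
    define M where "M = measure lebesgue K + 1"
    define \<delta> where "\<delta> = e / 2 / M"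
    have m: "0 < M" unfolding M_def by (rule add_nonneg_pos) auto
    then have "0 < \<delta>" "\<delta> * M = e / 2" using e by (simp_all add: \<delta>_def)
    then have d: "0 < \<delta>" "\<delta> * measure lebesgue K < e / 2" by (auto simp: algebra_simps M_def)
    have "(\<lambda>n. \<delta> * measure lebesgue K + \<delta> powr (1 - p) * (LINT x|lebesgue. norm (F n x - f x) powr p))
       \<longlonglongrightarrow> \<delta> * measure lebesgue K + \<delta> powr (1 - p) * 0"
      using F by (intro tendsto_intros) (simp add: Lp_tendsto_def)
    from order_tendstoD(2)[OF this, of e] d e obtain N where 
      "\<And>n. n \<ge> N \<Longrightarrow> \<delta> * measure lebesgue K + \<delta> powr (1 - p) * (LINT x|lebesgue. norm (F n x - f x) powr p) < e"
      by (auto simp: eventually_sequentially)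
    then have "norm ((LINT x|lebesgue. indicator K x * norm (F n x - f x)) - 0) < e" if "n \<ge> N" for n
      using main(2)[OF Lp(1)[of n] d(1)] that by (fastforce intro!: integral_nonneg)
    then show "\<exists>N. \<forall>n\<ge>N. norm ((LINT x|lebesgue. indicator K x * norm (F n x - f x)) - 0) < e" by blast
  qed
qed

text \<open>A general bilinear product lets one lemma serve both sides of the weak gradient
  identity: a converging scalar times a fixed vector field, and a fixed scalar times a converging
  vector field.\<close>

lemma Lp_tendsto_integral_bilinear:
  fixes prod :: "'b::euclidean_space \<Rightarrow> 'c::euclidean_space \<Rightarrow> 'd::euclidean_space" 
  assumes B: "bounded_bilinear prod"
    and F: "Lp_tendsto p F f" and p: "1 < p" and K: "compact K"
    and g: "continuous_on UNIV g" "\<And>x. x \<notin> K \<Longrightarrow> g x = 0"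
  shows "(\<lambda>n. LINT x|lebesgue. prod (F n x) (g x)) \<longlonglongrightarrow> (LINT x|lebesgue. prod (f x) (g x))"
proof -
  interpret bounded_bilinear prod by fact
  obtain C where C: "0 \<le> C" "\<And>x. norm (g x) \<le> C"
    using continuous_compact_support_bounded[OF g(1) K g(2)] by blast
  obtain M where M: "0 < M" "\<And>a b. norm (prod a b) \<le> norm a * norm b * M" using pos_bounded by blast
  have "g \<in> borel_measurable lborel" using borel_measurable_continuous_onI[OF g(1)] by simp
  then have gm: "g \<in> borel_measurable lebesgue" by (rule measurable_completion)
  have pm: "(\<lambda>x. prod (h x) (g x)) \<in> borel_measurable lebesgue" if "h \<in> borel_measurable lebesgue" for h
    by (rule borel_measurable_continuous_Pair[OF that gm])
      (intro continuous_on continuous_intros)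
  have b: "norm (prod (h x) (g x)) \<le> C * M * (indicator K x * norm (h x))" for h x
  proof (cases "x \<in> K")
    case True
    have "norm (prod (h x) (g x)) \<le> norm (h x) * C * M"
      using M C by (intro order_trans[OF M(2)] mult_right_mono mult_left_mono) auto
    then show ?thesis using True by (simp add: algebra_simps)
  qed (simp add: g zero_right)
  note L1 = Lp_tendsto_L1_local[OF F p K]
  have fm: "f \<in> borel_measurable lebesgue" "(\<lambda>x. F n x - f x) \<in> borel_measurable lebesgue" for n
    using F by (auto simp: Lp_tendsto_def Lp_space_UNIV intro!: borel_measurable_diff)
  have i: "integrable lebesgue (\<lambda>x. prod (f x) (g x))" "integrable lebesgue (\<lambda>x. prod (F n x - f x) (g x))" for n
    by (rule Bochner_Integration.integrable_bound[OF integrable_mult_right[OF L1(2), of "C * M"]],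
        use pm[OF fm(1)] b[of f] in \<open>auto intro!: AE_I2 order_trans[OF _ abs_ge_self]\<close>,
        rule Bochner_Integration.integrable_bound[OF integrable_mult_right[OF L1(1), of "C * M" n]],
        use pm[OF fm(2), of n] b[of "\<lambda>x. F n x - f x"] in \<open>auto intro!: AE_I2 order_trans[OF _ abs_ge_self]\<close>)
  have eq: "(LINT x|lebesgue. prod (F n x) (g x)) = (LINT x|lebesgue. prod (f x) (g x)) + (LINT x|lebesgue. prod (F n x - f x) (g x))" for n
    by (subst Bochner_Integration.integral_add[OF i, symmetric]) (simp add: diff_left)
  have "(\<lambda>n. LINT x|lebesgue. prod (F n x - f x) (g x)) \<longlonglongrightarrow> 0"
  proof (rule Lim_null_comparison)
    show "(\<lambda>n. C * M * (LINT x|lebesgue. indicator K x * norm (F n x - f x))) \<longlonglongrightarrow> 0"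
      using tendsto_mult_left[OF L1(3), of "C * M"] by simp
    show "\<forall>\<^sub>F n in sequentially. norm (LINT x|lebesgue. prod (F n x - f x) (g x)) \<le> C * M * (LINT x|lebesgue. indicator K x * norm (F n x - f x))"
    proof (intro always_eventually allI)
      fix n
      have "norm (LINT x|lebesgue. prod (F n x - f x) (g x)) \<le> (LINT x|lebesgue. norm (prod (F n x - f x) (g x)))"
        by (rule integral_norm_bound)
      also have "\<dots> \<le> (LINT x|lebesgue. C * M * (indicator K x * norm (F n x - f x)))"
        using i L1 by (intro integral_mono b) (auto intro: b)
      finally show "norm (LINT x|lebesgue. prod (F n x - f x) (g x)) \<le> C * M * (LINT x|lebesgue. indicator K x * norm (F n x - f x))"
        by simp
    qed
  qed
  from tendsto_add[OF tendsto_const this] show ?thesis by (simp add: eq)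
qed

section \<open>The space $W^{1,p}_0$\<close>

lemma Lp_space_test:
  fixes f :: "'a::euclidean_space \<Rightarrow> 'b::euclidean_space"
  assumes "continuous_on UNIV f" "compact K" "\<And>x. x \<notin> K \<Longrightarrow> f x = 0" "0 < p"
  shows "f \<in> Lp_space p UNIV"
proof -
  have "f \<in> borel_measurable lborel" using borel_measurable_continuous_onI[OF assms(1)] by simp
  then have "f \<in> borel_measurable lebesgue" by (rule measurable_completion)
  moreover have "integrable lebesgue (\<lambda>x. norm (f x) powr p)"
    by (rule continuous_compact_support_integrable[OF _ assms(2)])
      (use assms in \<open>auto intro!: continuous_on_powr' continuous_on_norm\<close>)
  ultimately show ?thesis by (simp add: Lp_space_UNIV)
qed

lemma test_functions_Lp_space:
  assumes "\<psi> \<in> test_functions S" "0 < p"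
  shows "\<psi> \<in> Lp_space p UNIV" "grad \<psi> \<in> Lp_space p UNIV"
proof -
  obtain K where K: "compact K" "\<And>x. x \<notin> K \<Longrightarrow> \<psi> x = 0" "\<And>x. x \<notin> K \<Longrightarrow> grad \<psi> x = 0"
    by (rule test_functions_support[OF assms(1)]) blast
  note s = test_functionsD(1)[OF assms(1)]
  show "\<psi> \<in> Lp_space p UNIV" by (rule Lp_space_test[OF smooth_on_continuous[OF s] K(1,2) assms(2)])
  show "grad \<psi> \<in> Lp_space p UNIV" by (rule Lp_space_test[OF grad_continuous[OF s] K(1,3) assms(2)])
qed

lemma W1p_norm_nonneg: "0 \<le> W1p_norm p f F"
  by (simp add: W1p_norm_def)

lemma W1p_norm_powr:
  assumes "0 < p"
  shows "W1p_norm p f F powr p = (LINT x|lebesgue. \<bar>f x\<bar> powr p) + (LINT x|lebesgue. norm (F x) powr p)"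
proof -
  have "0 \<le> (LINT x|lebesgue. \<bar>f x\<bar> powr p) + (LINT x|lebesgue. norm (F x) powr p)"
    by (intro add_nonneg_nonneg integral_nonneg) auto
  then show ?thesis using assms by (simp add: W1p_norm_def powr_powr)
qed

lemma in_W01p_Lp_tendsto:
  assumes "in_W01p \<Omega> p f F" "1 < p"
  obtains \<psi> where "\<And>n. \<psi> n \<in> test_functions \<Omega>" "Lp_tendsto p \<psi> f" "Lp_tendsto p (\<lambda>n. grad (\<psi> n)) F"
proof -
  have p: "0 < p" using assms(2) by simp
  have "\<forall>n. \<exists>\<psi>\<in>test_functions \<Omega>. W1p_norm p (\<lambda>x. f x - \<psi> x) (\<lambda>x. F x - grad \<psi> x) < inverse (real (Suc n))"
    using assms(1) by (simp add: in_W01p_def)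
  then obtain \<psi> where \<psi>: "\<And>n. \<psi> n \<in> test_functions \<Omega>"
    and le: "\<And>n. W1p_norm p (\<lambda>x. f x - \<psi> n x) (\<lambda>x. F x - grad (\<psi> n) x) < inverse (real (Suc n))"
    by metis
  have "(\<lambda>n. inverse (real (Suc n)) powr p) \<longlonglongrightarrow> 0 powr p"
    using p by (intro tendsto_powr'[OF LIMSEQ_inverse_real_of_nat tendsto_const]) auto
  then have lim: "(\<lambda>n. inverse (real (Suc n)) powr p) \<longlonglongrightarrow> 0" by simp
  have b: "(LINT x|lebesgue. \<bar>f x - \<psi> n x\<bar> powr p) + (LINT x|lebesgue. norm (F x - grad (\<psi> n) x) powr p) \<le> inverse (real (Suc n)) powr p" for n
    using powr_mono2[OF _ W1p_norm_nonneg less_imp_le[OF le], of p n] p by (simp add: W1p_norm_powr del: of_nat_Suc)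
  have nn: "0 \<le> (LINT x|lebesgue. \<bar>f x - \<psi> n x\<bar> powr p)" "0 \<le> (LINT x|lebesgue. norm (F x - grad (\<psi> n) x) powr p)" for n
    by (rule Bochner_Integration.integral_nonneg; simp)+
  have 1: "norm (LINT x|lebesgue. norm (\<psi> n x - f x) powr p) \<le> inverse (real (Suc n)) powr p" for n
    using b[of n] nn[of n] unfolding real_norm_def abs_minus_commute[of "\<psi> n _"] by linarith
  have 2: "norm (LINT x|lebesgue. norm (grad (\<psi> n) x - F x) powr p) \<le> inverse (real (Suc n)) powr p" for n
    using b[of n] nn[of n] unfolding norm_minus_commute[of "grad (\<psi> n) _"] real_norm_def by linarith
  have "(\<lambda>n. LINT x|lebesgue. norm (\<psi> n x - f x) powr p) \<longlonglongrightarrow> 0"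
    "(\<lambda>n. LINT x|lebesgue. norm (grad (\<psi> n) x - F x) powr p) \<longlonglongrightarrow> 0"
    by (rule Lim_null_comparison[OF always_eventually[OF allI] lim], rule 1 2)+
  then show ?thesis
    using that[of \<psi>] \<psi> test_functions_Lp_space[OF \<psi> p] assms(1) by (simp add: Lp_tendsto_def in_W01p_def)
qed

text \<open>Integration by parts holds along the sequence, and both of its sides converge since the
  other factor is continuous with compact support. So the L^p limit of the gradients is the weak
  gradient of the limit.\<close>

lemma in_W01pI:
  assumes \<psi>: "\<And>n. \<psi> n \<in> test_functions \<Omega>" and f: "Lp_tendsto p \<psi> f" and F: "Lp_tendsto p (\<lambda>n. grad (\<psi> n)) F"
    and p: "1 < p"
  shows "in_W01p \<Omega> p f F"
  unfolding in_W01p_def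
proof (intro conjI allI impI)
  show "f \<in> Lp_space p UNIV" "F \<in> Lp_space p UNIV" using f F by (auto simp: Lp_tendsto_def)
  show "is_weak_gradient f F"
    unfolding is_weak_gradient_def
  proof
    fix \<theta> :: "'a \<Rightarrow> real" assume t: "\<theta> \<in> test_functions UNIV"
    obtain K where K: "compact K" "\<And>x. x \<notin> K \<Longrightarrow> \<theta> x = 0" "\<And>x. x \<notin> K \<Longrightarrow> grad \<theta> x = 0"
      by (rule test_functions_support[OF t]) blast
    note s = test_functionsD(1)[OF t]
    have 1: "(\<lambda>n. LINT x|lebesgue. \<psi> n x *\<^sub>R grad \<theta> x) \<longlonglongrightarrow> (LINT x|lebesgue. f x *\<^sub>R grad \<theta> x)"
      by (rule Lp_tendsto_integral_bilinear[OF bounded_bilinear_scaleR f p K(1) grad_continuous[OF s] K(3)])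
    have 2: "(\<lambda>n. LINT x|lebesgue. \<theta> x *\<^sub>R grad (\<psi> n) x) \<longlonglongrightarrow> (LINT x|lebesgue. \<theta> x *\<^sub>R F x)"
      by (rule Lp_tendsto_integral_bilinear[OF bounded_bilinear.flip[OF bounded_bilinear_scaleR] F p K(1) smooth_on_continuous[OF s] K(2)])
    have "(\<lambda>n. LINT x|lebesgue. \<psi> n x *\<^sub>R grad \<theta> x) \<longlonglongrightarrow> - (LINT x|lebesgue. \<theta> x *\<^sub>R F x)"
      unfolding test_integration_by_parts[OF test_functionsD(1)[OF \<psi>] t] by (rule tendsto_minus[OF 2])
    from LIMSEQ_unique[OF 1 this]
    show "(LINT x|lebesgue. f x *\<^sub>R grad \<theta> x) = - (LINT x|lebesgue. \<theta> x *\<^sub>R F x)" .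
  qed
  fix e :: real assume e: "0 < e"
  have "(\<lambda>n. (LINT x|lebesgue. norm (\<psi> n x - f x) powr p) + (LINT x|lebesgue. norm (grad (\<psi> n) x - F x) powr p)) \<longlonglongrightarrow> 0 + 0"
    using f F by (intro tendsto_add) (auto simp: Lp_tendsto_def)
  from order_tendstoD(2)[OF this, of "e powr p"] e obtain n where
    n: "(LINT x|lebesgue. norm (\<psi> n x - f x) powr p) + (LINT x|lebesgue. norm (grad (\<psi> n) x - F x) powr p) < e powr p"
    by (auto simp: eventually_sequentially)
  have "W1p_norm p (\<lambda>x. f x - \<psi> n x) (\<lambda>x. F x - grad (\<psi> n) x) < (e powr p) powr (1 / p)"
    unfolding W1p_norm_def using n p
    by (intro powr_less_mono2 add_nonneg_nonneg integral_nonneg) (auto simp: norm_minus_commute abs_minus_commute)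
  then show "\<exists>\<psi>\<in>test_functions \<Omega>. W1p_norm p (\<lambda>x. f x - \<psi> x) (\<lambda>x. F x - grad \<psi> x) < e"
    using e p \<psi>[of n] by (auto simp: powr_powr)
qed

text \<open>Test functions in \<Omega> vanish outside \<Omega>, and a subsequence of the
  approximating ones converges almost everywhere.\<close>

lemma in_W01p_AE_eq_0:
  assumes "in_W01p \<Omega> p f F" "1 < p"
  shows "AE x in lebesgue. x \<notin> \<Omega> \<longrightarrow> f x = 0"
proof -
  obtain \<psi> where \<psi>: "\<And>n. \<psi> n \<in> test_functions \<Omega>" "Lp_tendsto p \<psi> f"
    by (rule in_W01p_Lp_tendsto[OF assms]) blast
  obtain r where "AE x in lebesgue. (\<lambda>n. \<psi> (r n) x) \<longlonglongrightarrow> f x"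
    using Lp_tendsto_AE_subseq[OF \<psi>(2)] assms(2) by (metis less_trans zero_less_one)
  then show ?thesis
  proof eventually_elim
    case (elim x)
    then show ?case using test_functionsD(5)[OF \<psi>(1)] by (auto simp: LIMSEQ_const_iff)
  qed
qed

text \<open>The classical chain rule for test functions passes to the limit: the Lipschitz bound
  transports L^p convergence through \<Phi>, whereas the bounded continuous factors \<Phi>1 and
  \<Phi>2 need only almost everywhere convergence. The norm bound is what later makes the composed
  test function bounded in time.\<close>

lemma in_W01p_chain:
  assumes f: "in_W01p \<Omega> p f F" and g: "in_W01p \<Omega> p g G" and p: "1 < p"
    and test: "\<And>\<psi> \<theta>. \<psi> \<in> test_functions \<Omega> \<Longrightarrow> \<theta> \<in> test_functions \<Omega> \<Longrightarrow> (\<lambda>x. \<Phi> (\<psi> x) (\<theta> x)) \<in> test_functions \<Omega>"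
    and gr: "\<And>\<psi> \<theta> x. \<psi> \<in> test_functions \<Omega> \<Longrightarrow> \<theta> \<in> test_functions \<Omega> \<Longrightarrow>
       grad (\<lambda>x. \<Phi> (\<psi> x) (\<theta> x)) x = \<Phi>1 (\<psi> x) (\<theta> x) *\<^sub>R grad \<psi> x + \<Phi>2 (\<psi> x) (\<theta> x) *\<^sub>R grad \<theta> x"
    and cont: "continuous_on UNIV (\<lambda>(a, b). \<Phi> a b)" "continuous_on UNIV (\<lambda>(a, b). \<Phi>1 a b)" "continuous_on UNIV (\<lambda>(a, b). \<Phi>2 a b)"
    and bound: "\<And>a b. \<bar>\<Phi>1 a b\<bar> \<le> C" "\<And>a b. \<bar>\<Phi>2 a b\<bar> \<le> C"
    and lip: "\<And>a b a' b'. \<bar>\<Phi> a b - \<Phi> a' b'\<bar> \<le> C * (\<bar>a - a'\<bar> + \<bar>b - b'\<bar>)"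
    and \<Phi>0: "\<Phi> 0 0 = 0"
  shows "in_W01p \<Omega> p (\<lambda>x. \<Phi> (f x) (g x)) (\<lambda>x. \<Phi>1 (f x) (g x) *\<^sub>R F x + \<Phi>2 (f x) (g x) *\<^sub>R G x)" (is ?in)
    and "W1p_norm p (\<lambda>x. \<Phi> (f x) (g x)) (\<lambda>x. \<Phi>1 (f x) (g x) *\<^sub>R F x + \<Phi>2 (f x) (g x) *\<^sub>R G x) powr p
       \<le> (2 * C) powr p * (W1p_norm p f F powr p + W1p_norm p g G powr p)" (is ?le)
proof -
  have p0: "0 < p" "0 \<le> p" using p by auto
  have C0: "0 \<le> C" by (rule order_trans[OF abs_ge_zero bound(1)])
  obtain \<psi> where \<psi>: "\<And>n. \<psi> n \<in> test_functions \<Omega>" "Lp_tendsto p \<psi> f" "Lp_tendsto p (\<lambda>n. grad (\<psi> n)) F"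
    by (rule in_W01p_Lp_tendsto[OF f p]) blast
  obtain \<theta> where \<theta>: "\<And>n. \<theta> n \<in> test_functions \<Omega>" "Lp_tendsto p \<theta> g" "Lp_tendsto p (\<lambda>n. grad (\<theta> n)) G"
    by (rule in_W01p_Lp_tendsto[OF g p]) blast
  \<comment> \<open>A subsequence of a subsequence is taken so that both approximations converge
    almost everywhere along the same indices.\<close>
  obtain r1 where r1: "strict_mono r1" "AE x in lebesgue. (\<lambda>n. \<psi> (r1 n) x) \<longlonglongrightarrow> f x"
    by (rule Lp_tendsto_AE_subseq[OF \<psi>(2) p0(1)])
  obtain r2 where r2: "strict_mono r2" "AE x in lebesgue. (\<lambda>n. \<theta> (r1 (r2 n)) x) \<longlonglongrightarrow> g x"
    by (rule Lp_tendsto_AE_subseq[OF Lp_tendsto_subseq[OF \<theta>(2) r1(1)] p0(1)])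
  define r where "r n = r1 (r2 n)" for n
  have r: "strict_mono r" using strict_mono_compose[OF r1(1) r2(1)] by (simp add: r_def[abs_def] o_def)
  have ae: "AE x in lebesgue. (\<lambda>n. \<psi> (r n) x) \<longlonglongrightarrow> f x \<and> (\<lambda>n. \<theta> (r n) x) \<longlonglongrightarrow> g x"
    using r1(2) r2(2)
  proof eventually_elim
    case (elim x)
    then show ?case using LIMSEQ_subseq_LIMSEQ[OF elim(1) r2(1)] by (simp add: r_def o_def)
  qed
  have lim: "(\<lambda>n. \<Psi> (a n) (b n)) \<longlonglongrightarrow> \<Psi> a' b'"
    if "continuous_on UNIV (\<lambda>(a, b). \<Psi> a b)" "a \<longlonglongrightarrow> a'" "b \<longlonglongrightarrow> b'" for \<Psi> :: "real \<Rightarrow> real \<Rightarrow> real" and a b a' b'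
    using continuous_on_tendsto_compose[OF that(1) tendsto_Pair[OF that(2,3)]] by simp
  have m: "f \<in> borel_measurable lebesgue" "g \<in> borel_measurable lebesgue"
     "\<psi> n \<in> borel_measurable lebesgue" "\<theta> n \<in> borel_measurable lebesgue" for n
    using \<psi>(2) \<theta>(2) by (auto simp: Lp_tendsto_def Lp_space_UNIV)
  have mc: "(\<lambda>x. \<Psi> (a x) (b x)) \<in> borel_measurable lebesgue"
    if "continuous_on UNIV (\<lambda>(a, b). \<Psi> a b)" "a \<in> borel_measurable lebesgue" "b \<in> borel_measurable lebesgue"
    for \<Psi> :: "real \<Rightarrow> real \<Rightarrow> real" and a b :: "'a \<Rightarrow> real"
    by (rule borel_measurable_continuous_Pair[OF that(2,3)]) (use that(1) in \<open>simp add: case_prod_beta'\<close>)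
  note sub = Lp_tendsto_subseq[OF _ r]
  have Lp: "f \<in> Lp_space p UNIV" "F \<in> Lp_space p UNIV" "g \<in> Lp_space p UNIV" "G \<in> Lp_space p UNIV"
    using \<psi> \<theta> by (auto simp: Lp_tendsto_def)
  have \<Phi>le: "norm (\<Phi> a b) \<le> C * (norm a + norm b)" for a b using lip[of a b 0 0] \<Phi>0 by simp
  have \<Phi>Lp: "(\<lambda>x. \<Phi> (a x) (b x)) \<in> Lp_space p UNIV"
    if "a \<in> Lp_space p UNIV" "b \<in> Lp_space p UNIV" for a b :: "'a \<Rightarrow> real"
    by (rule Lp_space_bound(1)[OF that _ p0(2) C0 \<Phi>le]) (rule mc[OF cont(1)]; use that in \<open>simp add: Lp_space_UNIV\<close>)
  have 1: "Lp_tendsto p (\<lambda>n x. \<Phi> (\<psi> (r n) x) (\<theta> (r n) x)) (\<lambda>x. \<Phi> (f x) (g x))"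
    by (rule Lp_tendsto_bound[OF sub[OF \<psi>(2)] sub[OF \<theta>(2)] \<Phi>Lp \<Phi>Lp p0(2) C0])
      (use lip Lp test_functions_Lp_space(1)[OF \<psi>(1) p0(1)] test_functions_Lp_space(1)[OF \<theta>(1) p0(1)] in simp_all)
  have 2: "Lp_tendsto p (\<lambda>n x. \<Phi>1 (\<psi> (r n) x) (\<theta> (r n) x) *\<^sub>R grad (\<psi> (r n)) x) (\<lambda>x. \<Phi>1 (f x) (g x) *\<^sub>R F x)"
    by (rule Lp_tendsto_scaleR[OF sub[OF \<psi>(3)] p0(1) mc[OF cont(2) m(3,4)] mc[OF cont(2) m(1,2)] bound(1) bound(1)])
      (rule eventually_mono[OF ae], rule lim[OF cont(2)], simp_all)
  have 3: "Lp_tendsto p (\<lambda>n x. \<Phi>2 (\<psi> (r n) x) (\<theta> (r n) x) *\<^sub>R grad (\<theta> (r n)) x) (\<lambda>x. \<Phi>2 (f x) (g x) *\<^sub>R G x)"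
    by (rule Lp_tendsto_scaleR[OF sub[OF \<theta>(3)] p0(1) mc[OF cont(3) m(3,4)] mc[OF cont(3) m(1,2)] bound(2) bound(2)])
      (rule eventually_mono[OF ae], rule lim[OF cont(3)], simp_all)
  have 4: "Lp_tendsto p (\<lambda>n. grad (\<lambda>x. \<Phi> (\<psi> (r n) x) (\<theta> (r n) x))) (\<lambda>x. \<Phi>1 (f x) (g x) *\<^sub>R F x + \<Phi>2 (f x) (g x) *\<^sub>R G x)"
    unfolding ext[of "grad (\<lambda>x. \<Phi> (\<psi> (r n) x) (\<theta> (r n) x))" for n, OF gr[OF \<psi>(1) \<theta>(1)]]
    by (rule Lp_tendsto_add[OF 2 3 p0(2)])
  show ?in by (rule in_W01pI[OF test[OF \<psi>(1) \<theta>(1)] 1 4 p])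
  have Hle: "norm (\<Phi>1 (f x) (g x) *\<^sub>R F x + \<Phi>2 (f x) (g x) *\<^sub>R G x) \<le> C * (norm (F x) + norm (G x))" for x
  proof -
    have "norm (\<Phi>1 (f x) (g x) *\<^sub>R F x + \<Phi>2 (f x) (g x) *\<^sub>R G x) \<le> \<bar>\<Phi>1 (f x) (g x)\<bar> * norm (F x) + \<bar>\<Phi>2 (f x) (g x)\<bar> * norm (G x)"
      using norm_triangle_ineq by (metis norm_scaleR)
    also have "\<dots> \<le> C * norm (F x) + C * norm (G x)" by (intro add_mono mult_right_mono bound norm_ge_zero)
    finally show ?thesis by (simp add: algebra_simps)
  qed
  have mH: "(\<lambda>x. \<Phi>1 (f x) (g x) *\<^sub>R F x + \<Phi>2 (f x) (g x) *\<^sub>R G x) \<in> borel_measurable lebesgue"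
    using 4 by (simp add: Lp_tendsto_def Lp_space_UNIV)
  have a: "(LINT x|lebesgue. norm (\<Phi> (f x) (g x)) powr p) \<le> (2 * C) powr p * ((LINT x|lebesgue. norm (f x) powr p) + (LINT x|lebesgue. norm (g x) powr p))"
    by (rule Lp_space_bound(2)[OF Lp(1,3) mc[OF cont(1) m(1,2)] p0(2) C0 \<Phi>le])
  have b: "(LINT x|lebesgue. norm (\<Phi>1 (f x) (g x) *\<^sub>R F x + \<Phi>2 (f x) (g x) *\<^sub>R G x) powr p) \<le> (2 * C) powr p * ((LINT x|lebesgue. norm (F x) powr p) + (LINT x|lebesgue. norm (G x) powr p))"
    by (rule Lp_space_bound(2)[OF Lp(2,4) mH p0(2) C0 Hle])
  show ?le
    unfolding W1p_norm_powr[OF p0(1)]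
    using add_mono[OF a b] by (simp add: algebra_simps)
qed

section \<open>Picone inequalities\<close>

text \<open>The graph of the convex function x^q lies above its tangent at A; this is a form of
  Young's inequality. Convexity is used on the open half line, so a vanishing A or B is treated
  separately.\<close>

lemma powr_above_tangent:
  fixes A B q :: real
  assumes "1 \<le> q" "0 \<le> A" "0 \<le> B"
  shows "q * A powr (q - 1) * B \<le> (q - 1) * A powr q + B powr q"
proof (cases "A = 0 \<or> B = 0")
  case True
  then show ?thesis using assms by auto
next
  case False
  then have AB: "0 < A" "0 < B" using assms by auto
  have "convex_on {0<..} (\<lambda>x. x powr q)"
    by (rule powr_convex[OF assms(1)])
  then have "B powr q - A powr q \<ge> (q * A powr (q - 1)) * (B - A)"
    using AB by (intro convex_on_imp_above_tangent[where A = "{0<..}"])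
      (auto intro!: derivative_eq_intros simp: interior_open)
  moreover have "A * (q * A powr (q - 1)) = q * A powr q" using AB powr_add[of A "q - 1" 1] by simp
  ultimately show ?thesis by (simp add: algebra_simps)
qed

text \<open>The sum factors as (X^q - Y^q) (X^(p-q) - Y^(p-q)), and the factors have the same sign
  because q and p - q are both positive.\<close>

lemma picone_sum_nonneg:
  fixes X Y p q :: real
  assumes "0 < q" "q < p" "0 \<le> X" "0 \<le> Y"
  shows "0 \<le> X powr p - Y powr q * X powr (p - q) + (Y powr p - X powr q * Y powr (p - q))"
proof -
  have "0 \<le> (X powr q - Y powr q) * (X powr (p - q) - Y powr (p - q))"
  proof (cases "X \<le> Y")
    case True
    then show ?thesis using assms
      by (intro mult_nonpos_nonpos) (auto intro!: powr_mono2)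
  next
    case False
    then show ?thesis using assms
      by (intro mult_nonneg_nonneg) (auto intro!: powr_mono2)
  qed
  moreover have "X powr q * X powr (p - q) = X powr p" "Y powr q * Y powr (p - q) = Y powr p"
    by (simp_all flip: powr_add)
  ultimately show ?thesis by (simp add: algebra_simps)
qed

text \<open>By homogeneity only the ratio t = b/a matters. If d < c, the claim is convexity of x^q
  at c = (1 - t) (c - d)/(1 - t) + t (d/t), a convex combination of (c - d)/(1 - t) and d/t. If d
  \<ge> c, the left-hand side is nonpositive.\<close>

lemma discrete_picone_ordered:
  fixes a b c d p q :: real
  assumes q: "1 \<le> q" and pos: "0 < b" "b < a" "0 < c" "0 < d"
  shows "spow p (a - b) * (c powr q * a powr - (q - 1) - d powr q * b powr - (q - 1))
    \<le> \<bar>c - d\<bar> powr q * \<bar>a - b\<bar> powr (p - q)"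
proof -
  define t where "t = b / a"
  have t: "0 < t" "t < 1" using pos by (auto simp: t_def)
  have bt: "b = t * a" "a - b = (1 - t) * a" using pos by (auto simp: t_def field_simps)
  have e3: "(a - b) powr (q - 1) = (1 - t) powr (q - 1) * a powr (q - 1)"
    unfolding bt(2) by (rule powr_mult)
  have e4: "b powr - (q - 1) = t powr - (q - 1) * a powr - (q - 1)"
    unfolding bt(1) by (rule powr_mult)
  have "(a - b) powr (q - 1) * (c powr q * a powr - (q - 1) - d powr q * b powr - (q - 1)) \<le> \<bar>c - d\<bar> powr q"
  proof (cases "d < c")
    case True
    from convex_onD[OF powr_convex[OF q], of t "(c - d) / (1 - t)" "d / t"] True t pos
    have "((1 - t) * ((c - d) / (1 - t)) + t * (d / t)) powr q \<le> (1 - t) * ((c - d) / (1 - t)) powr q + t * (d / t) powr q"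
      by simp
    also have "(1 - t) * ((c - d) / (1 - t)) + t * (d / t) = c" using t by simp
    finally have "(1 - t) powr (q - 1) * c powr q \<le> (1 - t) powr (q - 1) * ((1 - t) * ((c - d) / (1 - t)) powr q + t * (d / t) powr q)"
      by (rule mult_left_mono) simp
    also have "\<dots> = (c - d) powr q + (1 - t) powr (q - 1) * (d powr q * t powr - (q - 1))"
    proof -
      have "(1 - t) powr (q - 1) * (1 - t) = (1 - t) powr q" "t / t powr q = t powr - (q - 1)"
        using t powr_add[of "1 - t" "q - 1" 1] powr_add[of t "- q" 1] by (simp_all add: powr_minus_divide)
      moreover have e: "((c - d) / (1 - t)) powr q = (c - d) powr q / (1 - t) powr q" "(d / t) powr q = d powr q / t powr q"
        using t True pos by (simp_all add: powr_divide)
      moreover have "A * (s * (X / U) + t * (Y / V)) = X + A * (Y * W)" if "A * s = U" "t / V = W" "0 < U" for A s X Y U V W :: real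
      proof -
        have "A * (s * (X / U) + t * (Y / V)) = (A * s) * X / U + A * (Y * (t / V))"
          by (simp add: distrib_left mult.assoc mult.left_commute mult.commute)
        then show ?thesis unfolding that(1,2) using that(3) by simp
      qed
      ultimately show ?thesis using t unfolding e by simp
    qed
    finally have *: "(1 - t) powr (q - 1) * c powr q - (1 - t) powr (q - 1) * (d powr q * t powr - (q - 1)) \<le> (c - d) powr q"
      by simp
    have "(a - b) powr (q - 1) * (c powr q * a powr - (q - 1) - d powr q * b powr - (q - 1))
       = (a powr (q - 1) * a powr - (q - 1)) * ((1 - t) powr (q - 1) * c powr q - (1 - t) powr (q - 1) * (d powr q * t powr - (q - 1)))"
      unfolding e3 e4 by (simp only: right_diff_distrib mult_ac)
    also have "a powr (q - 1) * a powr - (q - 1) = 1" using pos by (simp flip: powr_add)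
    finally show ?thesis using * True by simp
  next
    case False
    have "c powr q * a powr - (q - 1) \<le> d powr q * b powr - (q - 1)"
      using False pos q by (intro mult_mono powr_mono2 powr_mono2') auto
    then have "(a - b) powr (q - 1) * (c powr q * a powr - (q - 1) - d powr q * b powr - (q - 1)) \<le> 0"
      by (intro mult_nonneg_nonpos) auto
    then show ?thesis by (rule order_trans) simp
  qed
  \<comment> \<open>The factor (a - b)^(p-q) raises the exponent q - 1 to p - 1, so that
    \<open>spow p (a - b)\<close> appears.\<close>
  from mult_left_mono[OF this, of "(a - b) powr (p - q)"]
  have "((a - b) powr (p - q) * (a - b) powr (q - 1)) * (c powr q * a powr - (q - 1) - d powr q * b powr - (q - 1))
     \<le> (a - b) powr (p - q) * \<bar>c - d\<bar> powr q" by (simp add: mult.assoc)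
  moreover have "(a - b) powr (p - q) * (a - b) powr (q - 1) = spow p (a - b)"
    using pos powr_add[of "a - b" "p - 2" 1] by (simp add: spow_def flip: powr_add)
  ultimately show ?thesis using pos by (simp add: mult.commute)
qed

lemma spow_minus: "spow p (- x) = - spow p x"
  by (simp add: spow_def)

lemma spow_mult_self: "spow p x * x = \<bar>x\<bar> powr p"
proof (cases "x = 0")
  case False
  then have "\<bar>x\<bar> powr (p - 2) * \<bar>x\<bar>\<^sup>2 = \<bar>x\<bar> powr p"
    using powr_add[of "\<bar>x\<bar>" "p - 2" 2] by simp
  then show ?thesis by (simp add: spow_def power2_eq_square mult.assoc)
qed (simp add: spow_def)

text \<open>Exchanging (a, c) with (b, d) changes the sign of both factors on the left and leaves
  the right-hand side alone, so b < a may be assumed; for a = b both sides vanish.\<close>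

lemma discrete_picone:
  fixes a b c d p q :: real
  assumes q: "1 \<le> q" and pos: "0 < a" "0 < b" "0 < c" "0 < d"
  shows "spow p (a - b) * (c powr q * a powr - (q - 1) - d powr q * b powr - (q - 1))
    \<le> \<bar>c - d\<bar> powr q * \<bar>a - b\<bar> powr (p - q)"
proof -
  consider "b < a" | "a < b" | "a = b" by linarith
  then show ?thesis
  proof cases
    case 1
    then show ?thesis using discrete_picone_ordered assms by blast
  next
    case 2
    from discrete_picone_ordered[OF q pos(1) 2 pos(4,3), of p] spow_minus[of p "a - b"]
    show ?thesis by (simp add: abs_minus_commute algebra_simps)
  next
    case 3
    then show ?thesis by (simp add: spow_def)
  qed
qed

text \<open>With X = |a - b| and Y = |c - d|, \<open>discrete_picone\<close> bounds the first
  summand below by X^p - Y^q X^(p-q), and the second by the same expression with X and Y exchanged.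
  The two bounds add up to the sum in \<open>picone_sum_nonneg\<close>.\<close>

lemma discrete_picone_pair:
  fixes a b c d p q :: real
  assumes q: "1 \<le> q" "q < p" and pos: "0 < a" "0 < b" "0 < c" "0 < d"
  shows "0 \<le> spow p (a - b) * ((a - c powr q * a powr - (q - 1)) - (b - d powr q * b powr - (q - 1)))
    + spow p (c - d) * ((c - a powr q * c powr - (q - 1)) - (d - b powr q * d powr - (q - 1)))"
  using discrete_picone[OF q(1) pos, of p] discrete_picone[OF q(1) pos(3,4,1,2), of p]
    picone_sum_nonneg[of q p "\<bar>a - b\<bar>" "\<bar>c - d\<bar>"] q
    spow_mult_self[of p "a - b"] spow_mult_self[of p "c - d"]
  by (simp add: algebra_simps)

text \<open>If X and Y are the gradients of positive functions with values a and c, the vector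
  paired with X is the gradient of a - c^q a^(1-q). Cauchy-Schwarz reduces the mixed term to norms,
  and \<open>powr_above_tangent\<close> at (c/a) |X| and |Y| gives the bound.\<close>

lemma local_picone:
  fixes X Y :: "'a::real_inner" and a c p q :: real
  assumes q: "1 \<le> q" "q < p" and pos: "0 < a" "0 < c"
  shows "norm X powr p - norm Y powr q * norm X powr (p - q) \<le> norm X powr (p - 2) *
     (X \<bullet> ((1 + (q - 1) * c powr q * a powr - q) *\<^sub>R X - (q * c powr (q - 1) * a powr - (q - 1)) *\<^sub>R Y))"
proof (cases "X = 0")
  case False
  define x where "x = norm X"
  define r where "r = c / a"
  have x: "0 < x" and r: "0 < r" using False pos by (auto simp: x_def r_def)
  have "c powr \<sigma> * a powr - \<sigma> = r powr \<sigma>" for \<sigma>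
    using pos by (simp add: r_def powr_divide powr_minus_divide)
  from this[of q] this[of "q - 1"] have r1: "c powr q * a powr - q = r powr q" "c powr (q - 1) * a powr - (q - 1) = r powr (q - 1)"
    by this
  have XX: "X \<bullet> X = x\<^sup>2" by (simp add: x_def power2_norm_eq_inner)
  have pw: "x powr (p - 2) * x\<^sup>2 = x powr p" "x powr (p - 2) * x = x powr (p - q) * x powr (q - 1)"
     "x powr p = x powr (p - q) * x powr q"
    using x powr_add[of x "p - 2" 2] powr_add[of x "p - 2" 1] by (simp_all flip: powr_add)
  have "q * (r powr (q - 1)) * (x powr (p - 2) * (X \<bullet> Y)) \<le> q * (r powr (q - 1)) * (x powr (p - 2) * (x * norm Y))"
    using q norm_cauchy_schwarz[of X Y] by (intro mult_left_mono) (auto simp: x_def)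
  also have "\<dots> = x powr (p - q) * (q * (r * x) powr (q - 1) * norm Y)"
    using r x pw(2) by (simp add: powr_mult algebra_simps)
  also have "\<dots> \<le> x powr (p - q) * ((q - 1) * (r * x) powr q + norm Y powr q)"
    using powr_above_tangent[of q "r * x" "norm Y"] q r x by (intro mult_left_mono) auto
  also have "\<dots> = (q - 1) * r powr q * x powr p + norm Y powr q * x powr (p - q)"
    using r x pw(3) by (simp add: powr_mult algebra_simps)
  finally have "q * (r powr (q - 1)) * (x powr (p - 2) * (X \<bullet> Y)) \<le> (q - 1) * r powr q * x powr p + norm Y powr q * x powr (p - q)" .
  moreover have "x powr (p - 2) * (X \<bullet> ((1 + (q - 1) * c powr q * a powr - q) *\<^sub>R X - (q * c powr (q - 1) * a powr - (q - 1)) *\<^sub>R Y))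
     = (1 + (q - 1) * r powr q) * (x powr (p - 2) * x\<^sup>2) - q * (r powr (q - 1)) * (x powr (p - 2) * (X \<bullet> Y))"
    unfolding r1[symmetric] by (simp add: inner_diff_right XX algebra_simps)
  ultimately show ?thesis unfolding pw(1) x_def[symmetric] by (simp add: algebra_simps)
qed (use q in auto)

lemma local_picone_pair:
  fixes X Y :: "'a::real_inner" and a c p q :: real
  assumes q: "1 \<le> q" "q < p" and pos: "0 < a" "0 < c"
  shows "0 \<le> norm X powr (p - 2) *
     (X \<bullet> ((1 + (q - 1) * c powr q * a powr - q) *\<^sub>R X - (q * c powr (q - 1) * a powr - (q - 1)) *\<^sub>R Y))
    + norm Y powr (p - 2) *
     (Y \<bullet> ((1 + (q - 1) * a powr q * c powr - q) *\<^sub>R Y - (q * a powr (q - 1) * c powr - (q - 1)) *\<^sub>R X))"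
  using local_picone[OF q pos, of X Y] local_picone[OF q pos(2,1), of Y X]
    picone_sum_nonneg[of q p "norm X" "norm Y"] q by simp

section \<open>The truncated test function\<close>

text \<open>A smooth and positive substitute for a + \<epsilon> on the whole line: both agree on
  [0, M + 1], and the substitute is constantly \<epsilon> off [-\<epsilon>/2, M + 2]. Test functions
  that approximate a solution may leave its range, and powers must be smooth with bounded
  derivatives there too. The margin between M and M + 1 makes derivatives at M computable.\<close>

definition shifted_cutoff :: "real \<Rightarrow> real \<Rightarrow> real \<Rightarrow> real" where
  "shifted_cutoff \<epsilon> M a = \<epsilon> + a * (smooth_step (1 + 2 / \<epsilon> * a) * smooth_step (M + 2 - a))"

lemma shifted_cutoff_eq: "0 < \<epsilon> \<Longrightarrow> 0 \<le> a \<Longrightarrow> a \<le> M + 1 \<Longrightarrow> shifted_cutoff \<epsilon> M a = a + \<epsilon>"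
  by (simp add: shifted_cutoff_def smooth_step_1)

lemma shifted_cutoff_const:
  assumes "0 < \<epsilon>" "a \<notin> {- \<epsilon> / 2..M + 2}" shows "shifted_cutoff \<epsilon> M a = \<epsilon>"
proof -
  have "1 + 2 / \<epsilon> * a \<le> 0 \<or> M + 2 - a \<le> 0" using assms by (auto simp: field_simps)
  then show ?thesis by (auto simp: shifted_cutoff_def smooth_step_0)
qed

lemma shifted_cutoff_pos:
  assumes e: "0 < \<epsilon>" shows "0 < shifted_cutoff \<epsilon> M a"
proof (cases "a \<in> {- \<epsilon> / 2..M + 2}")
  case True
  define c where "c = smooth_step (1 + 2 / \<epsilon> * a) * smooth_step (M + 2 - a)"
  have c: "0 \<le> c" "c \<le> 1" using smooth_step_bounds by (auto simp: c_def mult_le_one)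
  \<comment> \<open>In this case a negative a is at least -\<epsilon>/2, and c lies in [0, 1]; the
    value therefore stays at or above \<epsilon>/2.\<close>
  have "- \<epsilon> / 2 \<le> a * c"
  proof (cases "0 \<le> a")
    case True
    then have "0 \<le> a * c" using c by simp
    then show ?thesis using e by linarith
  next
    case False
    then have "a * 1 \<le> a * c" using c by (intro mult_left_mono_neg) auto
    then show ?thesis using True by simp
  qed
  then show ?thesis using e unfolding shifted_cutoff_def c_def[symmetric] by simp
qed (use shifted_cutoff_const[OF e] e in simp)

lemma shifted_cutoff_smooth: "smooth_on UNIV (shifted_cutoff \<epsilon> M)"
  unfolding shifted_cutoff_def[abs_def]
  by (intro smooth_intros smooth_on_compose[OF _ smooth_step_smooth] smooth_on_diff smooth_on_id)

text \<open>Off \<open>K\<close> the derivative vanishes, so it is continuous with compact support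
  and hence bounded; the mean value inequality then yields a Lipschitz constant.\<close>

lemma smooth_eventually_const_bounds:
  fixes f :: "real \<Rightarrow> real"
  assumes f: "smooth_on UNIV f" and K: "compact K" and const: "\<And>x. x \<notin> K \<Longrightarrow> f x = f 0"
    and f': "\<And>x. (f has_real_derivative f' x) (at x)"
  obtains C where "continuous_on UNIV f'" "\<And>x. \<bar>f x\<bar> \<le> C" "\<And>x. \<bar>f' x\<bar> \<le> C" "\<And>x y. \<bar>f x - f y\<bar> \<le> C * \<bar>x - y\<bar>"
proof -
  have eq: "f' x = grad f x" for x
  proof -
    have "grad f x = f' x"
      by (rule grad_eqI) (use f'[of x] in \<open>simp add: has_field_derivative_def\<close>)
    then show ?thesis by simp
  qed
  then have c': "continuous_on UNIV f'" using grad_continuous[OF f] by presburger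
  have "(\<lambda>x. f x - f 0) \<in> test_functions UNIV"
    using const by (intro test_functionsI[OF _ K] smooth_on_diff f smooth_intros) auto
  then have z: "x \<notin> K \<Longrightarrow> f' x = 0" for x
  proof -
    assume x: "x \<notin> K"
    have "((\<lambda>x. f 0) has_real_derivative 0) (at x)" by simp
    then have "(f has_real_derivative 0) (at x)"
      by (rule has_field_derivative_transform_within_open[where S = "- K"])
        (use x const K in \<open>auto simp: compact_imp_closed\<close>)
    then show ?thesis using f' DERIV_unique by blast
  qed
  obtain A where A: "0 \<le> A" "\<And>x. norm (f' x) \<le> A"
    by (rule continuous_compact_support_bounded[OF c' K z]) blast+
  have "continuous_on UNIV (\<lambda>x. f x - f 0)" by (intro continuous_intros smooth_on_continuous f)
  then obtain B where B: "0 \<le> B" "\<And>x. norm (f x - f 0) \<le> B"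
    by (rule continuous_compact_support_bounded[OF _ K]) (use const in auto)
  define C where "C = A + B + \<bar>f 0\<bar>"
  have lip: "\<bar>f x - f y\<bar> \<le> A * \<bar>x - y\<bar>" for x y
    using field_differentiable_bound[of UNIV f f' A x y] f' A(2) by simp
  show ?thesis
  proof (rule that[OF c', of C])
    show "\<bar>f x\<bar> \<le> C" for x using B(2)[of x] A(1) by (auto simp: C_def)
    show "\<bar>f' x\<bar> \<le> C" for x using A(2)[of x] B(1) by (auto simp: C_def)
    show "\<bar>f x - f y\<bar> \<le> C * \<bar>x - y\<bar>" for x y
      using lip[of x y] mult_right_mono[of A C "\<bar>x - y\<bar>"] A(1) B(1) by (auto simp: C_def)
  qed
qed

text \<open>The shape \<open>P a - Q b * R a\<close> is that of (a + \<epsilon>) - (b +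
  \<epsilon>)^(m+1) (a + \<epsilon>)^(-m) after truncation. The condition
  \<open>P 0 = Q 0 * R 0\<close> makes the composition vanish where both arguments do, so that test
  functions are mapped to test functions.\<close>

lemma in_W01p_chain_product:
  fixes P Q R P' Q' R' :: "real \<Rightarrow> real"
  assumes s: "smooth_on UNIV P" "smooth_on UNIV Q" "smooth_on UNIV R"
    and d: "\<And>x. (P has_real_derivative P' x) (at x)" "\<And>x. (Q has_real_derivative Q' x) (at x)" "\<And>x. (R has_real_derivative R' x) (at x)"
    and K: "compact K" and const: "\<And>x. x \<notin> K \<Longrightarrow> P x = P 0" "\<And>x. x \<notin> K \<Longrightarrow> Q x = Q 0" "\<And>x. x \<notin> K \<Longrightarrow> R x = R 0"
    and zero: "P 0 = Q 0 * R 0" and p: "1 < p"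
  defines "\<Phi> \<equiv> \<lambda>a b. P a - Q b * R a" and "\<Phi>1 \<equiv> \<lambda>a b. P' a - Q b * R' a" and "\<Phi>2 \<equiv> \<lambda>a b. - (Q' b * R a)"
  obtains C where "0 \<le> C"
    "continuous_on UNIV (\<lambda>(a, b). \<Phi> a b)" "continuous_on UNIV (\<lambda>(a, b). \<Phi>1 a b)" "continuous_on UNIV (\<lambda>(a, b). \<Phi>2 a b)"
    "\<And>a b. \<bar>\<Phi> a b\<bar> \<le> C"
    "\<And>(\<Omega>::'a::euclidean_space set) f F g G. in_W01p \<Omega> p f F \<Longrightarrow> in_W01p \<Omega> p g G \<Longrightarrow>
      in_W01p \<Omega> p (\<lambda>x. \<Phi> (f x) (g x)) (\<lambda>x. \<Phi>1 (f x) (g x) *\<^sub>R F x + \<Phi>2 (f x) (g x) *\<^sub>R G x)"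
    "\<And>(\<Omega>::'a::euclidean_space set) f F g G. in_W01p \<Omega> p f F \<Longrightarrow> in_W01p \<Omega> p g G \<Longrightarrow>
      W1p_norm p (\<lambda>x. \<Phi> (f x) (g x)) (\<lambda>x. \<Phi>1 (f x) (g x) *\<^sub>R F x + \<Phi>2 (f x) (g x) *\<^sub>R G x) powr p
       \<le> C * (W1p_norm p f F powr p + W1p_norm p g G powr p)"
proof -
  obtain A where A: "continuous_on UNIV P'" "\<And>x. \<bar>P x\<bar> \<le> A" "\<And>x. \<bar>P' x\<bar> \<le> A" "\<And>x y. \<bar>P x - P y\<bar> \<le> A * \<bar>x - y\<bar>"
    by (rule smooth_eventually_const_bounds[OF s(1) K const(1) d(1)]) blast+
  obtain B where B: "continuous_on UNIV Q'" "\<And>x. \<bar>Q x\<bar> \<le> B" "\<And>x. \<bar>Q' x\<bar> \<le> B" "\<And>x y. \<bar>Q x - Q y\<bar> \<le> B * \<bar>x - y\<bar>"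
    by (rule smooth_eventually_const_bounds[OF s(2) K const(2) d(2)]) blast+
  obtain E where E: "continuous_on UNIV R'" "\<And>x. \<bar>R x\<bar> \<le> E" "\<And>x. \<bar>R' x\<bar> \<le> E" "\<And>x y. \<bar>R x - R y\<bar> \<le> E * \<bar>x - y\<bar>"
    by (rule smooth_eventually_const_bounds[OF s(3) K const(3) d(3)]) blast+
  have nn: "0 \<le> A" "0 \<le> B" "0 \<le> E"
    by (rule order_trans[OF abs_ge_zero A(2)] order_trans[OF abs_ge_zero B(2)] order_trans[OF abs_ge_zero E(2)])+
  define D where "D = A + B * E"
  have BE: "\<bar>Q b * R a\<bar> \<le> B * E" "\<bar>Q b * R' a\<bar> \<le> B * E" "\<bar>Q' b * R a\<bar> \<le> B * E" for a b
    unfolding abs_mult by (intro mult_mono B E nn abs_ge_zero)+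
  have bd: "\<bar>\<Phi> a b\<bar> \<le> D" "\<bar>\<Phi>1 a b\<bar> \<le> D" "\<bar>\<Phi>2 a b\<bar> \<le> D" for a b
    using BE[of b a] A(2)[of a] A(3)[of a] nn(1) unfolding D_def \<Phi>_def \<Phi>1_def \<Phi>2_def by linarith+
  have lip: "\<bar>\<Phi> a b - \<Phi> a' b'\<bar> \<le> D * (\<bar>a - a'\<bar> + \<bar>b - b'\<bar>)" for a b a' b'
  proof -
    have "\<Phi> a b - \<Phi> a' b' = (P a - P a') - Q b * (R a - R a') - R a' * (Q b - Q b')"
      by (simp add: \<Phi>_def algebra_simps)
    then have "\<bar>\<Phi> a b - \<Phi> a' b'\<bar> \<le> \<bar>P a - P a'\<bar> + \<bar>Q b\<bar> * \<bar>R a - R a'\<bar> + \<bar>R a'\<bar> * \<bar>Q b - Q b'\<bar>"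
      by (simp flip: abs_mult)
    also have "\<dots> \<le> A * \<bar>a - a'\<bar> + B * (E * \<bar>a - a'\<bar>) + E * (B * \<bar>b - b'\<bar>)"
      by (intro add_mono mult_mono A B E nn abs_ge_zero)
    also have "\<dots> \<le> D * (\<bar>a - a'\<bar> + \<bar>b - b'\<bar>)"
      using nn by (simp add: D_def algebra_simps)
    finally show ?thesis .
  qed
  have cs: "continuous_on UNIV P" "continuous_on UNIV Q" "continuous_on UNIV R"
    by (intro smooth_on_continuous s)+
  have cc: "continuous_on UNIV (\<lambda>(a, b). \<Phi> a b)" "continuous_on UNIV (\<lambda>(a, b). \<Phi>1 a b)" "continuous_on UNIV (\<lambda>(a, b). \<Phi>2 a b)"
    unfolding \<Phi>_def \<Phi>1_def \<Phi>2_def case_prod_beta'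
    by (intro continuous_intros continuous_on_compose2[OF cs(1)] continuous_on_compose2[OF cs(2)] continuous_on_compose2[OF cs(3)]
        continuous_on_compose2[OF A(1)] continuous_on_compose2[OF B(1)] continuous_on_compose2[OF E(1)] subset_UNIV)+
  have test: "(\<lambda>x. \<Phi> (\<psi> x) (\<theta> x)) \<in> test_functions \<Omega>"
    if \<psi>: "\<psi> \<in> test_functions \<Omega>" and \<theta>: "\<theta> \<in> test_functions \<Omega>" for \<Omega> :: "'a set" and \<psi> \<theta>
  proof -
    obtain K1 where K1: "compact K1" "K1 \<subseteq> \<Omega>" "\<And>x. x \<notin> K1 \<Longrightarrow> \<psi> x = 0" by (rule test_functions_support[OF \<psi>]) blast
    obtain K2 where K2: "compact K2" "K2 \<subseteq> \<Omega>" "\<And>x. x \<notin> K2 \<Longrightarrow> \<theta> x = 0" by (rule test_functions_support[OF \<theta>]) blast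
    show ?thesis
    proof (rule test_functionsI[of _ "K1 \<union> K2"])
      show "smooth_on UNIV (\<lambda>x. \<Phi> (\<psi> x) (\<theta> x))" unfolding \<Phi>_def
        by (intro smooth_on_diff smooth_intros smooth_on_compose[OF _ s(1)] smooth_on_compose[OF _ s(2)] smooth_on_compose[OF _ s(3)]
            test_functionsD(1)[OF \<psi>] test_functionsD(1)[OF \<theta>])
      show "\<Phi> (\<psi> x) (\<theta> x) = 0" if "x \<notin> K1 \<union> K2" for x
        using that K1(3) K2(3) zero by (simp add: \<Phi>_def)
    qed (use K1 K2 in auto)
  qed
  have gr: "grad (\<lambda>x. \<Phi> (\<psi> x) (\<theta> x)) x = \<Phi>1 (\<psi> x) (\<theta> x) *\<^sub>R grad \<psi> x + \<Phi>2 (\<psi> x) (\<theta> x) *\<^sub>R grad \<theta> x"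
    if \<psi>: "\<psi> \<in> test_functions \<Omega>" and \<theta>: "\<theta> \<in> test_functions \<Omega>" for \<Omega> :: "'a set" and \<psi> \<theta> x
  proof (rule grad_eqI)
    have 1: "((\<lambda>x. f (\<psi> x)) has_derivative (\<lambda>h. f' (\<psi> x) * (grad \<psi> x \<bullet> h))) (at x)"
      if "(f has_real_derivative f' (\<psi> x)) (at (\<psi> x))" "\<psi> \<in> test_functions \<Omega>" for f f' and \<psi> :: "'a \<Rightarrow> real"
      using has_derivative_compose[OF smooth_on_has_derivative_grad[OF test_functionsD(1)[OF that(2)]] that(1)[unfolded has_field_derivative_def]] .
    show "((\<lambda>x. \<Phi> (\<psi> x) (\<theta> x)) has_derivative (\<bullet>) (\<Phi>1 (\<psi> x) (\<theta> x) *\<^sub>R grad \<psi> x + \<Phi>2 (\<psi> x) (\<theta> x) *\<^sub>R grad \<theta> x)) (at x)"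
      unfolding \<Phi>_def
      by (rule has_derivative_eq_rhs[OF has_derivative_diff[OF 1[of P P', OF d(1) \<psi>] has_derivative_mult[OF 1[of Q Q', OF d(2) \<theta>] 1[of R R', OF d(3) \<psi>]]]])
        (auto simp: \<Phi>1_def \<Phi>2_def inner_add_left algebra_simps)
  qed
  have \<Phi>0: "\<Phi> 0 0 = 0" using zero by (simp add: \<Phi>_def)
  define C where "C = D + (2 * D) powr p"
  have D: "0 \<le> D" using nn by (simp add: D_def)
  show ?thesis
  proof (rule that[of C, OF _ cc])
    show "0 \<le> C" using D by (simp add: C_def)
    show "\<bar>\<Phi> a b\<bar> \<le> C" for a b using bd(1)[of a b] by (simp add: C_def add_increasing2)
    fix \<Omega> :: "'a set" and f F g G assume fg: "in_W01p \<Omega> p f F" "in_W01p \<Omega> p g G"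
    show "in_W01p \<Omega> p (\<lambda>x. \<Phi> (f x) (g x)) (\<lambda>x. \<Phi>1 (f x) (g x) *\<^sub>R F x + \<Phi>2 (f x) (g x) *\<^sub>R G x)"
      by (rule in_W01p_chain(1)[OF fg p test gr cc bd(2,3) lip \<Phi>0])
    have "W1p_norm p (\<lambda>x. \<Phi> (f x) (g x)) (\<lambda>x. \<Phi>1 (f x) (g x) *\<^sub>R F x + \<Phi>2 (f x) (g x) *\<^sub>R G x) powr p
       \<le> (2 * D) powr p * (W1p_norm p f F powr p + W1p_norm p g G powr p)"
      by (rule in_W01p_chain(2)[OF fg p test gr cc bd(2,3) lip \<Phi>0])
    also have "\<dots> \<le> C * (W1p_norm p f F powr p + W1p_norm p g G powr p)"
      using D by (intro mult_right_mono) (auto simp: C_def)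
    finally show "W1p_norm p (\<lambda>x. \<Phi> (f x) (g x)) (\<lambda>x. \<Phi>1 (f x) (g x) *\<^sub>R F x + \<Phi>2 (f x) (g x) *\<^sub>R G x) powr p
       \<le> C * (W1p_norm p f F powr p + W1p_norm p g G powr p)" .
  qed
qed

section \<open>Space-time test functions\<close>

text \<open>Starting at 0 yields the primitive that vanishes before the bump, because the bumps are
  placed at positive times.\<close>

definition bump_primitive :: "nat \<Rightarrow> real \<Rightarrow> real \<Rightarrow> real \<Rightarrow> real" where
  "bump_primitive n c d t = integral {0..t} (bump n c d)"

lemma bump_continuous: "continuous_on S (bump n c d)"
  using smooth_on_continuous[OF bump_smooth] continuous_on_subset by blast

lemma bump_primitive_eq_0: "t \<le> c \<Longrightarrow> bump_primitive n c d t = 0"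
  unfolding bump_primitive_def by (subst integral_cong[where g = "\<lambda>_. 0"]) (auto simp: bump_0)

lemma bump_primitive_has_derivative:
  assumes c: "0 < c"
  shows "(bump_primitive n c d has_real_derivative bump n c d t) (at t)"
proof (cases "t < c")
  case True
  have "((\<lambda>x. 0) has_real_derivative 0) (at t)" by simp
  then have "(bump_primitive n c d has_real_derivative 0) (at t)"
    by (rule has_field_derivative_transform_within_open[where S = "{..<c}"])
      (use True in \<open>auto simp: bump_primitive_eq_0\<close>)
  then show ?thesis using True by (simp add: bump_0)
next
  case False
  have "((\<lambda>u. integral {0..u} (bump n c d)) has_real_derivative bump n c d t) (at t within {0..t + 1})"
    using c False by (intro integral_has_real_derivative bump_continuous) auto
  moreover have "at t within {0..t + 1} = at t"
    by (rule at_within_interior) (use c False in auto)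
  ultimately show ?thesis unfolding bump_primitive_def[abs_def] by simp
qed

lemma bump_primitive_smooth:
  assumes "0 < c" shows "smooth_on UNIV (bump_primitive n c d)"
proof (rule smooth_onI)
  fix k
  have "Ck_on (Suc k) UNIV (bump_primitive n c d)"
    by (rule Ck_on_UNIV_real_SucI[OF bump_primitive_has_derivative[OF assms] smooth_onD[OF bump_smooth]])
  then show "Ck_on k UNIV (bump_primitive n c d)" by (rule Ck_on_SucD)
qed

lemma bump_primitive_eq_integral:
  assumes "0 < c"
  shows "bump_primitive n c d t = (LINT s|lborel. indicator {..t} s * bump n c d s)"
proof -
  have "(LINT s:{0..t}|lborel. bump n c d s) = integral {0..t} (bump n c d)"
    by (rule set_borel_integral_eq_integral(2)) (rule borel_integrable_atLeastAtMost', rule bump_continuous)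
  moreover have "(\<lambda>s. indicator {0..t} s *\<^sub>R bump n c d s) = (\<lambda>s. indicator {..t} s * bump n c d s)"
    using assms bump_0[of _ c d n] by (intro ext) (auto simp: indicator_def)
  ultimately show ?thesis by (simp add: bump_primitive_def set_lebesgue_integral_def)
qed

lemma bump_borel [measurable]: "bump n c d \<in> borel_measurable borel"
  by (rule borel_measurable_continuous_onI[OF bump_continuous])

lemma bump_indicator_bound: "norm (bump n c d s) \<le> indicator {c<..<d} s"
  using bump_bounds[of n c d s] bump_0[of s c d n] by (auto simp: indicator_def)

lemma bump_indicator_bound': "norm (indicator {..t} s * bump n c d s) \<le> indicator {c<..<d} s"
  by (rule order_trans[OF _ bump_indicator_bound[of n]]) (simp add: indicator_def)

lemma integrable_indicator_Ioo: "integrable lborel (indicat_real {c<..<d::real})"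
  by (cases "c \<le> d") auto

lemma bump_primitive_tendsto:
  assumes "0 < c"
  shows "(\<lambda>n. bump_primitive n c d t) \<longlonglongrightarrow> (LINT s|lborel. indicator {..t} s * indicator {c<..<d} s)"
  unfolding bump_primitive_eq_integral[OF assms]
proof (rule integral_dominated_convergence[where w = "indicator {c<..<d}"])
  show "integrable lborel (indicat_real {c<..<d})" by (rule integrable_indicator_Ioo)
  show "AE s in lborel. (\<lambda>n. indicat_real {..t} s * bump n c d s) \<longlonglongrightarrow> indicator {..t} s * indicator {c<..<d} s"
    by (intro AE_I2 tendsto_mult tendsto_const bump_tendsto)
  show "AE s in lborel. norm (indicat_real {..t} s * bump n c d s) \<le> indicator {c<..<d} s" for n
    by (intro AE_I2 bump_indicator_bound')
qed auto

lemma bump_primitive_bound: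
  assumes "0 < c" "c \<le> d" shows "\<bar>bump_primitive n c d t\<bar> \<le> d - c"
proof -
  have i: "integrable lborel (\<lambda>s. indicator {..t} s * bump n c d s)"
    by (rule Bochner_Integration.integrable_bound[OF integrable_indicator_Ioo[of c d]], measurable, intro AE_I2)
      (rule order_trans[OF bump_indicator_bound'], simp)
  have "norm (LINT s|lborel. indicator {..t} s * bump n c d s) \<le> (LINT s|lborel. norm (indicator {..t} s * bump n c d s))"
    by (rule integral_norm_bound)
  also have "\<dots> \<le> (LINT s|lborel. indicator {c<..<d} s)"
    by (intro integral_mono integrable_norm i integrable_indicator_Ioo bump_indicator_bound')
  finally show ?thesis using assms by (simp add: bump_primitive_eq_integral)
qed

text \<open>A smooth approximation of the indicator of a box. Boxes are enough, since averages over
  small cubes determine an integrable function almost everywhere.\<close>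

definition box_bump :: "nat \<Rightarrow> 'a::euclidean_space \<Rightarrow> 'a \<Rightarrow> 'a \<Rightarrow> real" where
  "box_bump n a b x = (\<Prod>i\<in>Basis. bump n (a \<bullet> i) (b \<bullet> i) (x \<bullet> i))"

lemma box_bump_bounds: "0 \<le> box_bump n a b x" "box_bump n a b x \<le> 1"
  by (auto simp: box_bump_def bump_bounds intro!: prod_nonneg prod_le_1)

lemma box_bump_eq_0: "x \<notin> box a b \<Longrightarrow> box_bump n a b x = 0"
  by (force simp: box_bump_def mem_box bump_0)

lemma box_bump_tendsto: "(\<lambda>n. box_bump n a b x) \<longlonglongrightarrow> indicator (box a b) x"
proof -
  have "(\<lambda>n. box_bump n a b x) \<longlonglongrightarrow> (\<Prod>i\<in>Basis. indicator {a \<bullet> i<..<b \<bullet> i} (x \<bullet> i))"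
    unfolding box_bump_def by (intro tendsto_prod bump_tendsto)
  also have "(\<Prod>i\<in>Basis. indicat_real {a \<bullet> i<..<b \<bullet> i} (x \<bullet> i)) = indicator (box a b) x"
    by (auto simp: indicator_def mem_box intro!: prod.neutral)
  finally show ?thesis .
qed

lemma box_bump_smooth: "smooth_on UNIV (box_bump n a b)"
  unfolding box_bump_def[abs_def]
  by (intro smooth_on_prod smooth_on_compose[OF _ bump_smooth] smooth_on_bounded_linear
      finite_Basis bounded_linear_inner_left)

lemma box_bump_snd_smooth:
  "smooth_on UNIV (\<lambda>z::'t::euclidean_space \<times> 'a::euclidean_space. box_bump n a b (snd z))"
  unfolding box_bump_def
  by (intro smooth_on_prod smooth_on_compose[OF _ bump_smooth] smooth_on_bounded_linear
      finite_Basis bounded_linear_compose[OF bounded_linear_inner_left bounded_linear_snd])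

lemma box_bump_borel [measurable]: "box_bump n a b \<in> borel_measurable borel"
  unfolding box_bump_def[abs_def] by measurable

text \<open>The spatial factor does not depend on time, so the time derivative falls on \<eta>
  alone; the compact time interval and the closed box provide the compact support.\<close>

lemma tensor_test_function:
  fixes \<Omega> :: "'a::euclidean_space set" and \<eta> \<eta>' :: "real \<Rightarrow> real"
  assumes \<eta>: "smooth_on UNIV \<eta>" and d: "\<And>t. (\<eta> has_real_derivative \<eta>' t) (at t)"
    and z: "\<And>t. t \<notin> {t1..t2} \<Longrightarrow> \<eta> t = 0" and t: "0 < t1" "t2 < T" and ab: "cbox a b \<subseteq> \<Omega>"
  shows "(\<lambda>z. \<eta> (fst z) * box_bump n a b (snd z)) \<in> test_functions ({0<..<T} \<times> \<Omega>)"
    and "time_deriv (\<lambda>z. \<eta> (fst z) * box_bump n a b (snd z)) w = \<eta>' (fst w) * box_bump n a b (snd w)"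
proof -
  have s1: "smooth_on UNIV (\<lambda>z::real \<times> 'a. \<eta> (fst z))"
    by (intro smooth_on_compose[OF _ \<eta>] smooth_on_bounded_linear bounded_linear_fst)
  show "(\<lambda>z. \<eta> (fst z) * box_bump n a b (snd z)) \<in> test_functions ({0<..<T} \<times> \<Omega>)"
  proof (rule test_functionsI[where K = "{t1..t2} \<times> cbox a b"])
    show "smooth_on UNIV (\<lambda>z::real \<times> 'a. \<eta> (fst z) * box_bump n a b (snd z))"
      by (intro smooth_intros s1 box_bump_snd_smooth)
    show "compact ({t1..t2} \<times> cbox a b)" by (intro compact_Times compact_cbox compact_Icc)
    show "{t1..t2} \<times> cbox a b \<subseteq> {0<..<T} \<times> \<Omega>" using t ab by auto
    fix x :: "real \<times> 'a" assume "x \<notin> {t1..t2} \<times> cbox a b"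
    then show "\<eta> (fst x) * box_bump n a b (snd x) = 0"
      using z[of "fst x"] box_bump_eq_0[of "snd x" a b n] box_subset_cbox by (cases x) auto
  qed
  have "((\<lambda>z::real \<times> 'a. \<eta> (fst z)) has_derivative (\<lambda>h. \<eta>' (fst w) * fst h)) (at w)"
    by (rule has_derivative_compose[OF bounded_linear_imp_has_derivative[OF bounded_linear_fst] d[unfolded has_field_derivative_def]])
  moreover have "((\<lambda>z::real \<times> 'a. box_bump n a b (snd z)) has_derivative
       (\<lambda>h. (frechet_derivative (box_bump n a b) (at (snd w))) (snd h))) (at w)"
    by (rule has_derivative_compose[OF bounded_linear_imp_has_derivative[OF bounded_linear_snd]
          smooth_on_has_derivative[OF box_bump_smooth]])
  ultimately have "((\<lambda>z. \<eta> (fst z) * box_bump n a b (snd z)) has_derivative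
     (\<lambda>h. \<eta> (fst w) * (frechet_derivative (box_bump n a b) (at (snd w))) (snd h) + (\<eta>' (fst w) * fst h) * box_bump n a b (snd w))) (at w)"
    by (rule has_derivative_mult)
  from frechet_derivative_at[OF this]
  have fd: "frechet_derivative (\<lambda>z. \<eta> (fst z) * box_bump n a b (snd z)) (at w) =
     (\<lambda>h. \<eta> (fst w) * (frechet_derivative (box_bump n a b) (at (snd w))) (snd h) + (\<eta>' (fst w) * fst h) * box_bump n a b (snd w))"
    by (rule sym)
  show "time_deriv (\<lambda>z. \<eta> (fst z) * box_bump n a b (snd z)) w = \<eta>' (fst w) * box_bump n a b (snd w)"
    unfolding time_deriv_def fd
    using linear_0[OF has_derivative_linear[OF smooth_on_has_derivative[OF box_bump_smooth]], of n a b "snd w"]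
    by simp
qed

section \<open>Weak time derivatives and primitives\<close>

text \<open>The limit of the bump primitives in closed form: a ramp that rises from 0 at time c to d
  - c at time d.\<close>

lemma measure_Iic_Ioo:
  assumes "c \<le> d"
  shows "(LINT s|lborel. indicator {..t} s * indicator {c<..<d} s) = max 0 (min t d - c :: real)"
proof -
  have eq: "(\<lambda>s. indicat_real {..t} s * indicator {c<..<d} s) = indicator ({..t} \<inter> {c<..<d})"
    by (simp add: indicator_inter_arith fun_eq_iff)
  have "(LINT s|lborel. indicator {..t} s * indicator {c<..<d} s) = measure lborel ({..t} \<inter> {c<..<d})"
    unfolding eq by simp
  also have "\<dots> = max 0 (min t d - c)"
  proof -
    consider "t < c" | "c \<le> t" "t < d" | "d \<le> t" by linarith
    then show ?thesis
    proof cases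
      case 1
      then have "{..t} \<inter> {c<..<d} = {}" by auto
      then show ?thesis using 1 assms by simp
    next
      case 2
      then have "{..t} \<inter> {c<..<d} = {c<..t}" by auto
      then show ?thesis using 2 by simp
    next
      case 3
      then have "{..t} \<inter> {c<..<d} = {c<..<d}" by auto
      then show ?thesis using 3 assms by simp
    qed
  qed
  finally show ?thesis .
qed

lemma bump_primitive_const:
  assumes "0 < c" "d \<le> t" "d \<le> t'" shows "bump_primitive n c d t = bump_primitive n c d t'"
proof -
  have "(\<lambda>s. indicator {..t} s * bump n c d s) = (\<lambda>s. indicator {..t'} s * bump n c d s)"
    using assms bump_0[of _ c d n] by (intro ext) (auto simp: indicator_def)
  then show ?thesis by (simp add: bump_primitive_eq_integral[OF assms(1)])
qed

lemma integral_dominated_mult: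
  fixes z :: "'b \<Rightarrow> real"
  assumes z: "integrable M z" and f: "\<And>n. f n \<in> borel_measurable M" "g \<in> borel_measurable M"
    and lim: "\<And>w. (\<lambda>n. f n w) \<longlonglongrightarrow> g w" and bound: "\<And>n w. \<bar>f n w\<bar> \<le> C"
  shows "(\<lambda>n. LINT w|M. z w * f n w) \<longlonglongrightarrow> (LINT w|M. z w * g w)"
proof (rule integral_dominated_convergence[where w = "\<lambda>w. C * \<bar>z w\<bar>"])
  show "integrable M (\<lambda>w. C * \<bar>z w\<bar>)" using z by simp
  show "AE w in M. (\<lambda>n. z w * f n w) \<longlonglongrightarrow> z w * g w" by (intro AE_I2 tendsto_mult tendsto_const lim)
  show "AE w in M. norm (z w * f n w) \<le> C * \<bar>z w\<bar>" for n
    using mult_right_mono[OF bound[of n] abs_ge_zero[of "z _"]]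
    by (intro AE_I2) (simp add: abs_mult mult.commute[of "\<bar>z _\<bar>"])
qed (use z f in \<open>measurable\<close>)

lemma integrable_mult_bounded:
  fixes z :: "'b \<Rightarrow> real"
  assumes z: "integrable M z" and f: "f \<in> borel_measurable M" and bound: "\<And>w. \<bar>f w\<bar> \<le> C"
  shows "integrable M (\<lambda>w. z w * f w)"
proof (rule Bochner_Integration.integrable_bound)
  show "integrable M (\<lambda>w. C * \<bar>z w\<bar>)" using z by simp
  show "AE w in M. norm (z w * f w) \<le> norm (C * \<bar>z w\<bar>)"
  proof (intro AE_I2)
    fix w
    have "norm (z w * f w) \<le> C * \<bar>z w\<bar>"
      using mult_right_mono[OF bound[of w] abs_ge_zero[of "z w"]] by (simp add: abs_mult mult.commute[of "\<bar>z w\<bar>"])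
    then show "norm (z w * f w) \<le> norm (C * \<bar>z w\<bar>)" by simp
  qed
qed (use z f in \<open>measurable\<close>)

lemma borel_measurable_fst_comp:
  "f \<in> borel_measurable borel \<Longrightarrow> (\<lambda>w::real \<times> 'a::euclidean_space. f (fst w)) \<in> borel_measurable lborel" for f :: "real \<Rightarrow> real"
  by (rule measurable_compose[of fst lborel borel f])
    (simp_all add: borel_measurable_continuous_onI continuous_on_fst)

lemma borel_measurable_snd_comp:
  "f \<in> borel_measurable borel \<Longrightarrow> (\<lambda>w::real \<times> 'a::euclidean_space. f (snd w)) \<in> borel_measurable lborel" for f :: "'a::euclidean_space \<Rightarrow> real"
  by (rule measurable_compose[of snd lborel borel f])
    (simp_all add: borel_measurable_continuous_onI continuous_on_snd)

text \<open>The time profile of the test function is a primitive of a combination of two bumps with total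
  mass zero, which makes its support compact.\<close>

lemma weak_time_derivative_tent:
  fixes z \<zeta> :: "real \<times> 'a::euclidean_space \<Rightarrow> real"
  assumes z: "integrable lborel z" and \<zeta>: "integrable lborel \<zeta>"
    and weak: "\<And>\<psi>. \<psi> \<in> test_functions ({0<..<T} \<times> \<Omega>) \<Longrightarrow>
      (LINT w|lborel. z w * time_deriv \<psi> w) = - (LINT w|lborel. \<zeta> w * \<psi> w)"
    and t1: "0 < c1" "c1 \<le> d1" "d1 < T" and t2: "0 < c2" "c2 \<le> d2" "d2 < T" and ab: "cbox a b \<subseteq> \<Omega>"
  shows "(LINT w|lborel. z w * (((d2 - c2) * indicator {c1<..<d1} (fst w) - (d1 - c1) * indicator {c2<..<d2} (fst w)) * indicator (box a b) (snd w)))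
    = - (LINT w|lborel. \<zeta> w * (((d2 - c2) * max 0 (min (fst w) d1 - c1) - (d1 - c1) * max 0 (min (fst w) d2 - c2)) * indicator (box a b) (snd w)))"
proof -
  \<comment> \<open>The time T lies beyond both intervals, so these values are the total masses of
    the two bumps; each bump is weighted with the mass of the other.\<close>
  define I where "I n = bump_primitive n c1 d1 T" for n
  define J where "J n = bump_primitive n c2 d2 T" for n
  define \<eta> where "\<eta> n t = J n * bump_primitive n c1 d1 t - I n * bump_primitive n c2 d2 t" for n t
  define \<eta>' where "\<eta>' n t = J n * bump n c1 d1 t - I n * bump n c2 d2 t" for n t
  have IJ: "\<bar>I n\<bar> \<le> d1 - c1" "\<bar>J n\<bar> \<le> d2 - c2" for n
    unfolding I_def J_def using bump_primitive_bound t1 t2 by auto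
  have limIJ: "I \<longlonglongrightarrow> d1 - c1" "J \<longlonglongrightarrow> d2 - c2"
    using bump_primitive_tendsto[of c1 d1 T] bump_primitive_tendsto[of c2 d2 T] t1 t2
    by (simp_all add: measure_Iic_Ioo I_def[abs_def] J_def[abs_def])
  have s: "smooth_on UNIV (\<eta> n)" for n
    unfolding \<eta>_def[abs_def] using t1 t2 by (intro smooth_on_diff smooth_intros bump_primitive_smooth)
  have d: "(\<eta> n has_real_derivative \<eta>' n t) (at t)" for n t
    unfolding \<eta>_def[abs_def] \<eta>'_def using t1 t2 by (auto intro!: derivative_eq_intros bump_primitive_has_derivative)
  have zero: "\<eta> n t = 0" if "t \<notin> {min c1 c2..max d1 d2}" for n t
  proof (cases "t < min c1 c2")
    case True
    then show ?thesis by (simp add: \<eta>_def bump_primitive_eq_0)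
  next
    case False
    then have "max d1 d2 < t" using that by auto
    then have "bump_primitive n c1 d1 t = I n" "bump_primitive n c2 d2 t = J n"
      unfolding I_def J_def using t1 t2 by (auto intro!: bump_primitive_const)
    then show ?thesis by (simp add: \<eta>_def)
  qed
  have bnd: "0 < min c1 c2" "max d1 d2 < T" using t1 t2 by auto
  have test: "(\<lambda>w. \<eta> n (fst w) * box_bump n a b (snd w)) \<in> test_functions ({0<..<T} \<times> \<Omega>)" for n
    by (rule tensor_test_function(1)[OF s d _ bnd ab]) (rule zero)
  have td: "time_deriv (\<lambda>w. \<eta> n (fst w) * box_bump n a b (snd w)) w = \<eta>' n (fst w) * box_bump n a b (snd w)" for n w
    by (rule tensor_test_function(2)[OF s d _ bnd ab]) (rule zero)
  have weak': "(LINT w|lborel. z w * (\<eta>' n (fst w) * box_bump n a b (snd w))) = - (LINT w|lborel. \<zeta> w * (\<eta> n (fst w) * box_bump n a b (snd w)))" for n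
    using weak[OF test[of n]] unfolding td .
  have m: "\<eta> n \<in> borel_measurable borel" "\<eta>' n \<in> borel_measurable borel" for n
    unfolding \<eta>'_def[abs_def] using smooth_on_continuous[OF s[of n]] by (auto intro: borel_measurable_continuous_onI)
  have mB: "indicat_real (box a b) \<in> borel_measurable borel" by simp
  have \<theta>: "\<bar>x * box_bump n a b y\<bar> \<le> \<bar>x\<bar>" for x y n
    using box_bump_bounds[of n a b y] mult_left_mono[of "box_bump n a b y" 1 "\<bar>x\<bar>"] by (simp add: abs_mult)
  have b\<eta>': "\<bar>\<eta>' n t\<bar> \<le> (d2 - c2) + (d1 - c1)" for n t
  proof -
    have "\<bar>\<eta>' n t\<bar> \<le> \<bar>J n\<bar> * \<bar>bump n c1 d1 t\<bar> + \<bar>I n\<bar> * \<bar>bump n c2 d2 t\<bar>"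
      unfolding \<eta>'_def by (simp flip: abs_mult)
    also have "\<dots> \<le> (d2 - c2) * 1 + (d1 - c1) * 1"
      using IJ[of n] bump_bounds[of n] t1 t2 by (intro add_mono mult_mono) auto
    finally show ?thesis by simp
  qed
  have b\<eta>: "\<bar>\<eta> n t\<bar> \<le> (d2 - c2) * (d1 - c1) + (d1 - c1) * (d2 - c2)" for n t
  proof -
    have "\<bar>\<eta> n t\<bar> \<le> \<bar>J n\<bar> * \<bar>bump_primitive n c1 d1 t\<bar> + \<bar>I n\<bar> * \<bar>bump_primitive n c2 d2 t\<bar>"
      unfolding \<eta>_def by (simp flip: abs_mult)
    also have "\<dots> \<le> (d2 - c2) * (d1 - c1) + (d1 - c1) * (d2 - c2)"
      using IJ[of n] t1 t2 by (intro add_mono mult_mono bump_primitive_bound) auto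
    finally show ?thesis .
  qed
  have mi: "(\<lambda>t. (d2 - c2) * indicator {c1<..<d1} t - (d1 - c1) * indicator {c2<..<d2} t) \<in> borel_measurable (borel :: real measure)"
    "(\<lambda>t. (d2 - c2) * max 0 (min t d1 - c1) - (d1 - c1) * max 0 (min t d2 - c2)) \<in> borel_measurable (borel :: real measure)"
    by measurable
  \<comment> \<open>The bounds on the time profiles do not depend on n, so dominated convergence
    replaces the bumps by indicators and, further below, their primitives by ramps.\<close>
  have 1: "(\<lambda>n. LINT w|lborel. z w * (\<eta>' n (fst w) * box_bump n a b (snd w))) \<longlonglongrightarrow>
     (LINT w|lborel. z w * (((d2 - c2) * indicator {c1<..<d1} (fst w) - (d1 - c1) * indicator {c2<..<d2} (fst w)) * indicator (box a b) (snd w)))"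
  proof (rule integral_dominated_mult[OF z])
    show "(\<lambda>n. \<eta>' n (fst w) * box_bump n a b (snd w)) \<longlonglongrightarrow>
      ((d2 - c2) * indicator {c1<..<d1} (fst w) - (d1 - c1) * indicator {c2<..<d2} (fst w)) * indicator (box a b) (snd w)" for w
      unfolding \<eta>'_def by (intro tendsto_intros limIJ bump_tendsto box_bump_tendsto)
    show "\<bar>\<eta>' n (fst w) * box_bump n a b (snd w)\<bar> \<le> (d2 - c2) + (d1 - c1)" for n w
      by (rule order_trans[OF \<theta> b\<eta>'])
  qed (intro borel_measurable_times borel_measurable_fst_comp borel_measurable_snd_comp m mi mB box_bump_borel)+
  have lim\<eta>: "(\<lambda>n. \<eta> n t) \<longlonglongrightarrow> (d2 - c2) * max 0 (min t d1 - c1) - (d1 - c1) * max 0 (min t d2 - c2)" for t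
    unfolding \<eta>_def using bump_primitive_tendsto[of c1 d1 t] bump_primitive_tendsto[of c2 d2 t] t1 t2 
    by (intro tendsto_intros limIJ) (simp_all add: measure_Iic_Ioo)
  have 2: "(\<lambda>n. LINT w|lborel. \<zeta> w * (\<eta> n (fst w) * box_bump n a b (snd w))) \<longlonglongrightarrow>
     (LINT w|lborel. \<zeta> w * (((d2 - c2) * max 0 (min (fst w) d1 - c1) - (d1 - c1) * max 0 (min (fst w) d2 - c2)) * indicator (box a b) (snd w)))"
  proof (rule integral_dominated_mult[OF \<zeta>])
    show "(\<lambda>n. \<eta> n (fst w) * box_bump n a b (snd w)) \<longlonglongrightarrow>
      ((d2 - c2) * max 0 (min (fst w) d1 - c1) - (d1 - c1) * max 0 (min (fst w) d2 - c2)) * indicator (box a b) (snd w)" for w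
      by (intro tendsto_intros lim\<eta> box_bump_tendsto)
    show "\<bar>\<eta> n (fst w) * box_bump n a b (snd w)\<bar> \<le> (d2 - c2) * (d1 - c1) + (d1 - c1) * (d2 - c2)" for n w
      by (rule order_trans[OF \<theta> b\<eta>])
  qed (intro borel_measurable_times borel_measurable_fst_comp borel_measurable_snd_comp m mi mB box_bump_borel)+
  from LIMSEQ_unique[OF 1 tendsto_minus[OF 2, folded weak']] show ?thesis .
qed

text \<open>In \<open>weak_time_derivative_tent\<close> the second interval is (r, 2r), and the
  identity is divided by r before r tends to 0. The initial condition removes the averages of z over
  this interval, while the second ramp divided by r tends to the indicator of positive
  times.\<close>

lemma weak_time_derivative_initial:
  fixes z \<zeta> :: "real \<times> 'a::euclidean_space \<Rightarrow> real"
  assumes z: "integrable lborel z" and \<zeta>: "integrable lborel \<zeta>"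
    and weak: "\<And>\<psi>. \<psi> \<in> test_functions ({0<..<T} \<times> \<Omega>) \<Longrightarrow>
      (LINT w|lborel. z w * time_deriv \<psi> w) = - (LINT w|lborel. \<zeta> w * \<psi> w)"
    and init: "\<And>e. 0 < e \<Longrightarrow> \<exists>r>0. \<forall>\<rho>. 0 < \<rho> \<and> \<rho> < r \<longrightarrow>
      (LINT w|lborel. \<bar>z w\<bar> * indicator ({\<rho><..<2 * \<rho>} \<times> \<Omega>) w) \<le> e * \<rho>"
    and open\<Omega>: "open \<Omega>" and t: "0 < c" "c \<le> d" "d < T" and ab: "cbox a b \<subseteq> \<Omega>"
  shows "(LINT w|lborel. z w * (indicator {c<..<d} (fst w) * indicator (box a b) (snd w)))
    = (LINT w|lborel. \<zeta> w * (((d - c) * indicator {0<..} (fst w) - max 0 (min (fst w) d - c)) * indicator (box a b) (snd w)))"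
proof -
  \<comment> \<open>The factor T/3 keeps 2r below T.\<close>
  define r where "r n = T / 3 * inverse (real (Suc n))" for n
  have T: "0 < T" using t by simp
  have r: "0 < r n" "2 * r n < T" for n
  proof -
    have "inverse (real (Suc n)) \<le> 1" "0 < inverse (real (Suc n))" by (auto simp: inverse_le_1_iff)
    then show "0 < r n" "2 * r n < T"
      using T mult_left_mono[of "inverse (real (Suc n))" 1 "T / 3"] by (auto simp: r_def simp del: of_nat_Suc)
  qed
  have "r \<longlonglongrightarrow> T / 3 * 0"
    unfolding r_def[abs_def] by (intro tendsto_mult tendsto_const LIMSEQ_inverse_real_of_nat)
  then have rlim: "r \<longlonglongrightarrow> 0" by simp
  let ?B = "\<lambda>w::real \<times> 'a. indicat_real (box a b) (snd w)"
  define A where "A = (LINT w|lborel. z w * (indicator {c<..<d} (fst w) * ?B w))"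
  define L where "L = (LINT w|lborel. \<zeta> w * (max 0 (min (fst w) d - c) * ?B w))"
  define E where "E n = (LINT w|lborel. z w * (indicator {r n<..<2 * r n} (fst w) * ?B w))" for n
  define F where "F n = (LINT w|lborel. \<zeta> w * (max 0 (min (fst w) (2 * r n) - r n) * ?B w))" for n
  have mB: "indicat_real (box a b) \<in> borel_measurable borel" by simp
  have mi: "(\<lambda>t. indicat_real {x<..<y} t) \<in> borel_measurable borel" "(\<lambda>t. max 0 (min t y - x)) \<in> borel_measurable borel" for x y :: real
    by measurable
  note mm = borel_measurable_times[OF borel_measurable_fst_comp borel_measurable_snd_comp[OF mB]]
  have iz: "integrable lborel (\<lambda>w. z w * (indicator {x<..<y} (fst w) * ?B w))" for x y
    by (rule integrable_mult_bounded[OF z mm[OF mi(1)], where C = 1]) (auto simp: indicator_def)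
  have i\<zeta>: "integrable lborel (\<lambda>w. \<zeta> w * (max 0 (min (fst w) y - x) * ?B w))" for x y
    by (rule integrable_mult_bounded[OF \<zeta> mm[OF mi(2)], where C = "\<bar>y - x\<bar>"]) (auto simp: indicator_def)
  have main: "A = (d - c) * (E n / r n) - L + (d - c) * (F n / r n)" for n
  proof -
    have "r n * A - (d - c) * E n = (LINT w|lborel. z w * ((r n * indicator {c<..<d} (fst w) - (d - c) * indicator {r n<..<2 * r n} (fst w)) * ?B w))"
    proof -
      have "(LINT w|lborel. z w * ((r n * indicator {c<..<d} (fst w) - (d - c) * indicator {r n<..<2 * r n} (fst w)) * ?B w))
        = (LINT w|lborel. r n * (z w * (indicator {c<..<d} (fst w) * ?B w)) - (d - c) * (z w * (indicator {r n<..<2 * r n} (fst w) * ?B w)))"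
        by (rule Bochner_Integration.integral_cong[OF refl]) (simp only: algebra_simps)
      also have "\<dots> = r n * A - (d - c) * E n"
        unfolding A_def E_def using iz by simp
      finally show ?thesis by (rule sym)
    qed
    also have "\<dots> = - (LINT w|lborel. \<zeta> w * ((r n * max 0 (min (fst w) d - c) - (d - c) * max 0 (min (fst w) (2 * r n) - r n)) * ?B w))"
      using weak_time_derivative_tent[OF z \<zeta> weak t, where ?c2.0 = "r n" and ?d2.0 = "2 * r n" and a = a and b = b] r[of n] ab by simp
    also have "\<dots> = - (r n * L - (d - c) * F n)"
    proof -
      have "(LINT w|lborel. \<zeta> w * ((r n * max 0 (min (fst w) d - c) - (d - c) * max 0 (min (fst w) (2 * r n) - r n)) * ?B w))
        = (LINT w|lborel. r n * (\<zeta> w * (max 0 (min (fst w) d - c) * ?B w)) - (d - c) * (\<zeta> w * (max 0 (min (fst w) (2 * r n) - r n) * ?B w)))"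
        by (rule Bochner_Integration.integral_cong[OF refl]) (simp only: algebra_simps)
      also have "\<dots> = r n * L - (d - c) * F n"
        unfolding L_def F_def using i\<zeta> by simp
      finally show ?thesis by simp
    qed
    finally have "r n * A = (d - c) * E n - r n * L + (d - c) * F n" by simp
    then have "A = ((d - c) * E n - r n * L + (d - c) * F n) / r n"
      using r(1)[of n] by (metis less_irrefl nonzero_mult_div_cancel_left)
    then show ?thesis using r(1)[of n] by (simp add: add_divide_distrib diff_divide_distrib)
  qed
  have "(\<lambda>n. E n / r n) \<longlonglongrightarrow> 0"
  proof (rule LIMSEQ_I)
    fix e :: real assume e: "0 < e"
    obtain \<rho>0 where \<rho>0: "0 < \<rho>0" "\<And>\<rho>. 0 < \<rho> \<Longrightarrow> \<rho> < \<rho>0 \<Longrightarrow> (LINT w|lborel. \<bar>z w\<bar> * indicator ({\<rho><..<2 * \<rho>} \<times> \<Omega>) w) \<le> e / 2 * \<rho>"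
      using init[of "e / 2"] e by auto
    obtain N where N: "\<And>n. n \<ge> N \<Longrightarrow> r n < \<rho>0"
      using order_tendstoD(2)[OF rlim \<rho>0(1)] by (auto simp: eventually_sequentially)
    have "norm (E n / r n - 0) < e" if n: "n \<ge> N" for n
    proof -
      have mQ: "indicat_real ({r n<..<2 * r n} \<times> \<Omega>) \<in> borel_measurable lborel"
        using open\<Omega> by (simp add: open_Times)
      have i: "integrable lborel (\<lambda>w. \<bar>z w\<bar> * indicator ({r n<..<2 * r n} \<times> \<Omega>) w)"
        by (rule integrable_mult_bounded[OF integrable_abs[OF z] mQ, where C = 1]) (simp add: indicator_def)
      have "norm (E n) \<le> (LINT w|lborel. norm (z w * (indicator {r n<..<2 * r n} (fst w) * ?B w)))"
        unfolding E_def by (rule integral_norm_bound)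
      also have "\<dots> \<le> (LINT w|lborel. \<bar>z w\<bar> * indicator ({r n<..<2 * r n} \<times> \<Omega>) w)"
        using ab box_subset_cbox[of a b] by (intro integral_mono integrable_norm iz i) (auto simp: indicator_def)
      also have "\<dots> \<le> e / 2 * r n" using N[OF n] r by (intro \<rho>0) auto
      finally have "norm (E n / r n - 0) \<le> e / 2" using r[of n] by (simp add: field_simps)
      then show ?thesis using e by linarith
    qed
    then show "\<exists>N. \<forall>n\<ge>N. norm (E n / r n - 0) < e" by blast
  qed
  moreover have "(\<lambda>n. F n / r n) \<longlonglongrightarrow> (LINT w|lborel. \<zeta> w * (indicator {0<..} (fst w) * ?B w))"
  proof -
    have eq: "F n / r n = (LINT w|lborel. \<zeta> w * (max 0 (min (fst w) (2 * r n) - r n) / r n * ?B w))" for n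
      unfolding F_def by (simp flip: integral_divide_zero)
    \<comment> \<open>For t > 0 the quotient equals 1 as soon as 2r < t; for t \<le> 0 it is always
      0.\<close>
    have lim: "(\<lambda>n. max 0 (min t (2 * r n) - r n) / r n) \<longlonglongrightarrow> indicator {0<..} t" for t :: real
    proof (cases "0 < t")
      case True
      then have "\<forall>\<^sub>F n in sequentially. r n < t / 2" using order_tendstoD(2)[OF rlim, of "t / 2"] by simp
      then have "\<forall>\<^sub>F n in sequentially. max 0 (min t (2 * r n) - r n) / r n = 1"
      proof eventually_elim
        case (elim n)
        then show ?case using r[of n] by simp
      qed
      then show ?thesis using True by (simp add: tendsto_eventually)
    next
      case False
      have "max 0 (min t (2 * r n) - r n) / r n = 0" for n
        using False r[of n] by simp
      then show ?thesis using False by simp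
    qed
    have bd: "\<bar>max 0 (min t (2 * r n) - r n) / r n\<bar> \<le> 1" for t n
      using r[of n] by (simp add: field_simps)
    have m1: "(\<lambda>t. max 0 (min t (2 * r n) - r n) / r n) \<in> borel_measurable borel" for n by measurable
    have m2: "(\<lambda>t::real. indicat_real {0<..} t) \<in> borel_measurable borel" by measurable
    show ?thesis unfolding eq
    proof (rule integral_dominated_mult[OF \<zeta>])
      show "(\<lambda>n. max 0 (min (fst w) (2 * r n) - r n) / r n * ?B w) \<longlonglongrightarrow> indicator {0<..} (fst w) * ?B w" for w
        by (intro tendsto_mult tendsto_const lim)
      show "\<bar>max 0 (min (fst w) (2 * r n) - r n) / r n * ?B w\<bar> \<le> 1" for n w
        using bd[of "fst w" n] by (auto simp: indicator_def)
    qed (rule mm[OF m1], rule mm[OF m2])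
  qed
  ultimately have "(\<lambda>n. (d - c) * (E n / r n) - L + (d - c) * (F n / r n)) \<longlonglongrightarrow>
     (d - c) * 0 - L + (d - c) * (LINT w|lborel. \<zeta> w * (indicator {0<..} (fst w) * ?B w))"
    by (intro tendsto_intros)
  then have "A = (d - c) * (LINT w|lborel. \<zeta> w * (indicator {0<..} (fst w) * ?B w)) - L"
    unfolding main[symmetric] by (simp add: LIMSEQ_const_iff)
  also have "\<dots> = (LINT w|lborel. (d - c) * (\<zeta> w * (indicator {0<..} (fst w) * ?B w)) - \<zeta> w * (max 0 (min (fst w) d - c) * ?B w))"
  proof -
    have "(\<lambda>t::real. indicat_real {0<..} t) \<in> borel_measurable borel" by measurable
    from integrable_mult_bounded[OF \<zeta> mm[OF this], where C = 1]
    have "integrable lborel (\<lambda>w. \<zeta> w * (indicator {0<..} (fst w) * ?B w))" by (auto simp: indicator_def)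
    then show ?thesis unfolding L_def using i\<zeta> by simp
  qed
  also have "\<dots> = (LINT w|lborel. \<zeta> w * (((d - c) * indicator {0<..} (fst w) - max 0 (min (fst w) d - c)) * ?B w))"
    by (rule Bochner_Integration.integral_cong[OF refl]) (simp only: algebra_simps)
  finally show ?thesis unfolding A_def .
qed

section \<open>Fubini's theorem and primitives in time\<close>

lemma integrable_lborel_pairD:
  fixes f :: "'a::euclidean_space \<times> 'b::euclidean_space \<Rightarrow> real"
  assumes "integrable lborel f"
  shows "AE x in lborel. integrable lborel (\<lambda>y. f (x, y))"
    "integrable lborel (\<lambda>x. LINT y|lborel. f (x, y))"
    "(LINT x|lborel. LINT y|lborel. f (x, y)) = (LINT w|lborel. f w)"
    "AE y in lborel. integrable lborel (\<lambda>x. f (x, y))"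
    "integrable lborel (\<lambda>y. LINT x|lborel. f (x, y))"
    "(LINT y|lborel. LINT x|lborel. f (x, y)) = (LINT w|lborel. f w)"
proof -
  have f: "integrable (lborel \<Otimes>\<^sub>M lborel) (\<lambda>(x, y). f (x, y))"
    using assms unfolding case_prod_eta lborel_prod .
  show "AE x in lborel. integrable lborel (\<lambda>y. f (x, y))" by (rule lborel_pair.AE_integrable_fst[OF f])
  show "integrable lborel (\<lambda>x. LINT y|lborel. f (x, y))" by (rule lborel_pair.integrable_fst[OF f])
  show "(LINT x|lborel. LINT y|lborel. f (x, y)) = (LINT w|lborel. f w)"
    using lborel_pair.integral_fst[OF f] unfolding case_prod_eta lborel_prod .
  show "AE y in lborel. integrable lborel (\<lambda>x. f (x, y))" by (rule lborel_pair.AE_integrable_snd[OF f])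
  show "integrable lborel (\<lambda>y. LINT x|lborel. f (x, y))" by (rule lborel_pair.integrable_snd[OF f])
  show "(LINT y|lborel. LINT x|lborel. f (x, y)) = (LINT w|lborel. f w)"
    using lborel_pair.integral_snd[OF f] unfolding case_prod_eta lborel_prod .
qed

lemma integrable_lborel_mult_pair:
  fixes f :: "'a::euclidean_space \<Rightarrow> real" and g :: "'b::euclidean_space \<Rightarrow> real"
  assumes f: "integrable lborel f" and g: "integrable lborel g"
  shows "integrable lborel (\<lambda>w. f (fst w) * g (snd w))"
proof -
  have [measurable]: "f \<in> borel_measurable borel" "g \<in> borel_measurable borel" using f g by auto
  have "integrable (lborel \<Otimes>\<^sub>M lborel) (\<lambda>w. f (fst w) * g (snd w))"
  proof (rule lborel_pair.Fubini_integrable)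
    show "(\<lambda>w. f (fst w) * g (snd w)) \<in> borel_measurable (lborel \<Otimes>\<^sub>M lborel)" by measurable
    show "integrable lborel (\<lambda>x. LINT y|lborel. norm (f (fst (x, y)) * g (snd (x, y))))"
      using f by (simp add: abs_mult)
    show "AE x in lborel. integrable lborel (\<lambda>y. f (fst (x, y)) * g (snd (x, y)))"
      using g by simp
  qed
  then show ?thesis unfolding lborel_prod .
qed

lemma AE_lborel_PairI:
  fixes P :: "'a::euclidean_space \<times> 'b::euclidean_space \<Rightarrow> bool"
  assumes "{z. P z} \<in> sets borel" and "AE x in lborel. AE y in lborel. P (x, y)"
  shows "AE z in lborel. P z"
  using lborel_pair.AE_pair_measure[of P] assms unfolding lborel_prod by auto

text \<open>Both orders of integration in \<open>{\<sigma> < \<tau>}\<close> give the same value, and the diagonal is a null set.\<close>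

lemma integral_mult_primitive:
  fixes f :: "real \<Rightarrow> real"
  assumes f: "integrable lborel f"
  shows "(LINT \<tau>|lborel. f \<tau> * (LINT \<sigma>|lborel. indicator {..<\<tau>} \<sigma> * f \<sigma>)) = (LINT \<tau>|lborel. f \<tau>)\<^sup>2 / 2"
proof -
  have [measurable]: "f \<in> borel_measurable borel" using f by auto
  have ff: "integrable lborel (\<lambda>w::real \<times> real. f (fst w) * f (snd w))" by (rule integrable_lborel_mult_pair[OF f f])
  have S: "indicat_real {w::real \<times> real. snd w < fst w} \<in> borel_measurable lborel" "indicat_real {w::real \<times> real. fst w < snd w} \<in> borel_measurable lborel"
    by (auto intro!: borel_measurable_indicator borel_open open_Collect_less continuous_intros)
  have i: "integrable lborel (\<lambda>w::real \<times> real. f (fst w) * f (snd w) * indicator {w. snd w < fst w} w)"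
      "integrable lborel (\<lambda>w::real \<times> real. f (fst w) * f (snd w) * indicator {w. fst w < snd w} w)"
    by (rule integrable_mult_bounded[OF ff S(1), where C = 1], simp add: indicator_def)
      (rule integrable_mult_bounded[OF ff S(2), where C = 1], simp add: indicator_def)
  define A where "A = (LINT \<tau>|lborel. f \<tau> * (LINT \<sigma>|lborel. indicator {..<\<tau>} \<sigma> * f \<sigma>))"
  have 1: "(LINT w|lborel. f (fst w) * f (snd w) * indicator {w. snd w < fst w} w) = A"
  proof -
    have "(LINT \<sigma>|lborel. f (fst (\<tau>, \<sigma>)) * f (snd (\<tau>, \<sigma>)) * indicator {w. snd w < fst w} (\<tau>, \<sigma>))
      = f \<tau> * (LINT \<sigma>|lborel. indicator {..<\<tau>} \<sigma> * f \<sigma>)" for \<tau>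
    proof -
      have "(\<lambda>\<sigma>. f (fst (\<tau>, \<sigma>)) * f (snd (\<tau>, \<sigma>)) * indicator {w. snd w < fst w} (\<tau>, \<sigma>)) = (\<lambda>\<sigma>. f \<tau> * (indicator {..<\<tau>} \<sigma> * f \<sigma>))"
        by (auto simp: indicator_def)
      then show ?thesis by simp
    qed
    then show ?thesis using integrable_lborel_pairD(3)[OF i(1)] by (simp only: A_def)
  qed
  have 2: "(LINT w|lborel. f (fst w) * f (snd w) * indicator {w. fst w < snd w} w) = A"
  proof -
    have "(LINT \<sigma>|lborel. f (fst (\<sigma>, \<tau>)) * f (snd (\<sigma>, \<tau>)) * indicator {w. fst w < snd w} (\<sigma>, \<tau>))
      = f \<tau> * (LINT \<sigma>|lborel. indicator {..<\<tau>} \<sigma> * f \<sigma>)" for \<tau>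
    proof -
      have "(\<lambda>\<sigma>. f (fst (\<sigma>, \<tau>)) * f (snd (\<sigma>, \<tau>)) * indicator {w. fst w < snd w} (\<sigma>, \<tau>)) = (\<lambda>\<sigma>. f \<tau> * (indicator {..<\<tau>} \<sigma> * f \<sigma>))"
        by (auto simp: indicator_def)
      then show ?thesis by simp
    qed
    then show ?thesis using integrable_lborel_pairD(6)[OF i(2)] by (simp only: A_def)
  qed
  have "(LINT \<tau>|lborel. f \<tau>)\<^sup>2 = (LINT \<tau>|lborel. LINT \<sigma>|lborel. f \<tau> * f \<sigma>)"
    by (simp add: power2_eq_square)
  also have "\<dots> = (LINT \<tau>|lborel. LINT \<sigma>|lborel. f (fst (\<tau>, \<sigma>)) * f (snd (\<tau>, \<sigma>)))" by simp
  also have "\<dots> = (LINT w|lborel. f (fst w) * f (snd w))" by (rule integrable_lborel_pairD(3)[OF ff])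
  also have "\<dots> = (LINT w|lborel. f (fst w) * f (snd w) * indicator {w. snd w < fst w} w + f (fst w) * f (snd w) * indicator {w. fst w < snd w} w)"
  proof (rule integral_cong_AE)
    have "AE w in (lborel :: (real \<times> real) measure). fst w \<noteq> snd w"
    proof (rule AE_lborel_PairI)
      show "{w::real \<times> real. fst w \<noteq> snd w} \<in> sets borel"
        by (intro borel_open open_Collect_neq continuous_intros)
    qed (auto intro: AE_lborel_singleton[THEN eventually_mono])
    then show "AE w in lborel. f (fst w) * f (snd w) = f (fst w) * f (snd w) * indicator {w. snd w < fst w} w + f (fst w) * f (snd w) * indicator {w. fst w < snd w} w"
      by eventually_elim (auto simp: indicator_def)
  qed (use ff i in auto)
  also have "\<dots> = A + A" using 1 2 i by simp
  finally show ?thesis unfolding A_def by simp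
qed

text \<open>Integration runs over all earlier times; for functions that vanish at nonpositive times
  this is the primitive starting at 0. Where the slice is not integrable the value may be the
  default 0, which for integrable \<zeta> concerns only a null set of space points.\<close>

definition time_primitive :: "(real \<times> 'a::euclidean_space \<Rightarrow> real) \<Rightarrow> real \<times> 'a \<Rightarrow> real" where
  "time_primitive \<zeta> w = (LINT \<tau>|lborel. indicator {..<fst w} \<tau> * \<zeta> (\<tau>, snd w))"

context
  fixes \<zeta> :: "real \<times> 'a::euclidean_space \<Rightarrow> real"
  assumes \<zeta>: "integrable lborel \<zeta>"
begin

lemma measurable_section_kernel:
  "(\<lambda>(w, \<tau>). indicat_real {..<fst w} \<tau> * \<zeta> (\<tau>, snd w)) \<in> borel_measurable (lborel \<Otimes>\<^sub>M lborel)"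
proof -
  have [measurable]: "\<zeta> \<in> borel_measurable borel" using \<zeta> by auto
  have "open {x::(real \<times> 'a) \<times> real. snd x < fst (fst x)}"
    by (intro open_Collect_less continuous_intros)
  then have 1: "indicat_real {x::(real \<times> 'a) \<times> real. snd x < fst (fst x)} \<in> borel_measurable borel"
    by (intro borel_measurable_indicator borel_open)
  have "(\<lambda>x::(real \<times> 'a) \<times> real. (snd x, snd (fst x))) \<in> borel_measurable borel"
    by (intro borel_measurable_continuous_onI continuous_intros)
  then have 2: "(\<lambda>x::(real \<times> 'a) \<times> real. \<zeta> (snd x, snd (fst x))) \<in> borel_measurable borel"
    by (rule measurable_compose) measurable
  have "(\<lambda>(w, \<tau>). indicat_real {..<fst w} \<tau> * \<zeta> (\<tau>, snd w)) = (\<lambda>x::(real \<times> 'a) \<times> real. indicat_real {x. snd x < fst (fst x)} x * \<zeta> (snd x, snd (fst x)))"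
    by (auto simp: indicator_def)
  then show ?thesis using borel_measurable_times[OF 1 2] unfolding lborel_prod by simp
qed

lemma time_primitive_measurable: "time_primitive \<zeta> \<in> borel_measurable borel"
proof -
  have "(\<lambda>w. LINT \<tau>|lborel. indicat_real {..<fst w} \<tau> * \<zeta> (\<tau>, snd w)) \<in> borel_measurable lborel"
    by (rule lborel.borel_measurable_lebesgue_integral[OF measurable_section_kernel])
  then show ?thesis unfolding time_primitive_def[abs_def] by simp
qed

text \<open>The exceptional set depends on x alone: integrability of the slice in time bounds the
  primitive for all t at once.\<close>

lemma time_primitive_bound: "AE x in lborel. \<forall>t. \<bar>time_primitive \<zeta> (t, x)\<bar> \<le> (LINT \<tau>|lborel. \<bar>\<zeta> (\<tau>, x)\<bar>)"
  using integrable_lborel_pairD(4)[OF \<zeta>]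
proof eventually_elim
  case (elim x)
  show ?case
  proof
    fix t
    have i: "integrable lborel (\<lambda>\<tau>. \<zeta> (\<tau>, x) * indicator {..<t} \<tau>)"
      by (rule integrable_mult_bounded[OF elim, where C = 1]) auto
    have "norm (LINT \<tau>|lborel. \<zeta> (\<tau>, x) * indicator {..<t} \<tau>) \<le> (LINT \<tau>|lborel. norm (\<zeta> (\<tau>, x) * indicator {..<t} \<tau>))"
      by (rule integral_norm_bound)
    also have "\<dots> \<le> (LINT \<tau>|lborel. \<bar>\<zeta> (\<tau>, x)\<bar>)"
      using elim by (intro integral_mono integrable_norm i) (auto simp: indicator_def)
    finally show "\<bar>time_primitive \<zeta> (t, x)\<bar> \<le> (LINT \<tau>|lborel. \<bar>\<zeta> (\<tau>, x)\<bar>)"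
      by (simp add: time_primitive_def mult.commute)
  qed
qed

lemma time_primitive_integrable:
  "integrable lborel (\<lambda>w. indicator {c<..<d} (fst w) * time_primitive \<zeta> w)"
proof (rule Bochner_Integration.integrable_bound)
  have "integrable lborel (\<lambda>x. LINT \<tau>|lborel. \<bar>\<zeta> (\<tau>, x)\<bar>)"
    using integrable_lborel_pairD(5)[OF integrable_norm[OF \<zeta>]] by simp
  from integrable_lborel_mult_pair[OF integrable_indicator_Ioo this]
  show "integrable lborel (\<lambda>w. indicat_real {c<..<d} (fst w) * (LINT \<tau>|lborel. \<bar>\<zeta> (\<tau>, snd w)\<bar>))" .
  show "(\<lambda>w. indicat_real {c<..<d} (fst w) * time_primitive \<zeta> w) \<in> borel_measurable lborel"
    by (intro borel_measurable_times borel_measurable_fst_comp) (use time_primitive_measurable in auto)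
  obtain N where N: "{x. \<not> (\<forall>t. \<bar>time_primitive \<zeta> (t, x)\<bar> \<le> (LINT \<tau>|lborel. \<bar>\<zeta> (\<tau>, x)\<bar>))} \<subseteq> N" "N \<in> null_sets lborel"
    using time_primitive_bound unfolding eventually_ae_filter by auto
  have "AE w in (lborel :: (real \<times> 'a) measure). snd w \<notin> N"
  proof (rule AE_lborel_PairI)
    have "snd \<in> borel_measurable (borel :: (real \<times> 'a) measure)"
      by (intro borel_measurable_continuous_onI continuous_intros)
    from measurable_sets_borel[OF this, of "- N"] N(2)
    show "{w::real \<times> 'a. snd w \<notin> N} \<in> sets borel" by (auto simp: vimage_def null_sets_def)
  qed (use N(2) in \<open>auto intro: AE_not_in\<close>)
  then show "AE w in lborel. norm (indicat_real {c<..<d} (fst w) * time_primitive \<zeta> w) \<le> norm (indicat_real {c<..<d} (fst w) * (LINT \<tau>|lborel. \<bar>\<zeta> (\<tau>, snd w)\<bar>))"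
  proof eventually_elim
    case (elim w)
    then have "\<bar>time_primitive \<zeta> (fst w, snd w)\<bar> \<le> (LINT \<tau>|lborel. \<bar>\<zeta> (\<tau>, snd w)\<bar>)" using N(1) by blast
    then show ?case by (auto simp: indicator_def)
  qed
qed

text \<open>Fubini trades the primitive for a weight: integrating the condition \<tau> < s over s in
  (c, d) leaves d - c minus the length of the part of (c, d) up to \<tau>. For \<zeta> supported in
  positive times this is the right-hand side of \<open>weak_time_derivative_initial\<close>.\<close>

lemma integral_time_primitive_box:
  assumes c: "c \<le> d"
  shows "(LINT w|lborel. time_primitive \<zeta> w * (indicator {c<..<d} (fst w) * indicator (box a b) (snd w)))
     = (LINT w|lborel. \<zeta> w * (((d - c) - max 0 (min (fst w) d - c)) * indicator (box a b) (snd w)))"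
proof -
  \<comment> \<open>The variables are ordered as (s, (\<tau>, x)): integration in s produces the
    weight, integration in (\<tau>, x) produces the primitive at time s.\<close>
  define F :: "real \<times> real \<times> 'a \<Rightarrow> real" where
    "F x = indicator {c<..<d} (fst x) * \<zeta> (snd x) * (indicator {x. fst (snd x) < fst x} x * indicator (box a b) (snd (snd x)))" for x
  have "open {x::real \<times> real \<times> 'a. fst (snd x) < fst x}"
    by (intro open_Collect_less continuous_intros)
  moreover have "open ((\<lambda>x::real \<times> real \<times> 'a. snd (snd x)) -` box a b)"
    by (intro open_vimage open_box continuous_intros)
  ultimately have m: "(\<lambda>x. indicat_real {x::real \<times> real \<times> 'a. fst (snd x) < fst x} x * indicator ((\<lambda>x. snd (snd x)) -` box a b) x) \<in> borel_measurable lborel"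
    by (intro borel_measurable_times) (auto intro!: borel_measurable_indicator borel_open)
  have "(\<lambda>x. indicat_real {x::real \<times> real \<times> 'a. fst (snd x) < fst x} x * indicator ((\<lambda>x. snd (snd x)) -` box a b) x)
      = (\<lambda>x. indicator {x. fst (snd x) < fst x} x * indicator (box a b) (snd (snd x)))"
    by (simp add: indicator_def)
  note m' = m[unfolded this]
  have F: "integrable lborel F" unfolding F_def[abs_def]
    by (rule integrable_mult_bounded[OF integrable_lborel_mult_pair[OF integrable_indicator_Ioo \<zeta>] m', where C = 1])
      (simp add: indicator_def)
  have "(LINT w|lborel. LINT s|lborel. F (s, w)) = (LINT w|lborel. \<zeta> w * (((d - c) - max 0 (min (fst w) d - c)) * indicator (box a b) (snd w)))"
  proof (rule Bochner_Integration.integral_cong[OF refl])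
    fix w :: "real \<times> 'a"
    have "(LINT s|lborel. F (s, w)) = (LINT s|lborel. (indicator {c<..<d} s - indicator {..fst w} s * indicator {c<..<d} s) * (\<zeta> w * indicator (box a b) (snd w)))"
      by (rule Bochner_Integration.integral_cong[OF refl]) (auto simp: F_def indicator_def)
    also have "\<dots> = (LINT s|lborel. indicator {c<..<d} s - indicator {..fst w} s * indicator {c<..<d} s) * (\<zeta> w * indicator (box a b) (snd w))"
      by (rule integral_mult_left_zero)
    also have "(LINT s|lborel. indicat_real {c<..<d} s - indicator {..fst w} s * indicator {c<..<d} s) = (d - c) - max 0 (min (fst w) d - c)"
    proof -
      have "integrable lborel (\<lambda>s. indicat_real {c<..<d} s * indicator {..fst w} s)"
        by (rule integrable_mult_bounded[OF integrable_indicator_Ioo, where C = 1]) auto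
      then have "integrable lborel (\<lambda>s. indicat_real {..fst w} s * indicator {c<..<d} s)" by (simp add: mult.commute)
      then show ?thesis using integrable_indicator_Ioo[of c d] c by (simp add: measure_Iic_Ioo)
    qed
    finally show "(LINT s|lborel. F (s, w)) = \<zeta> w * (((d - c) - max 0 (min (fst w) d - c)) * indicator (box a b) (snd w))"
      by (simp only: mult_ac)
  qed
  moreover have "(LINT s|lborel. LINT w|lborel. F (s, w)) = (LINT s|lborel. LINT x|lborel. time_primitive \<zeta> (s, x) * (indicator {c<..<d} s * indicator (box a b) x))"
  proof (rule Bochner_Integration.integral_cong[OF refl])
    fix s :: real
    have "open {w::real \<times> 'a. fst w < s}" "open (snd -` box a b :: (real \<times> 'a) set)"
      by (auto intro!: open_Collect_less open_vimage continuous_intros)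
    then have m: "(\<lambda>w::real \<times> 'a. indicator {c<..<d} s * (indicat_real {w. fst w < s} w * indicator (snd -` box a b) w)) \<in> borel_measurable lborel"
      by (intro borel_measurable_times) (auto intro!: borel_measurable_indicator borel_open)
    have Fs: "integrable lborel (\<lambda>w. \<zeta> w * (indicator {c<..<d} s * (indicat_real {w. fst w < s} w * indicator (snd -` box a b) w)))"
      by (rule integrable_mult_bounded[OF \<zeta> m, where C = 1]) (auto simp: indicator_def)
    have "(LINT w|lborel. F (s, w)) = (LINT w|lborel. \<zeta> w * (indicator {c<..<d} s * (indicat_real {w. fst w < s} w * indicator (snd -` box a b) w)))"
      by (rule Bochner_Integration.integral_cong[OF refl]) (auto simp: F_def indicator_def)
    also have "\<dots> = (LINT x|lborel. LINT \<tau>|lborel. \<zeta> (\<tau>, x) * (indicator {c<..<d} s * (indicat_real {w. fst w < s} (\<tau>, x) * indicator (snd -` box a b) (\<tau>, x))))"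
      by (rule integrable_lborel_pairD(6)[OF Fs, symmetric])
    also have "\<dots> = (LINT x|lborel. time_primitive \<zeta> (s, x) * (indicator {c<..<d} s * indicator (box a b) x))"
    proof (rule Bochner_Integration.integral_cong[OF refl])
      fix x
      have "(LINT \<tau>|lborel. \<zeta> (\<tau>, x) * (indicator {c<..<d} s * (indicat_real {w. fst w < s} (\<tau>, x) * indicator (snd -` box a b) (\<tau>, x))))
        = (LINT \<tau>|lborel. (indicator {..<s} \<tau> * \<zeta> (\<tau>, x)) * (indicator {c<..<d} s * indicator (box a b) x))"
        by (rule Bochner_Integration.integral_cong[OF refl]) (auto simp: indicator_def)
      then show "(LINT \<tau>|lborel. \<zeta> (\<tau>, x) * (indicator {c<..<d} s * (indicat_real {w. fst w < s} (\<tau>, x) * indicator (snd -` box a b) (\<tau>, x))))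
         = time_primitive \<zeta> (s, x) * (indicator {c<..<d} s * indicator (box a b) x)"
        by (simp add: time_primitive_def)
    qed
    finally show "(LINT w|lborel. F (s, w)) = (LINT x|lborel. time_primitive \<zeta> (s, x) * (indicator {c<..<d} s * indicator (box a b) x))" .
  qed
  moreover have "(LINT s|lborel. LINT x|lborel. time_primitive \<zeta> (s, x) * (indicator {c<..<d} s * indicator (box a b) x))
     = (LINT w|lborel. time_primitive \<zeta> w * (indicator {c<..<d} (fst w) * indicator (box a b) (snd w)))"
  proof -
    have "integrable lborel (\<lambda>w. (indicator {c<..<d} (fst w) * time_primitive \<zeta> w) * indicator (box a b) (snd w))"
      by (rule integrable_mult_bounded[OF time_primitive_integrable borel_measurable_snd_comp, where C = 1]) auto
    then have "integrable lborel (\<lambda>w. time_primitive \<zeta> w * (indicator {c<..<d} (fst w) * indicator (box a b) (snd w)))"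
      by (simp only: mult_ac)
    from integrable_lborel_pairD(3)[OF this] show ?thesis by simp
  qed
  moreover have "(LINT w|lborel. LINT s|lborel. F (s, w)) = (LINT s|lborel. LINT w|lborel. F (s, w))"
    using integrable_lborel_pairD(3,6)[OF F] by simp
  ultimately show ?thesis by simp
qed

end


section \<open>Cubes in space-time and Lebesgue points\<close>

lemma One_prod: "(One :: real \<times> 'a::euclidean_space) = (1, One)"
proof (rule euclidean_eqI)
  fix i :: "real \<times> 'a" assume i: "i \<in> Basis"
  then have "One \<bullet> i = 1" using inner_sum_left_Basis[of i "\<lambda>_. 1"] by simp
  moreover have "(1, One) \<bullet> i = 1" using i unfolding Basis_prod_def by auto
  ultimately show "One \<bullet> i = (1, One) \<bullet> i" by simp
qed

lemma mem_box_prod_One: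
  fixes w y :: "real \<times> 'a::euclidean_space"
  shows "y \<in> box w (w + h *\<^sub>R One) \<longleftrightarrow> fst y \<in> {fst w<..<fst w + h} \<and> snd y \<in> box (snd w) (snd w + h *\<^sub>R One)"
  unfolding One_prod by (cases w; cases y) (auto simp: mem_box inner_add_left Basis_prod_def)

lemma cbox_One_subset:
  fixes w :: "'a::euclidean_space"
  assumes "open Q" "w \<in> Q"
  obtains r where "0 < r" "\<And>h. 0 \<le> h \<Longrightarrow> h < r \<Longrightarrow> cbox w (w + h *\<^sub>R One) \<subseteq> Q"
proof -
  obtain e where e: "0 < e" "ball w e \<subseteq> Q" using assms by (meson openE)
  show ?thesis
  proof (rule that[of "e / DIM('a)"])
    show "0 < e / DIM('a)" using e by simp
    fix h assume h: "0 \<le> h" "h < e / DIM('a)"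
    have "dist w y < e" if y: "y \<in> cbox w (w + h *\<^sub>R One)" for y
    proof -
      have "norm (y - w) \<le> (\<Sum>i\<in>Basis. \<bar>(y - w) \<bullet> i\<bar>)" by (rule norm_le_l1)
      also have "\<dots> \<le> (\<Sum>i\<in>(Basis::'a set). h)"
        by (rule sum_mono) (use y in \<open>auto simp: mem_box inner_diff_left inner_add_left abs_le_iff\<close>)
      also have "\<dots> < e" using h by (simp add: field_simps)
      finally show ?thesis by (simp add: dist_norm norm_minus_commute)
    qed
    then show "cbox w (w + h *\<^sub>R One) \<subseteq> Q" using e(2) by auto
  qed
qed

text \<open>The averages of \<open>z\<close> and of its candidate primitive over small boxes agree, hence the functions
  agree at the Lebesgue points.\<close>

lemma weak_time_derivative_primitive:
  fixes z \<zeta> :: "real \<times> 'a::euclidean_space \<Rightarrow> real"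
  assumes z: "integrable lborel z" and \<zeta>: "integrable lborel \<zeta>"
    and weak: "\<And>\<psi>. \<psi> \<in> test_functions ({0<..<T} \<times> \<Omega>) \<Longrightarrow>
      (LINT w|lborel. z w * time_deriv \<psi> w) = - (LINT w|lborel. \<zeta> w * \<psi> w)"
    and init: "\<And>e. 0 < e \<Longrightarrow> \<exists>r>0. \<forall>\<rho>. 0 < \<rho> \<and> \<rho> < r \<longrightarrow>
      (LINT w|lborel. \<bar>z w\<bar> * indicator ({\<rho><..<2 * \<rho>} \<times> \<Omega>) w) \<le> e * \<rho>"
    and open\<Omega>: "open \<Omega>" and \<zeta>0: "\<And>w. fst w \<le> 0 \<Longrightarrow> \<zeta> w = 0"
  shows "AE w in lborel. w \<in> {0<..<T} \<times> \<Omega> \<longrightarrow> z w = time_primitive \<zeta> w"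
proof -
  define f where "f w = z w * indicator {0<..<T} (fst w) - indicator {0<..<T} (fst w) * time_primitive \<zeta> w" for w
  have iz: "integrable lborel (\<lambda>w. z w * indicator {0<..<T} (fst w))"
    by (rule integrable_mult_bounded[OF z borel_measurable_fst_comp, where C = 1]) auto
  note itp = time_primitive_integrable[OF \<zeta>]
  have f: "integrable lborel f" unfolding f_def[abs_def] by (intro Bochner_Integration.integrable_diff iz itp)
  have "f integrable_on cbox a b" for a b
    by (rule integrable_on_subcbox[OF integrable_on_lborel[OF f]]) simp
  \<comment> \<open>Lebesgue differentiation along cubes with lower corner w: outside N the averages
    of f converge to f w.\<close>
  then obtain N where N: "negligible N" "\<And>w e. w \<notin> N \<Longrightarrow> 0 < e \<Longrightarrow>
      \<exists>d>0. \<forall>h. 0 < h \<and> h < d \<longrightarrow> norm (integral (cbox w (w + h *\<^sub>R One)) f /\<^sub>R h ^ DIM(real \<times> 'a) - f w) < e"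
    using integrable_ccontinuous_explicit[of f] by blast
  have zero: "integral (cbox w (w + h *\<^sub>R One)) f = 0" if h: "0 < h" and sub: "cbox w (w + h *\<^sub>R One) \<subseteq> {0<..<T} \<times> \<Omega>" for w h
  proof -
    define c where "c = fst w"
    define x where "x = snd w"
    have w: "w = (c, x)" by (simp add: c_def x_def)
    let ?B = "box x (x + h *\<^sub>R One)"
    have incl: "(t, y) \<in> cbox w (w + h *\<^sub>R One)" if "t \<in> {c..c + h}" "y \<in> cbox x (x + h *\<^sub>R One)" for t y
      using that unfolding One_prod by (auto simp: w mem_box inner_add_left Basis_prod_def)
    have "x \<in> cbox x (x + h *\<^sub>R One)" using h by (auto simp: mem_box inner_add_left)
    then have c: "0 < c" "c + h < T" using sub incl[of c x] incl[of "c + h" x] h by auto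
    have xs: "cbox x (x + h *\<^sub>R One) \<subseteq> \<Omega>" using sub incl[of c] h by auto
    have ind: "indicator (box w (w + h *\<^sub>R One)) y = indicator {c<..<c + h} (fst y) * indicat_real ?B (snd y)" for y
      using mem_box_prod_One[of y w h] by (auto simp: indicator_def w)
    have mm: "(\<lambda>y::real \<times> 'a. indicator {c<..<c + h} (fst y) * indicat_real ?B (snd y)) \<in> borel_measurable lborel"
      by (intro borel_measurable_times borel_measurable_fst_comp borel_measurable_snd_comp) auto
    have "integral (cbox w (w + h *\<^sub>R One)) f = integral (box w (w + h *\<^sub>R One)) f"
      by (rule integral_open_interval[symmetric])
    also have "\<dots> = (LINT y:box w (w + h *\<^sub>R One)|lborel. f y)"
      by (rule set_borel_integral_eq_integral(2)[symmetric])
        (unfold set_integrable_def, intro integrable_mult_indicator f, simp)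
    also have "\<dots> = (LINT y|lborel. z y * (indicator {c<..<c + h} (fst y) * indicator ?B (snd y))
       - (indicator {0<..<T} (fst y) * time_primitive \<zeta> y) * (indicator {c<..<c + h} (fst y) * indicator ?B (snd y)))"
      unfolding set_lebesgue_integral_def ind
      by (rule Bochner_Integration.integral_cong[OF refl]) (use c in \<open>auto simp: f_def indicator_def\<close>)
    also have "\<dots> = (LINT y|lborel. z y * (indicator {c<..<c + h} (fst y) * indicator ?B (snd y)))
       - (LINT y|lborel. (indicator {0<..<T} (fst y) * time_primitive \<zeta> y) * (indicator {c<..<c + h} (fst y) * indicator ?B (snd y)))"
      by (intro Bochner_Integration.integral_diff integrable_mult_bounded[OF z mm, where C = 1] integrable_mult_bounded[OF itp mm, where C = 1])
        (auto simp: indicator_def)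
    also have "(LINT y|lborel. (indicator {0<..<T} (fst y) * time_primitive \<zeta> y) * (indicator {c<..<c + h} (fst y) * indicator ?B (snd y)))
       = (LINT y|lborel. time_primitive \<zeta> y * (indicator {c<..<c + h} (fst y) * indicator ?B (snd y)))"
      by (rule Bochner_Integration.integral_cong[OF refl]) (use c in \<open>auto simp: indicator_def\<close>)
    also have "\<dots> = (LINT w|lborel. \<zeta> w * ((((c + h) - c) - max 0 (min (fst w) (c + h) - c)) * indicator ?B (snd w)))"
      by (rule integral_time_primitive_box[OF \<zeta>]) (use h in simp)
    \<comment> \<open>The indicator of positive times may be inserted because \<zeta> vanishes at
      the other times; this is the form needed for
      \<open>weak_time_derivative_initial\<close>.\<close>
    also have "\<dots> = (LINT w|lborel. \<zeta> w * ((((c + h) - c) * indicator {0<..} (fst w) - max 0 (min (fst w) (c + h) - c)) * indicator ?B (snd w)))"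
      by (rule Bochner_Integration.integral_cong[OF refl]) (use \<zeta>0 in \<open>auto simp: indicator_def\<close>)
    also have "\<dots> = (LINT y|lborel. z y * (indicator {c<..<c + h} (fst y) * indicator ?B (snd y)))"
      by (rule weak_time_derivative_initial[OF z \<zeta> weak init open\<Omega> c(1) _ c(2) xs, symmetric]) (use h in auto)
    finally show ?thesis by simp
  qed
  have openQ: "open ({0<..<T} \<times> \<Omega>)" by (intro open_Times open\<Omega> open_greaterThanLessThan)
  have "f w = 0" if wN: "w \<notin> N" and wQ: "w \<in> {0<..<T} \<times> \<Omega>" for w
  proof (rule ccontr)
    assume "f w \<noteq> 0"
    \<comment> \<open>With tolerance |f w|, a cube average equal to 0 is already a
      contradiction.\<close>
    then obtain d where d: "0 < d" "\<And>h. 0 < h \<and> h < d \<longrightarrow> norm (integral (cbox w (w + h *\<^sub>R One)) f /\<^sub>R h ^ DIM(real \<times> 'a) - f w) < norm (f w)"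
      using N(2)[OF wN, of "norm (f w)"] by auto
    obtain r where r: "0 < r" "\<And>h. 0 \<le> h \<Longrightarrow> h < r \<Longrightarrow> cbox w (w + h *\<^sub>R One) \<subseteq> {0<..<T} \<times> \<Omega>"
      by (rule cbox_One_subset[OF openQ wQ]) blast
    define h where "h = min d r / 2"
    have h: "0 < h" "h < d" "h < r" using d(1) r(1) by (auto simp: h_def)
    have "integral (cbox w (w + h *\<^sub>R One)) f = 0" by (rule zero[OF h(1) r(2)]) (use h in auto)
    then show False using d(2)[of h] h by simp
  qed
  moreover have "AE w in lborel. w \<notin> N"
    using N(1) AE_not_in[of N "lebesgue :: (real \<times> 'a) measure"] by (simp add: negligible_iff_null_sets AE_completion_iff)
  ultimately show ?thesis
  proof (elim eventually_mono, intro impI)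
    fix w assume "\<And>w. w \<notin> N \<Longrightarrow> w \<in> {0<..<T} \<times> \<Omega> \<Longrightarrow> f w = 0" "w \<notin> N" "w \<in> {0<..<T} \<times> \<Omega>"
    then have "f w = 0" by blast
    with \<open>w \<in> _\<close> show "z w = time_primitive \<zeta> w" by (auto simp: f_def)
  qed
qed

text \<open>Let Z be the primitive of \<zeta>. At almost every x the integral of \<zeta> Z up to
  time t is Z(t, x)^2 / 2 by \<open>integral_mult_primitive\<close>. Integrated over x this is
  nonpositive, so Z(t, x) = 0 for every t in (0, T] and almost every x; joint measurability of Z
  turns this into a statement on space-time.\<close>

lemma primitive_energy_zero:
  fixes z \<zeta> :: "real \<times> 'a::euclidean_space \<Rightarrow> real"
  assumes \<zeta>: "integrable lborel \<zeta>" and \<zeta>0: "\<And>w. w \<notin> {0<..<T} \<times> \<Omega> \<Longrightarrow> \<zeta> w = 0"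
    and ae: "AE w in lborel. w \<in> {0<..<T} \<times> \<Omega> \<longrightarrow> z w = time_primitive \<zeta> w"
    and int: "integrable lborel (\<lambda>w. \<zeta> w * z w)"
    and neg: "\<And>t. 0 < t \<Longrightarrow> t \<le> T \<Longrightarrow> (LINT w|lborel. indicator {0<..<t} (fst w) * (\<zeta> w * z w)) \<le> 0"
  shows "AE w in lborel. w \<in> {0<..<T} \<times> \<Omega> \<longrightarrow> z w = 0"
proof -
  note tpm = time_primitive_measurable[OF \<zeta>]
  have \<zeta>m: "\<zeta> \<in> borel_measurable lborel" using \<zeta> by auto
  have ae': "AE w in lborel. \<zeta> w * z w = \<zeta> w * time_primitive \<zeta> w"
    using ae
  proof eventually_elim
    case (elim w)
    then show ?case using \<zeta>0[of w] by (cases "w \<in> {0<..<T} \<times> \<Omega>") auto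
  qed
  have tp0: "AE x in lborel. time_primitive \<zeta> (t, x) = 0" if t: "0 < t" "t \<le> T" for t
  proof -
    define g where "g w = indicator {0<..<t} (fst w) * (\<zeta> w * time_primitive \<zeta> w)" for w
    have mg: "g \<in> borel_measurable lborel" unfolding g_def[abs_def]
      using tpm by (intro borel_measurable_times \<zeta>m borel_measurable_fst_comp) auto
    have mi: "(\<lambda>w. indicat_real {0<..<t} (fst w) * (\<zeta> w * z w)) \<in> borel_measurable lborel"
      by (intro borel_measurable_times borel_measurable_integrable[OF int] borel_measurable_fst_comp) auto
    have "integrable lborel (\<lambda>w. (\<zeta> w * z w) * indicator {0<..<t} (fst w))"
      by (rule integrable_mult_bounded[OF int borel_measurable_fst_comp, where C = 1]) auto
    then have ii: "integrable lborel (\<lambda>w. indicat_real {0<..<t} (fst w) * (\<zeta> w * z w))" by (simp only: mult.commute)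
    have eq: "AE w in lborel. indicat_real {0<..<t} (fst w) * (\<zeta> w * z w) = g w"
      using ae' by eventually_elim (simp add: g_def)
    have ig: "integrable lborel g" using integrable_cong_AE[OF mi mg eq] ii by simp
    have "(LINT w|lborel. g w) \<le> 0" using integral_cong_AE[OF mi mg eq] neg[OF t] by simp
    then have le: "(LINT x|lborel. LINT \<tau>|lborel. g (\<tau>, x)) \<le> 0" using integrable_lborel_pairD(6)[OF ig] by simp
    have aeg: "AE x in lborel. (LINT \<tau>|lborel. g (\<tau>, x)) = (time_primitive \<zeta> (t, x))\<^sup>2 / 2"
      using integrable_lborel_pairD(4)[OF \<zeta>]
    proof eventually_elim
      case (elim x)
      define f where "f \<tau> = \<zeta> (\<tau>, x) * indicator {0<..<t} \<tau>" for \<tau>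
      have f: "integrable lborel f" unfolding f_def[abs_def]
        by (rule integrable_mult_bounded[OF elim, where C = 1]) auto
      \<comment> \<open>Up to time t, cutting \<zeta> off to (0, t) does not change the primitive,
        since \<zeta> vanishes at nonpositive times.\<close>
      have tp: "time_primitive \<zeta> (\<tau>, x) = (LINT \<sigma>|lborel. indicator {..<\<tau>} \<sigma> * f \<sigma>)" if "\<tau> \<le> t" for \<tau>
        unfolding time_primitive_def
        by (rule Bochner_Integration.integral_cong[OF refl]) (use that \<zeta>0 in \<open>auto simp: f_def indicator_def\<close>)
      have "(LINT \<tau>|lborel. g (\<tau>, x)) = (LINT \<tau>|lborel. f \<tau> * (LINT \<sigma>|lborel. indicator {..<\<tau>} \<sigma> * f \<sigma>))"
        by (rule Bochner_Integration.integral_cong[OF refl]) (auto simp: g_def f_def[of "_::real"] tp indicator_def)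
      also have "\<dots> = (LINT \<tau>|lborel. f \<tau>)\<^sup>2 / 2" by (rule integral_mult_primitive[OF f])
      also have "(LINT \<tau>|lborel. f \<tau>) = time_primitive \<zeta> (t, x)"
        unfolding tp[OF order_refl]
        by (rule Bochner_Integration.integral_cong[OF refl]) (auto simp: f_def indicator_def)
      finally show ?case .
    qed
    have "(\<lambda>x. (t, x)) \<in> borel_measurable (borel :: 'a measure)"
      by (intro borel_measurable_continuous_onI continuous_intros)
    from measurable_compose[OF this tpm]
    have mtp: "(\<lambda>x. (time_primitive \<zeta> (t, x))\<^sup>2 / 2) \<in> borel_measurable lborel" by simp
    note igx = integrable_lborel_pairD(5)[OF ig]
    have itp: "integrable lborel (\<lambda>x. (time_primitive \<zeta> (t, x))\<^sup>2 / 2)"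
      using integrable_cong_AE[OF borel_measurable_integrable[OF igx] mtp aeg] igx by simp
    have "(LINT x|lborel. (time_primitive \<zeta> (t, x))\<^sup>2 / 2) \<le> 0"
      using integral_cong_AE[OF borel_measurable_integrable[OF igx] mtp aeg] le by simp
    moreover have "0 \<le> (LINT x|lborel. (time_primitive \<zeta> (t, x))\<^sup>2 / 2)" by (rule Bochner_Integration.integral_nonneg) simp
    ultimately have "(LINT x|lborel. (time_primitive \<zeta> (t, x))\<^sup>2 / 2) = 0" by linarith
    then have "AE x in lborel. (time_primitive \<zeta> (t, x))\<^sup>2 / 2 = 0"
      using integral_nonneg_eq_0_iff_AE[OF itp] by simp
    then show ?thesis by eventually_elim simp
  qed
  have "AE w in lborel. w \<in> {w. fst w \<in> {0<..T} \<longrightarrow> time_primitive \<zeta> w = 0}"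
  proof (rule AE_lborel_PairI)
    have "fst -` {0<..T} \<in> sets (borel :: (real \<times> 'a) measure)"
      by (rule measurable_sets_borel[of _ borel]) (auto intro!: borel_measurable_continuous_onI continuous_intros)
    moreover have "time_primitive \<zeta> -` {0} \<in> sets borel"
      by (rule measurable_sets_borel[OF tpm]) simp
    ultimately have "- (fst -` {0<..T}) \<union> time_primitive \<zeta> -` {0} \<in> sets borel"
      by (intro sets.Un borel_comp)
    moreover have "- (fst -` {0<..T}) \<union> time_primitive \<zeta> -` {0} = {w. w \<in> {w. fst w \<in> {0<..T} \<longrightarrow> time_primitive \<zeta> w = 0}}" by auto
    ultimately show "{w. w \<in> {w. fst w \<in> {0<..T} \<longrightarrow> time_primitive \<zeta> w = 0}} \<in> sets borel" by simp
    show "AE t in lborel. AE x in lborel. (t, x) \<in> {w. fst w \<in> {0<..T} \<longrightarrow> time_primitive \<zeta> w = 0}"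
    proof (rule AE_I2)
      fix t :: real
      show "AE x in lborel. (t, x) \<in> {w. fst w \<in> {0<..T} \<longrightarrow> time_primitive \<zeta> w = 0}"
        using tp0[of t] by (cases "t \<in> {0<..T}") auto
    qed
  qed
  with ae show ?thesis by eventually_elim auto
qed

section \<open>Letting the shift tend to zero\<close>

text \<open>The quotient test function expanded into the form a - c^q a^(1-q) of the Picone
  inequalities, with a and c the shifted values and q = m + 1.\<close>

definition shifted_test :: "real \<Rightarrow> real \<Rightarrow> real \<Rightarrow> real \<Rightarrow> real" where
  "shifted_test m \<epsilon> a b = (a + \<epsilon>) - (b + \<epsilon>) powr (m + 1) * (a + \<epsilon>) powr - m"

lemma shifted_test_eq:
  assumes "0 < \<epsilon>" "0 \<le> a"
  shows "shifted_test m \<epsilon> a b = ((a + \<epsilon>) powr (m + 1) - (b + \<epsilon>) powr (m + 1)) * (a + \<epsilon>) powr - m"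
proof -
  have "(a + \<epsilon>) powr (m + 1) * (a + \<epsilon>) powr - m = a + \<epsilon>" using assms by (simp flip: powr_add)
  then show ?thesis by (simp add: shifted_test_def left_diff_distrib)
qed

text \<open>The factor \<open>a powr m\<close> absorbs the negative power, because a^m (a +
  \<epsilon>)^(-m) \<le> 1. The bound is free of \<epsilon> and gives majorants for the terms with
  \<open>v\<close> and with \<open>g\<close>.\<close>

lemma powr_mult_shifted_test_bound:
  assumes \<epsilon>: "0 < \<epsilon>" "\<epsilon> < 1" and m: "0 \<le> m" and a: "0 \<le> a" "a \<le> M" and b: "0 \<le> b" "b \<le> M"
  shows "\<bar>a powr m * shifted_test m \<epsilon> a b\<bar> \<le> (M + 1) powr (m + 1)"
proof -
  have "a powr m * (a + \<epsilon>) powr - m \<le> (a + \<epsilon>) powr m * (a + \<epsilon>) powr - m"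
    using assms by (intro mult_right_mono powr_mono2) auto
  moreover have "(a + \<epsilon>) powr m * (a + \<epsilon>) powr - m = 1" using assms by (simp flip: powr_add)
  moreover have "0 \<le> a powr m * (a + \<epsilon>) powr - m" by (intro mult_nonneg_nonneg powr_ge_zero)
  ultimately have 1: "\<bar>a powr m * (a + \<epsilon>) powr - m\<bar> \<le> 1" by linarith
  have "(a + \<epsilon>) powr (m + 1) \<le> (M + 1) powr (m + 1)" "(b + \<epsilon>) powr (m + 1) \<le> (M + 1) powr (m + 1)"
    using assms by (auto intro!: powr_mono2)
  then have 2: "\<bar>(a + \<epsilon>) powr (m + 1) - (b + \<epsilon>) powr (m + 1)\<bar> \<le> (M + 1) powr (m + 1)"
    unfolding abs_le_iff using powr_ge_zero[of "a + \<epsilon>" "m + 1"] powr_ge_zero[of "b + \<epsilon>" "m + 1"] by linarith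
  have "a powr m * shifted_test m \<epsilon> a b = ((a + \<epsilon>) powr (m + 1) - (b + \<epsilon>) powr (m + 1)) * (a powr m * (a + \<epsilon>) powr - m)"
    using shifted_test_eq[OF \<epsilon>(1) a(1)] by (simp only: mult_ac)
  also have "\<bar>\<dots>\<bar> \<le> (M + 1) powr (m + 1) * 1"
    by (subst abs_mult) (rule mult_mono[OF 2 1], auto)
  finally show ?thesis by simp
qed

lemma shifted_test_tendsto:
  assumes e: "e \<longlonglongrightarrow> 0" and ab: "0 < a" "0 < b"
  shows "(\<lambda>n. shifted_test m (e n) a b) \<longlonglongrightarrow> a - b powr (m + 1) * a powr - m"
proof -
  have "(\<lambda>n. shifted_test m (e n) a b) \<longlonglongrightarrow> (a + 0) - (b + 0) powr (m + 1) * (a + 0) powr - m"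
    unfolding shifted_test_def using ab by (intro tendsto_intros e) auto
  then show ?thesis by simp
qed

text \<open>Used with k = m, where the last factor is 1 and a difference of powers remains, and with
  k = \<delta> for the singular term.\<close>

lemma powr_mult_limit:
  fixes a b k m :: real
  assumes "0 < a" shows "a powr k * (a - b powr (m + 1) * a powr - m) = (a powr (m + 1) - b powr (m + 1)) * a powr (k - m)"
proof -
  have "a powr k * a = a powr (m + 1) * a powr (k - m)" "a powr k * a powr - m = a powr (k - m)"
    using assms powr_add[of a 1 k] by (simp_all add: mult.commute add.commute flip: powr_add)
  then show ?thesis by (simp add: right_diff_distrib left_diff_distrib)
qed

text \<open>Only an upper bound is available uniformly in \<epsilon>. If b \<le> a, the second test
  value is nonpositive, and the tangent inequality bounds the first by (m + 1) (a - b), hence by (m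
  + 1) a.\<close>

lemma shifted_test_singular_bound:
  assumes \<epsilon>: "0 < \<epsilon>" and m: "0 \<le> m" and pos: "0 < a" "0 < b" and \<delta>: "0 < \<delta>"
  shows "a powr \<delta> * shifted_test m \<epsilon> a b + b powr \<delta> * shifted_test m \<epsilon> b a
    \<le> (m + 1) * (a powr (\<delta> + 1) + b powr (\<delta> + 1))"
proof -
  have *: "a powr \<delta> * shifted_test m \<epsilon> a b + b powr \<delta> * shifted_test m \<epsilon> b a \<le> (m + 1) * a powr (\<delta> + 1)"
    if "b \<le> a" "0 < b" for a b
  proof -
    let ?A = "a + \<epsilon>" and ?B = "b + \<epsilon>"
    have pos: "0 < ?A" "0 < ?B" "0 < a" using that \<epsilon> by auto
    have "?B powr (m + 1) \<le> ?A powr (m + 1)" using that \<epsilon> m by (intro powr_mono2) auto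
    then have "shifted_test m \<epsilon> b a \<le> 0"
      using that \<epsilon> by (subst shifted_test_eq) (auto intro: mult_nonpos_nonneg)
    then have 1: "b powr \<delta> * shifted_test m \<epsilon> b a \<le> 0" by (simp add: mult_nonneg_nonpos)
    have "(m + 1) * ?A powr m * ?B \<le> m * ?A powr (m + 1) + ?B powr (m + 1)"
      using powr_above_tangent[of "m + 1" ?A ?B] m pos by simp
    moreover have "?A powr (m + 1) = ?A powr m * ?A" using pos powr_add[of ?A m 1] by simp
    ultimately have "?A powr (m + 1) - ?B powr (m + 1) \<le> (m + 1) * ?A powr m * (?A - ?B)"
      by (simp add: algebra_simps)
    then have "(?A powr (m + 1) - ?B powr (m + 1)) * ?A powr - m \<le> (m + 1) * ?A powr m * (?A - ?B) * ?A powr - m"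
      by (rule mult_right_mono) simp
    also have "\<dots> = (m + 1) * (a - b) * (?A powr m * ?A powr - m)" by (simp add: mult_ac)
    also have "?A powr m * ?A powr - m = 1" using pos by (simp flip: powr_add)
    also have "(m + 1) * (a - b) * 1 \<le> (m + 1) * a" using that m by (simp add: mult_left_mono)
    finally have "shifted_test m \<epsilon> a b \<le> (m + 1) * a" using pos \<epsilon> by (simp add: shifted_test_eq)
    then have "a powr \<delta> * shifted_test m \<epsilon> a b \<le> a powr \<delta> * ((m + 1) * a)" by (rule mult_left_mono) simp
    also have "\<dots> = (m + 1) * a powr (\<delta> + 1)" using pos by (simp add: powr_add)
    finally show ?thesis using 1 by linarith
  qed
  have "0 \<le> (m + 1) * a powr (\<delta> + 1)" "0 \<le> (m + 1) * b powr (\<delta> + 1)" using m by auto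
  then show ?thesis using *[of b a] *[of a b] pos by (cases "b \<le> a") (auto simp: distrib_left)
qed

text \<open>The sum equals (a^(m+1) - b^(m+1)) (a^(\<delta>-m) - b^(\<delta>-m)), the product of
  increments of an increasing and of a decreasing power, since \<delta> < m.\<close>

lemma singular_limit_nonpos:
  assumes "0 < a" "0 < b" "0 \<le> m" "\<delta> < m"
  shows "a powr \<delta> * (a - b powr (m + 1) * a powr - m) + b powr \<delta> * (b - a powr (m + 1) * b powr - m) \<le> (0::real)"
proof -
  have "(a powr (m + 1) - b powr (m + 1)) * (a powr (\<delta> - m) - b powr (\<delta> - m)) \<le> 0"
  proof (cases "a \<le> b")
    case True
    then have "a powr (m + 1) \<le> b powr (m + 1)" "b powr (\<delta> - m) \<le> a powr (\<delta> - m)"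
      using assms by (simp_all add: powr_mono2 powr_mono2')
    then show ?thesis by (intro mult_nonpos_nonneg) auto
  next
    case False
    then have "b powr (m + 1) \<le> a powr (m + 1)" "a powr (\<delta> - m) \<le> b powr (\<delta> - m)"
      using assms by (simp_all add: powr_mono2 powr_mono2')
    then show ?thesis by (intro mult_nonneg_nonpos) auto
  qed
  then show ?thesis unfolding powr_mult_limit[OF assms(1)] powr_mult_limit[OF assms(2)] by (simp add: algebra_simps)
qed

lemma integral_dominated_mult_AE:
  fixes z :: "'b \<Rightarrow> real"
  assumes z: "integrable M z" and f: "\<And>n. f n \<in> borel_measurable M" "g \<in> borel_measurable M"
    and lim: "AE w in M. (\<lambda>n. f n w) \<longlonglongrightarrow> g w" and bound: "AE w in M. \<forall>n. \<bar>f n w\<bar> \<le> C"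
  shows "(\<lambda>n. LINT w|M. z w * f n w) \<longlonglongrightarrow> (LINT w|M. z w * g w)"
    and "integrable M (\<lambda>w. z w * f n w)"
proof -
  have i: "integrable M (\<lambda>w. C * \<bar>z w\<bar>)" using z by simp
  have b: "AE w in M. norm (z w * f n w) \<le> C * \<bar>z w\<bar>" for n
    using bound
  proof eventually_elim
    case (elim w)
    then show ?case using mult_right_mono[of "\<bar>f n w\<bar>" C "\<bar>z w\<bar>"] by (simp add: abs_mult mult.commute[of "\<bar>z w\<bar>"])
  qed
  have zm: "z \<in> borel_measurable M" using z by auto
  note m = borel_measurable_times[OF zm f(1)] borel_measurable_times[OF zm f(2)]
  have l: "AE w in M. (\<lambda>n. z w * f n w) \<longlonglongrightarrow> z w * g w"
    using lim by eventually_elim (intro tendsto_mult tendsto_const)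
  show "(\<lambda>n. LINT w|M. z w * f n w) \<longlonglongrightarrow> (LINT w|M. z w * g w)"
    by (rule integral_dominated_convergence[OF m(2) m(1) i l b])
  show "integrable M (\<lambda>w. z w * f n w)"
    by (rule Bochner_Integration.integrable_bound[OF i m(1)]) (use b[of n] in \<open>eventually_elim, simp\<close>)
qed

text \<open>The singular term has no sign for \<open>\<epsilon> > 0\<close>; its positive part is dominated by the
  integrable function \<open>(m + 1) \<kappa> (u\<^sup>\<delta>\<^sup>+\<^sup>1 + w\<^sup>\<delta>\<^sup>+\<^sup>1)\<close> and tends to zero pointwise.\<close>

lemma shifted_inequality_limit:
  fixes M :: "'b measure" and u w v v' g \<kappa> :: "'b \<Rightarrow> real"
  assumes meas: "u \<in> borel_measurable M" "w \<in> borel_measurable M" "\<kappa> \<in> borel_measurable M"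
    and v: "integrable M v" "integrable M v'" and g: "integrable M g"
    and uw: "AE x in M. 0 < u x \<and> u x \<le> C \<and> 0 < w x \<and> w x \<le> C"
    and m: "0 \<le> m" and \<kappa>: "\<And>x. 0 \<le> \<kappa> x" "\<And>x. \<kappa> x \<noteq> 0 \<Longrightarrow> 0 < \<delta> \<and> \<delta> < m"
    and i\<kappa>: "integrable M (\<lambda>x. \<kappa> x * u x powr (\<delta> + 1))" "integrable M (\<lambda>x. \<kappa> x * w x powr (\<delta> + 1))"
    and iR: "\<And>\<epsilon>. 0 < \<epsilon> \<Longrightarrow> \<epsilon> < 1 \<Longrightarrow> integrable M (\<lambda>x. (g x * u x powr m + \<kappa> x * u x powr \<delta>) * shifted_test m \<epsilon> (u x) (w x)
        + (g x * w x powr m + \<kappa> x * w x powr \<delta>) * shifted_test m \<epsilon> (w x) (u x))"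
    and ineq: "\<And>\<epsilon>. 0 < \<epsilon> \<Longrightarrow> \<epsilon> < 1 \<Longrightarrow>
      (LINT x|M. u x powr m * v x * shifted_test m \<epsilon> (u x) (w x) + w x powr m * v' x * shifted_test m \<epsilon> (w x) (u x))
      \<le> (LINT x|M. (g x * u x powr m + \<kappa> x * u x powr \<delta>) * shifted_test m \<epsilon> (u x) (w x)
        + (g x * w x powr m + \<kappa> x * w x powr \<delta>) * shifted_test m \<epsilon> (w x) (u x))"
  shows "(LINT x|M. (v x - v' x) * (u x powr (m + 1) - w x powr (m + 1))) \<le> 0"
    and "integrable M (\<lambda>x. (v x - v' x) * (u x powr (m + 1) - w x powr (m + 1)))"
proof -
  \<comment> \<open>The shift 1/(n + 2) is strictly below 1 also for n = 0.\<close>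
  define e where "e n = inverse (real (Suc (Suc n)))" for n
  have e: "0 < e n" "e n < 1" for n by (auto simp: e_def inverse_less_1_iff)
  have elim: "e \<longlonglongrightarrow> 0" unfolding e_def[abs_def] by (rule LIMSEQ_Suc[OF LIMSEQ_inverse_real_of_nat])
  define \<alpha> where "\<alpha> n x = u x powr m * shifted_test m (e n) (u x) (w x)" for n x
  define \<alpha>' where "\<alpha>' n x = w x powr m * shifted_test m (e n) (w x) (u x)" for n x
  define \<beta> where "\<beta> n x = u x powr \<delta> * shifted_test m (e n) (u x) (w x) + w x powr \<delta> * shifted_test m (e n) (w x) (u x)" for n x
  define z where "z x = u x powr (m + 1) - w x powr (m + 1)" for x
  have mst: "(\<lambda>x. shifted_test m \<epsilon> (u x) (w x)) \<in> borel_measurable M" "(\<lambda>x. shifted_test m \<epsilon> (w x) (u x)) \<in> borel_measurable M" for \<epsilon>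
    using meas unfolding shifted_test_def by measurable
  have m\<alpha>: "\<alpha> n \<in> borel_measurable M" "\<alpha>' n \<in> borel_measurable M" "\<beta> n \<in> borel_measurable M" "z \<in> borel_measurable M" for n
    using mst meas unfolding \<alpha>_def[abs_def] \<alpha>'_def[abs_def] \<beta>_def[abs_def] z_def[abs_def] by measurable
  have b\<alpha>: "AE x in M. \<forall>n. \<bar>\<alpha> n x\<bar> \<le> (C + 1) powr (m + 1)" "AE x in M. \<forall>n. \<bar>\<alpha>' n x\<bar> \<le> (C + 1) powr (m + 1)"
    using uw by (eventually_elim, auto simp: \<alpha>_def \<alpha>'_def intro!: powr_mult_shifted_test_bound e m)+
  have l\<alpha>: "AE x in M. (\<lambda>n. \<alpha> n x) \<longlonglongrightarrow> z x"
    using uw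
  proof eventually_elim
    case (elim x)
    have "(\<lambda>n. \<alpha> n x) \<longlonglongrightarrow> u x powr m * (u x - w x powr (m + 1) * u x powr - m)"
      unfolding \<alpha>_def using elim by (intro tendsto_mult tendsto_const shifted_test_tendsto \<open>e \<longlonglongrightarrow> 0\<close>) auto
    then show ?case using elim by (simp add: powr_mult_limit z_def)
  qed
  have l\<alpha>': "AE x in M. (\<lambda>n. \<alpha>' n x) \<longlonglongrightarrow> - z x"
    using uw
  proof eventually_elim
    case (elim x)
    have "(\<lambda>n. \<alpha>' n x) \<longlonglongrightarrow> w x powr m * (w x - u x powr (m + 1) * w x powr - m)"
      unfolding \<alpha>'_def using elim by (intro tendsto_mult tendsto_const shifted_test_tendsto \<open>e \<longlonglongrightarrow> 0\<close>) auto
    then show ?case using elim by (simp add: powr_mult_limit z_def)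
  qed
  note v1 = integral_dominated_mult_AE[OF v(1) m\<alpha>(1,4) l\<alpha> b\<alpha>(1)]
  note v2 = integral_dominated_mult_AE[OF v(2) m\<alpha>(2) borel_measurable_uminus[OF m\<alpha>(4)] l\<alpha>' b\<alpha>(2)]
  note g1 = integral_dominated_mult_AE[OF g m\<alpha>(1,4) l\<alpha> b\<alpha>(1)]
  note g2 = integral_dominated_mult_AE[OF g m\<alpha>(2) borel_measurable_uminus[OF m\<alpha>(4)] l\<alpha>' b\<alpha>(2)]
  have zb: "AE x in M. \<forall>n::nat. \<bar>z x\<bar> \<le> (C + 1) powr (m + 1)"
    using l\<alpha> b\<alpha>(1)
  proof eventually_elim
    case (elim x)
    then show ?case using LIMSEQ_le_const2[OF tendsto_rabs[OF elim(1)]] by blast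
  qed
  have iz: "integrable M (\<lambda>x. v x * z x)" "integrable M (\<lambda>x. v' x * z x)"
    by (rule integral_dominated_mult_AE(2)[where f = "\<lambda>n. z" and g = z, OF v(1) m\<alpha>(4,4) _ zb], simp)
      (rule integral_dominated_mult_AE(2)[where f = "\<lambda>n. z" and g = z, OF v(2) m\<alpha>(4,4) _ zb], simp)
  show "integrable M (\<lambda>x. (v x - v' x) * (u x powr (m + 1) - w x powr (m + 1)))"
    using Bochner_Integration.integrable_diff[OF iz] by (simp add: z_def left_diff_distrib)
  define S where "S n x = max 0 (\<kappa> x * \<beta> n x)" for n x
  have mS: "S n \<in> borel_measurable M" for n
    unfolding S_def[abs_def] by (intro borel_measurable_max borel_measurable_const borel_measurable_times meas m\<alpha>)
  define B where "B x = (m + 1) * (\<kappa> x * u x powr (\<delta> + 1) + \<kappa> x * w x powr (\<delta> + 1))" for x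
  have iB: "integrable M B" unfolding B_def[abs_def] using i\<kappa> by simp
  have bS: "AE x in M. norm (S n x) \<le> B x" for n
    using uw
  proof eventually_elim
    case (elim x)
    have B0: "0 \<le> B x" unfolding B_def using m \<kappa>(1)[of x] by simp
    show ?case
    proof (cases "\<kappa> x = 0")
      case False
      have "\<kappa> x * \<beta> n x \<le> \<kappa> x * ((m + 1) * (u x powr (\<delta> + 1) + w x powr (\<delta> + 1)))"
        unfolding \<beta>_def using elim \<kappa>(2)[OF False]
        by (intro mult_left_mono shifted_test_singular_bound e m \<kappa>) auto
      also have "\<dots> = B x" by (simp add: B_def algebra_simps)
      finally show ?thesis using B0 by (simp add: S_def)
    qed (use B0 in \<open>simp add: S_def\<close>)
  qed
  have lS: "AE x in M. (\<lambda>n. S n x) \<longlonglongrightarrow> 0"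
    using uw
  proof eventually_elim
    case (elim x)
    show ?case
    proof (cases "\<kappa> x = 0")
      case False
      define l where "l = u x powr \<delta> * (u x - w x powr (m + 1) * u x powr - m) + w x powr \<delta> * (w x - u x powr (m + 1) * w x powr - m)"
      have "(\<lambda>n. \<beta> n x) \<longlonglongrightarrow> l"
        unfolding \<beta>_def l_def using elim by (intro tendsto_add tendsto_mult tendsto_const shifted_test_tendsto \<open>e \<longlonglongrightarrow> 0\<close>) auto
      then have "(\<lambda>n. S n x) \<longlonglongrightarrow> max 0 (\<kappa> x * l)"
        unfolding S_def by (intro tendsto_max tendsto_mult tendsto_const)
      moreover have "\<kappa> x * l \<le> 0"
        unfolding l_def using elim \<kappa>(1)[of x] \<kappa>(2)[OF False] m by (intro mult_nonneg_nonpos singular_limit_nonpos) auto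
      ultimately show ?thesis by (simp add: max_absorb1)
    qed (simp add: S_def)
  qed
  have S0: "(\<lambda>n. LINT x|M. S n x) \<longlonglongrightarrow> (LINT x|M. 0)"
    by (rule integral_dominated_convergence[OF _ mS iB lS bS]) simp
  have iS: "integrable M (S n)" for n
    by (rule Bochner_Integration.integrable_bound[OF iB mS]) (use bS[of n] in \<open>eventually_elim, simp\<close>)
  have main: "(LINT x|M. v x * \<alpha> n x) + (LINT x|M. v' x * \<alpha>' n x) \<le> ((LINT x|M. g x * \<alpha> n x) + (LINT x|M. g x * \<alpha>' n x)) + (LINT x|M. S n x)" for n
  proof -
    have "(LINT x|M. v x * \<alpha> n x) + (LINT x|M. v' x * \<alpha>' n x) = (LINT x|M. v x * \<alpha> n x + v' x * \<alpha>' n x)"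
      using v1(2)[of n] v2(2)[of n] by simp
    also have "\<dots> = (LINT x|M. u x powr m * v x * shifted_test m (e n) (u x) (w x) + w x powr m * v' x * shifted_test m (e n) (w x) (u x))"
      by (simp only: \<alpha>_def \<alpha>'_def mult_ac)
    also have "\<dots> \<le> (LINT x|M. (g x * u x powr m + \<kappa> x * u x powr \<delta>) * shifted_test m (e n) (u x) (w x)
        + (g x * w x powr m + \<kappa> x * w x powr \<delta>) * shifted_test m (e n) (w x) (u x))"
      by (rule ineq[OF e])
    also have "\<dots> \<le> (LINT x|M. (g x * \<alpha> n x + g x * \<alpha>' n x) + S n x)"
    proof (rule integral_mono[OF iR[OF e]])
      show "integrable M (\<lambda>x. (g x * \<alpha> n x + g x * \<alpha>' n x) + S n x)"
        using g1(2)[of n] g2(2)[of n] iS[of n] by simp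
      fix x
      have "(g x * u x powr m + \<kappa> x * u x powr \<delta>) * shifted_test m (e n) (u x) (w x)
        + (g x * w x powr m + \<kappa> x * w x powr \<delta>) * shifted_test m (e n) (w x) (u x) = (g x * \<alpha> n x + g x * \<alpha>' n x) + \<kappa> x * \<beta> n x"
        by (simp add: \<alpha>_def \<alpha>'_def \<beta>_def algebra_simps)
      also have "\<dots> \<le> (g x * \<alpha> n x + g x * \<alpha>' n x) + S n x" by (simp add: S_def)
      finally show "(g x * u x powr m + \<kappa> x * u x powr \<delta>) * shifted_test m (e n) (u x) (w x)
        + (g x * w x powr m + \<kappa> x * w x powr \<delta>) * shifted_test m (e n) (w x) (u x) \<le> (g x * \<alpha> n x + g x * \<alpha>' n x) + S n x" .
    qed
    also have "\<dots> = ((LINT x|M. g x * \<alpha> n x) + (LINT x|M. g x * \<alpha>' n x)) + (LINT x|M. S n x)"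
      using g1(2)[of n] g2(2)[of n] iS[of n] by simp
    finally show ?thesis .
  qed
  \<comment> \<open>The two terms with \<open>g\<close> tend to opposite limits; only here do they
    cancel.\<close>
  have "(LINT x|M. v x * z x) + (LINT x|M. v' x * - z x) \<le> ((LINT x|M. g x * z x) + (LINT x|M. g x * - z x)) + (LINT x|M. 0)"
    by (rule LIMSEQ_le[OF tendsto_add[OF v1(1) v2(1)] tendsto_add[OF tendsto_add[OF g1(1) g2(1)] S0]]) (use main in blast)
  then have "(LINT x|M. v x * z x) - (LINT x|M. v' x * z x) \<le> 0" by simp
  then show "(LINT x|M. (v x - v' x) * (u x powr (m + 1) - w x powr (m + 1))) \<le> 0"
    using iz by (simp add: z_def[symmetric] left_diff_distrib)
qed

section \<open>Uniqueness from the energy inequality\<close>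

text \<open>Mediates between the completed measure on the cylinder and \<open>lborel\<close>: the
  data are replaced by Borel versions that vanish outside the cylinder, for which slices and
  primitives are measurable. Smallness at almost every early time is integrated over (\<rho>, 2
  \<rho>), an interval of length \<rho>.\<close>

lemma energy_uniqueness:
  fixes z \<zeta> :: "real \<times> 'a::euclidean_space \<Rightarrow> real" and \<Omega> :: "'a set"
  defines "Q \<equiv> \<lambda>t. {0<..<t::real} \<times> \<Omega>"
  assumes \<Omega>: "open \<Omega>"
    and iz: "integrable (lebesgue_on (Q T)) z" and i\<zeta>: "integrable (lebesgue_on (Q T)) \<zeta>"
    and weak: "is_weak_time_derivative (Q T) z \<zeta>"
    and int: "integrable (lebesgue_on (Q T)) (\<lambda>w. \<zeta> w * z w)"
    and neg: "\<And>t. 0 < t \<Longrightarrow> t \<le> T \<Longrightarrow> (LINT w|lebesgue_on (Q t). \<zeta> w * z w) \<le> 0"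
    and init: "\<And>e. 0 < e \<Longrightarrow> \<exists>r>0. AE t in lebesgue. 0 < t \<and> t < r \<longrightarrow> (LINT x|lebesgue_on \<Omega>. \<bar>z (t, x)\<bar>) \<le> e"
    and T: "0 < T"
  shows "AE w in lebesgue. w \<in> Q T \<longrightarrow> z w = 0"
proof -
  have openQ: "open (Q t)" for t unfolding Q_def by (intro open_Times \<Omega> open_greaterThanLessThan)
  have QL: "Q t \<in> sets lebesgue" for t using openQ[of t] by (intro sets_completionI_sets) simp
  have restrict: "integrable (lebesgue_on (Q t)) f \<longleftrightarrow> integrable lebesgue (\<lambda>w. indicator (Q t) w * f w)"
      "(LINT w|lebesgue_on (Q t). f w) = (LINT w|lebesgue. indicator (Q t) w * f w)" for f :: "real \<times> 'a \<Rightarrow> real" and t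
    using integrable_restrict_space[of "Q t" lebesgue f] integral_restrict_space[of "Q t" lebesgue f] QL[of t] by auto
  have borel: "\<exists>f'. f' \<in> borel_measurable lborel \<and> (\<forall>w. w \<notin> Q T \<longrightarrow> f' w = 0) \<and> (AE w in lebesgue. f' w = indicator (Q T) w * f w)"
    if f: "integrable (lebesgue_on (Q T)) f" for f :: "real \<times> 'a \<Rightarrow> real"
  proof -
    obtain f' where f': "f' \<in> borel_measurable borel" "AE w in lebesgue. f' w = indicator (Q T) w * f w"
      by (rule borel_version[OF borel_measurable_integrable[OF f] QL])
    show ?thesis
    proof (intro exI[of _ "\<lambda>w. indicator (Q T) w * f' w"] conjI)
      show "(\<lambda>w. indicator (Q T) w * f' w) \<in> borel_measurable lborel" using f'(1) openQ by simp
      show "AE w in lebesgue. indicator (Q T) w * f' w = indicator (Q T) w * f w"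
        using f'(2) by eventually_elim (simp add: indicator_def)
    qed auto
  qed
  obtain z' where z': "z' \<in> borel_measurable lborel" "\<And>w. w \<notin> Q T \<Longrightarrow> z' w = 0" "AE w in lebesgue. z' w = indicator (Q T) w * z w"
    using borel[OF iz] by blast
  obtain \<zeta>' where \<zeta>': "\<zeta>' \<in> borel_measurable lborel" "\<And>w. w \<notin> Q T \<Longrightarrow> \<zeta>' w = 0" "AE w in lebesgue. \<zeta>' w = indicator (Q T) w * \<zeta> w"
    using borel[OF i\<zeta>] by blast
  have conv: "integrable lborel F" "(LINT w|lborel. F w) = (LINT w|lebesgue. f w)"
    if F: "F \<in> borel_measurable lborel" and f: "integrable lebesgue f" and ae: "AE w in lebesgue. F w = f w"
    for F f :: "real \<times> 'a \<Rightarrow> real"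
  proof -
    note FL = measurable_completion[OF F]
    have "integrable lebesgue F" using integrable_cong_AE[OF FL borel_measurable_integrable[OF f] ae] f by simp
    then show "integrable lborel F" using integrable_completion[OF F] by simp
    have "(LINT w|lebesgue. F w) = (LINT w|lebesgue. f w)" by (rule integral_cong_AE[OF FL borel_measurable_integrable[OF f] ae])
    then show "(LINT w|lborel. F w) = (LINT w|lebesgue. f w)" using integral_completion[OF F] by simp
  qed
  note iz' = conv[OF z'(1) iz[unfolded restrict] z'(3)] and i\<zeta>' = conv[OF \<zeta>'(1) i\<zeta>[unfolded restrict] \<zeta>'(3)]
  have mult: "(LINT w|lborel. F w * h w) = (LINT w:Q T|lebesgue. f w * h w)"
    if F: "F \<in> borel_measurable lborel" and f: "integrable (lebesgue_on (Q T)) f" and ae: "AE w in lebesgue. F w = indicator (Q T) w * f w"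
      and h: "h \<in> borel_measurable borel" for F f h :: "real \<times> 'a \<Rightarrow> real"
  proof -
    have hl: "h \<in> borel_measurable lborel" using h by simp
    have fl: "(\<lambda>w. indicator (Q T) w * f w) \<in> borel_measurable lebesgue"
      using f[unfolded restrict] by (rule borel_measurable_integrable)
    have "(LINT w|lborel. F w * h w) = (LINT w|lebesgue. F w * h w)"
      by (rule integral_completion[symmetric]) (intro borel_measurable_times F hl)
    also have "\<dots> = (LINT w|lebesgue. (indicator (Q T) w * f w) * h w)"
      by (rule integral_cong_AE[OF borel_measurable_times[OF measurable_completion[OF F] measurable_completion[OF hl]]
          borel_measurable_times[OF fl measurable_completion[OF hl]]]) (use ae in \<open>eventually_elim, simp\<close>)
    finally show ?thesis by (simp add: set_lebesgue_integral_def mult.assoc)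
  qed
  have weak': "(LINT w|lborel. z' w * time_deriv \<psi> w) = - (LINT w|lborel. \<zeta>' w * \<psi> w)"
    if \<psi>: "\<psi> \<in> test_functions ({0<..<T} \<times> \<Omega>)" for \<psi>
  proof -
    note s = test_functionsD(1)[OF \<psi>]
    have "(1, 0) \<in> (Basis :: (real \<times> 'a) set)" by (simp add: Basis_prod_def)
    then have "smooth_on UNIV (time_deriv \<psi>)"
      unfolding time_deriv_def[abs_def] by (rule smooth_on_frechet_derivative[OF s])
    then have td: "time_deriv \<psi> \<in> borel_measurable borel"
      by (intro borel_measurable_continuous_onI smooth_on_continuous)
    have \<psi>m: "\<psi> \<in> borel_measurable borel"
      by (intro borel_measurable_continuous_onI smooth_on_continuous s)
    show ?thesis
      using weak \<psi> unfolding mult[OF z'(1) iz z'(3) td] mult[OF \<zeta>'(1) i\<zeta> \<zeta>'(3) \<psi>m] is_weak_time_derivative_def Q_def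
      by blast
  qed
  have init': "\<exists>r>0. \<forall>\<rho>. 0 < \<rho> \<and> \<rho> < r \<longrightarrow> (LINT w|lborel. \<bar>z' w\<bar> * indicator ({\<rho><..<2 * \<rho>} \<times> \<Omega>) w) \<le> e * \<rho>"
    if e: "0 < e" for e
  proof -
    obtain r where r: "0 < r" "AE t in lebesgue. 0 < t \<and> t < r \<longrightarrow> (LINT x|lebesgue_on \<Omega>. \<bar>z (t, x)\<bar>) \<le> e"
      using init[OF e] by blast
    have aez: "AE t in lebesgue. AE x in lebesgue. z' (t, x) = indicator (Q T) (t, x) * z (t, x)"
      by (rule AE_lebesgue_Pair[OF z'(3)])
    \<comment> \<open>With \<rho> below min r T / 2 the whole interval (\<rho>, 2 \<rho>) lies
      before both r and T.\<close>
    have "(LINT w|lborel. \<bar>z' w\<bar> * indicator ({\<rho><..<2 * \<rho>} \<times> \<Omega>) w) \<le> e * \<rho>" if \<rho>: "0 < \<rho>" "\<rho> < min r T / 2" for \<rho>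
    proof -
      have mi: "indicat_real ({\<rho><..<2 * \<rho>} \<times> \<Omega>) \<in> borel_measurable lborel" using \<Omega> by (simp add: open_Times)
      have i: "integrable lborel (\<lambda>w. \<bar>z' w\<bar> * indicator ({\<rho><..<2 * \<rho>} \<times> \<Omega>) w)"
        by (rule integrable_mult_bounded[OF integrable_abs[OF iz'(1)] mi, where C = 1]) (simp add: indicator_def)
      have "(LINT w|lborel. \<bar>z' w\<bar> * indicator ({\<rho><..<2 * \<rho>} \<times> \<Omega>) w) = (LINT t|lborel. LINT x|lborel. \<bar>z' (t, x)\<bar> * indicator ({\<rho><..<2 * \<rho>} \<times> \<Omega>) (t, x))"
        by (rule integrable_lborel_pairD(3)[OF i, symmetric])
      also have "\<dots> \<le> (LINT t|lborel. e * indicator {\<rho><..<2 * \<rho>} t)"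
      proof (rule integral_mono_AE[OF integrable_lborel_pairD(2)[OF i]])
        show "integrable lborel (\<lambda>t. e * indicat_real {\<rho><..<2 * \<rho>} t)"
          by (intro integrable_mult_right integrable_indicator_Ioo)
        have "AE t in lborel. 0 < t \<and> t < r \<longrightarrow> (LINT x|lebesgue_on \<Omega>. \<bar>z (t, x)\<bar>) \<le> e"
          "AE t in lborel. AE x in lebesgue. z' (t, x) = indicator (Q T) (t, x) * z (t, x)"
          using r(2) aez by (simp_all add: AE_completion_iff)
        then show "AE t in lborel. (LINT x|lborel. \<bar>z' (t, x)\<bar> * indicator ({\<rho><..<2 * \<rho>} \<times> \<Omega>) (t, x)) \<le> e * indicator {\<rho><..<2 * \<rho>} t"
        proof eventually_elim
          case (elim t)
          show ?case
          proof (cases "t \<in> {\<rho><..<2 * \<rho>}")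
            case True
            have "(\<lambda>x. (t, x)) \<in> borel_measurable (borel :: 'a measure)"
              by (intro borel_measurable_continuous_onI continuous_intros)
            from measurable_compose[OF this, of z' borel] z'(1) have zt: "(\<lambda>x. z' (t, x)) \<in> borel_measurable lborel" by simp
            have zi: "(\<lambda>x. \<bar>z' (t, x)\<bar> * indicator \<Omega> x) \<in> borel_measurable lborel"
              by (intro borel_measurable_times borel_measurable_abs zt) (use \<Omega> in auto)
            have "(LINT x|lborel. \<bar>z' (t, x)\<bar> * indicator ({\<rho><..<2 * \<rho>} \<times> \<Omega>) (t, x)) = (LINT x|lborel. \<bar>z' (t, x)\<bar> * indicator \<Omega> x)"
              by (rule Bochner_Integration.integral_cong[OF refl]) (use True in \<open>simp add: indicator_def\<close>)
            also have "\<dots> = (LINT x|lebesgue. \<bar>z' (t, x)\<bar> * indicator \<Omega> x)" by (rule integral_completion[OF zi, symmetric])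
            also have "\<dots> = (LINT x|lebesgue. indicator \<Omega> x * \<bar>z (t, x)\<bar>)"
            proof -
              have ae: "AE x in lebesgue. \<bar>z' (t, x)\<bar> * indicator \<Omega> x = indicator \<Omega> x * \<bar>z (t, x)\<bar>"
                using elim(2) by eventually_elim (use True \<rho> in \<open>auto simp: indicator_def Q_def\<close>)
              have "(\<lambda>x. indicator \<Omega> x * \<bar>z (t, x)\<bar>) \<in> borel_measurable lebesgue"
              proof (rule borel_measurable_completion_AE[OF measurable_completion[OF zi]])
                show "AE x in lborel. indicator \<Omega> x * \<bar>z (t, x)\<bar> = \<bar>z' (t, x)\<bar> * indicator \<Omega> x"
                  using ae unfolding AE_completion_iff by eventually_elim (rule sym)
              qed
              from integral_cong_AE[OF measurable_completion[OF zi] this ae] show ?thesis .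
            qed
            also have "\<dots> = (LINT x|lebesgue_on \<Omega>. \<bar>z (t, x)\<bar>)"
              using integral_restrict_space[of \<Omega> lebesgue "\<lambda>x. \<bar>z (t, x)\<bar>"] \<Omega> by simp
            also have "\<dots> \<le> e" using elim(1) True \<rho> by auto
            finally show ?thesis using True by simp
          next
            case False
            then have "(\<lambda>x. \<bar>z' (t, x)\<bar> * indicator ({\<rho><..<2 * \<rho>} \<times> \<Omega>) (t, x)) = (\<lambda>x. 0)" by (auto simp: indicator_def)
            then show ?thesis using False by simp
          qed
        qed
      qed
      also have "\<dots> = e * \<rho>" using \<rho> by simp
      finally show ?thesis .
    qed
    then show ?thesis using r(1) T by (intro exI[of _ "min r T / 2"]) auto
  qed
  have ae_prim: "AE w in lborel. w \<in> {0<..<T} \<times> \<Omega> \<longrightarrow> z' w = time_primitive \<zeta>' w"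
    by (rule weak_time_derivative_primitive[OF iz'(1) i\<zeta>'(1) weak' init' \<Omega>]) (auto intro!: \<zeta>'(2) simp: Q_def)
  have aem: "AE w in lebesgue. \<zeta>' w * z' w = indicator (Q T) w * (\<zeta> w * z w)"
    using z'(3) \<zeta>'(3) by eventually_elim (simp add: indicator_def)
  note int' = conv[OF borel_measurable_times[OF \<zeta>'(1) z'(1)] int[unfolded restrict] aem]
  have neg': "(LINT w|lborel. indicator {0<..<t} (fst w) * (\<zeta>' w * z' w)) \<le> 0" if t: "0 < t" "t \<le> T" for t
  proof -
    have F: "(\<lambda>w. indicator {0<..<t} (fst w) * (\<zeta>' w * z' w)) \<in> borel_measurable lborel"
      by (intro borel_measurable_times \<zeta>' z' borel_measurable_fst_comp) auto
    have sub: "Q t \<subseteq> Q T" using t by (auto simp: Q_def)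
    have f: "integrable lebesgue (\<lambda>w. indicator (Q t) w * (\<zeta> w * z w))"
    proof -
      have "integrable lebesgue (\<lambda>w. (indicator (Q T) w * (\<zeta> w * z w)) * indicator (Q t) w)"
        by (rule integrable_mult_bounded[OF int[unfolded restrict], where C = 1]) (use QL[of t] in auto)
      moreover have "(\<lambda>w. (indicator (Q T) w * (\<zeta> w * z w)) * indicator (Q t) w) = (\<lambda>w. indicator (Q t) w * (\<zeta> w * z w))"
        using sub by (intro ext) (auto simp: indicator_def)
      ultimately show ?thesis by simp
    qed
    have "AE w in lebesgue. indicator {0<..<t} (fst w) * (\<zeta>' w * z' w) = indicator (Q t) w * (\<zeta> w * z w)"
      using aem by eventually_elim (use t in \<open>auto simp: indicator_def Q_def\<close>)
    from conv(2)[OF F f this] show ?thesis using neg[OF t] by (simp add: restrict)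
  qed
  have "AE w in lborel. w \<in> {0<..<T} \<times> \<Omega> \<longrightarrow> z' w = 0"
    by (rule primitive_energy_zero[OF i\<zeta>'(1) _ ae_prim int'(1) neg']) (auto intro!: \<zeta>'(2) simp: Q_def)
  then have "AE w in lebesgue. w \<in> Q T \<longrightarrow> z' w = 0" unfolding Q_def by (rule AE_completion)
  with z'(3) show ?thesis by eventually_elim auto
qed

section \<open>Weak solutions\<close>

lemma borel_measurable_restrict_mono:
  "f \<in> borel_measurable (lebesgue_on S) \<Longrightarrow> B \<subseteq> S \<Longrightarrow> f \<in> borel_measurable (lebesgue_on B)"
  by (rule measurable_restrict_mono)

lemma integrable_lebesgue_on_iff:
  fixes f :: "'a::euclidean_space \<Rightarrow> 'b::euclidean_space"
  assumes "S \<in> sets lebesgue"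
  shows "set_integrable lebesgue S f \<longleftrightarrow> integrable (lebesgue_on S) f"
    and "(LINT x:S|lebesgue. f x) = (LINT x|lebesgue_on S. f x)"
  using integrable_restrict_space[of S lebesgue f] integral_restrict_space[of S lebesgue f] assms
  by (auto simp: set_integrable_def set_lebesgue_integral_def)

lemma integrable_lebesgue_on_subset:
  fixes f :: "'a::euclidean_space \<Rightarrow> 'b::euclidean_space"
  assumes "integrable (lebesgue_on S) f" "S \<in> sets lebesgue" "B \<in> sets lebesgue" "B \<subseteq> S"
  shows "integrable (lebesgue_on B) f"
  using set_integrable_subset[of lebesgue S f B] assms by (simp add: integrable_lebesgue_on_iff)

lemma open_sets_lebesgue: "open S \<Longrightarrow> S \<in> sets lebesgue"
  by (rule sets_completionI_sets) simp

lemma AE_lebesgue_on_iff: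
  "S \<in> sets lebesgue \<Longrightarrow> (AE x in lebesgue_on S. P x) \<longleftrightarrow> (AE x in lebesgue. x \<in> S \<longrightarrow> P x)"
  by (rule AE_restrict_space_iff) simp

lemma Lp_space_2_integrable:
  fixes f :: "'a::euclidean_space \<Rightarrow> real"
  assumes f: "f \<in> Lp_space 2 S" and S: "S \<in> lmeasurable"
  shows "integrable (lebesgue_on S) f" "integrable (lebesgue_on S) (\<lambda>x. (f x)\<^sup>2)"
proof -
  interpret finite_measure "lebesgue_on S" by (rule finite_measure_lebesgue_on[OF S])
  have "norm (f x) powr 2 = (f x)\<^sup>2" for x by (cases "f x = 0") (auto simp: powr_numeral)
  then show 2: "integrable (lebesgue_on S) (\<lambda>x. (f x)\<^sup>2)" using f by (simp add: Lp_space_def)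
  have i: "integrable (lebesgue_on S) (\<lambda>x. 1 + (f x)\<^sup>2)" using 2 by simp
  have le: "\<bar>a\<bar> \<le> 1 + a\<^sup>2" for a :: real
    using sum_power2_ge_zero[of "\<bar>a\<bar> - 1" 0] by (simp add: power2_eq_square algebra_simps)
  show "integrable (lebesgue_on S) f"
    by (rule Bochner_Integration.integrable_bound[OF i]) (use f le in \<open>auto simp: Lp_space_def\<close>)
qed

lemma bounded_integrable_lebesgue_on:
  fixes f :: "'a::euclidean_space \<Rightarrow> real"
  assumes f: "f \<in> borel_measurable (lebesgue_on S)" and S: "S \<in> lmeasurable" and b: "AE x in lebesgue_on S. \<bar>f x\<bar> \<le> C"
  shows "integrable (lebesgue_on S) f"
proof -
  interpret finite_measure "lebesgue_on S" by (rule finite_measure_lebesgue_on[OF S])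
  show ?thesis by (rule integrable_const_bound[where B = C]) (use f b in auto)
qed

text \<open>The powers of both solutions have L^2-continuous representatives with the same value at
  time 0, so their difference is small in L^2 at early times. On a set of finite measure, |a| \<le>
  k + a^2/k converts this into smallness in L^1. Since representatives agree with the solutions only
  at almost every time, so does the conclusion.\<close>

lemma has_initial_value_difference:
  assumes u: "has_initial_value \<Omega> T m u u0" and w: "has_initial_value \<Omega> T m w u0"
    and T: "0 < T" and \<Omega>: "\<Omega> \<in> lmeasurable" and e: "0 < e"
  shows "\<exists>r>0. AE t in lebesgue. 0 < t \<and> t < r \<longrightarrow>
    (LINT x|lebesgue_on \<Omega>. \<bar>u t x powr (m + 1) - w t x powr (m + 1)\<bar>) \<le> e"
proof -
  interpret finite_measure "lebesgue_on \<Omega>" by (rule finite_measure_lebesgue_on[OF \<Omega>])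
  have \<Omega>s: "\<Omega> \<in> sets lebesgue" using \<Omega> by blast
  define \<mu> where "\<mu> = measure (lebesgue_on \<Omega>) (space (lebesgue_on \<Omega>))"
  \<comment> \<open>Chosen so that the constant part 2 k \<mu> is at most e/2. The two integrals of
    squares are asked to be at most k e / 4 each, which after division by k leaves another e/2. The
    added 1 covers \<mu> = 0.\<close>
  define k where "k = e / 4 / (\<mu> + 1)"
  have \<mu>: "0 < \<mu> + 1" unfolding \<mu>_def by (rule add_nonneg_pos) auto
  have k: "0 < k" using e \<mu> by (simp add: k_def)
  have "k * (\<mu> + 1) = e / 4" using \<mu> k_def nonzero_eq_divide_eq[of "\<mu> + 1" k "e / 4"] by (metis less_irrefl)
  then have k\<mu>: "2 * k * \<mu> \<le> e / 2" using k by (simp add: algebra_simps)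
  have main: "\<exists>U r. 0 < r \<and> (AE t in lebesgue. 0 < t \<and> t < T \<longrightarrow> (AE x in lebesgue_on \<Omega>. U t x = u t x)) \<and>
     (AE x in lebesgue_on \<Omega>. U 0 x = u0 x) \<and>
     (\<forall>t. 0 < t \<and> t < r \<longrightarrow> integrable (lebesgue_on \<Omega>) (\<lambda>x. (U t x powr (m + 1) - U 0 x powr (m + 1))\<^sup>2) \<and>
        (LINT x|lebesgue_on \<Omega>. (U t x powr (m + 1) - U 0 x powr (m + 1))\<^sup>2) \<le> k * e / 4)"
    if u: "has_initial_value \<Omega> T m u u0" for u
  proof -
    obtain U where U: "AE t in lebesgue_on {0<..<T}. AE x in lebesgue_on \<Omega>. U t x = u t x"
      "\<And>t. t \<in> {0..T} \<Longrightarrow> (\<lambda>x. U t x powr (m + 1)) \<in> Lp_space 2 \<Omega>"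
      "\<And>t. t \<in> {0..T} \<Longrightarrow> ((\<lambda>r. LINT x:\<Omega>|lebesgue. (U r x powr (m + 1) - U t x powr (m + 1))\<^sup>2) \<longlongrightarrow> 0) (at t within {0..T})"
      "AE x in lebesgue_on \<Omega>. U 0 x = u0 x"
      using u unfolding has_initial_value_def by blast
    have "\<forall>\<^sub>F r in at 0 within {0..T}. (LINT x:\<Omega>|lebesgue. (U r x powr (m + 1) - U 0 x powr (m + 1))\<^sup>2) < k * e / 4"
      using order_tendstoD(2)[OF U(3)[of 0], of "k * e / 4"] T k e by simp
    then obtain d where d: "0 < d" "\<And>r. r \<in> {0..T} \<Longrightarrow> r \<noteq> 0 \<Longrightarrow> dist r 0 < d \<Longrightarrow>
       (LINT x:\<Omega>|lebesgue. (U r x powr (m + 1) - U 0 x powr (m + 1))\<^sup>2) < k * e / 4"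
      unfolding eventually_at by blast
    have "integrable (lebesgue_on \<Omega>) (\<lambda>x. (U t x powr (m + 1) - U 0 x powr (m + 1))\<^sup>2)" if t: "0 < t" "t < T" for t
    proof -
      have L: "(\<lambda>x. U t x powr (m + 1)) \<in> Lp_space 2 \<Omega>" "(\<lambda>x. U 0 x powr (m + 1)) \<in> Lp_space 2 \<Omega>"
        using U(2) t by auto
      have i: "integrable (lebesgue_on \<Omega>) (\<lambda>x. 2 * (U t x powr (m + 1))\<^sup>2 + 2 * (U 0 x powr (m + 1))\<^sup>2)"
        using Lp_space_2_integrable(2)[OF L(1) \<Omega>] Lp_space_2_integrable(2)[OF L(2) \<Omega>] by simp
      have mt: "(\<lambda>x. (U t x powr (m + 1) - U 0 x powr (m + 1))\<^sup>2) \<in> borel_measurable (lebesgue_on \<Omega>)"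
        using L unfolding Lp_space_def by (intro borel_measurable_power borel_measurable_diff) auto
      have "(a - b)\<^sup>2 \<le> 2 * a\<^sup>2 + 2 * b\<^sup>2" for a b :: real
        using zero_le_power2[of "a + b"] by (simp add: power2_eq_square algebra_simps)
      then show ?thesis by (intro Bochner_Integration.integrable_bound[OF i mt] AE_I2) simp
    qed
    then show ?thesis
      using U(1,4) d T \<Omega>s
      by (intro exI[of _ U] exI[of _ "min d T"] conjI allI impI)
        (auto simp: AE_lebesgue_on_iff integrable_lebesgue_on_iff dist_norm intro!: less_imp_le)
  qed
  obtain U r where U: "0 < r" "AE t in lebesgue. 0 < t \<and> t < T \<longrightarrow> (AE x in lebesgue_on \<Omega>. U t x = u t x)"
    "AE x in lebesgue_on \<Omega>. U 0 x = u0 x"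
    "\<And>t. 0 < t \<Longrightarrow> t < r \<Longrightarrow> integrable (lebesgue_on \<Omega>) (\<lambda>x. (U t x powr (m + 1) - U 0 x powr (m + 1))\<^sup>2)"
    "\<And>t. 0 < t \<Longrightarrow> t < r \<Longrightarrow> (LINT x|lebesgue_on \<Omega>. (U t x powr (m + 1) - U 0 x powr (m + 1))\<^sup>2) \<le> k * e / 4"
    using main[OF u] by blast
  obtain W r' where W: "0 < r'" "AE t in lebesgue. 0 < t \<and> t < T \<longrightarrow> (AE x in lebesgue_on \<Omega>. W t x = w t x)"
    "AE x in lebesgue_on \<Omega>. W 0 x = u0 x"
    "\<And>t. 0 < t \<Longrightarrow> t < r' \<Longrightarrow> integrable (lebesgue_on \<Omega>) (\<lambda>x. (W t x powr (m + 1) - W 0 x powr (m + 1))\<^sup>2)"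
    "\<And>t. 0 < t \<Longrightarrow> t < r' \<Longrightarrow> (LINT x|lebesgue_on \<Omega>. (W t x powr (m + 1) - W 0 x powr (m + 1))\<^sup>2) \<le> k * e / 4"
    using main[OF w] by blast
  have "AE t in lebesgue. 0 < t \<and> t < min (min r r') T \<longrightarrow> (LINT x|lebesgue_on \<Omega>. \<bar>u t x powr (m + 1) - w t x powr (m + 1)\<bar>) \<le> e"
    using U(2) W(2)
  proof (eventually_elim, intro impI)
    fix t assume "0 < t \<and> t < T \<longrightarrow> (AE x in lebesgue_on \<Omega>. U t x = u t x)"
      "0 < t \<and> t < T \<longrightarrow> (AE x in lebesgue_on \<Omega>. W t x = w t x)" "0 < t \<and> t < min (min r r') T"
    then have t: "0 < t" "t < r" "t < r'" and ae: "AE x in lebesgue_on \<Omega>. U t x = u t x" "AE x in lebesgue_on \<Omega>. W t x = w t x"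
      by auto
    define A where "A x = (U t x powr (m + 1) - U 0 x powr (m + 1))\<^sup>2" for x
    define B where "B x = (W t x powr (m + 1) - W 0 x powr (m + 1))\<^sup>2" for x
    have AB: "integrable (lebesgue_on \<Omega>) A" "integrable (lebesgue_on \<Omega>) B"
       "integral\<^sup>L (lebesgue_on \<Omega>) A \<le> k * e / 4" "integral\<^sup>L (lebesgue_on \<Omega>) B \<le> k * e / 4"
      unfolding A_def[abs_def] B_def[abs_def] using U(4,5) W(4,5) t by auto
    have am: "\<bar>a\<bar> \<le> k + a\<^sup>2 / k" for a :: real
    proof -
      have "0 \<le> (\<bar>a\<bar> - k)\<^sup>2" by simp
      then have "\<bar>a\<bar> * k * 2 \<le> a\<^sup>2 + k\<^sup>2" by (simp add: power2_diff)
      moreover have "0 \<le> \<bar>a\<bar> * k" using k by simp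
      ultimately have "\<bar>a\<bar> * k \<le> a\<^sup>2 + k\<^sup>2" by linarith
      then have "\<bar>a\<bar> \<le> (a\<^sup>2 + k\<^sup>2) / k" using k by (simp add: pos_le_divide_eq)
      then show ?thesis using k by (simp add: add_divide_distrib power2_eq_square)
    qed
    have bound: "AE x in lebesgue_on \<Omega>. \<bar>u t x powr (m + 1) - w t x powr (m + 1)\<bar> \<le> 2 * k + (A x + B x) / k"
      using ae U(3) W(3)
    proof eventually_elim
      case (elim x)
      have "\<bar>u t x powr (m + 1) - w t x powr (m + 1)\<bar> \<le> \<bar>U t x powr (m + 1) - U 0 x powr (m + 1)\<bar> + \<bar>W t x powr (m + 1) - W 0 x powr (m + 1)\<bar>"
        using elim by simp
      also have "\<dots> \<le> (k + A x / k) + (k + B x / k)" unfolding A_def B_def by (intro add_mono am)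
      finally show ?case by (simp add: add_divide_distrib)
    qed
    show "(LINT x|lebesgue_on \<Omega>. \<bar>u t x powr (m + 1) - w t x powr (m + 1)\<bar>) \<le> e"
    proof (cases "integrable (lebesgue_on \<Omega>) (\<lambda>x. \<bar>u t x powr (m + 1) - w t x powr (m + 1)\<bar>)")
      case True
      have "(LINT x|lebesgue_on \<Omega>. \<bar>u t x powr (m + 1) - w t x powr (m + 1)\<bar>) \<le> (LINT x|lebesgue_on \<Omega>. 2 * k + (A x + B x) / k)"
        by (rule integral_mono_AE[OF True _ bound]) (use AB in auto)
      also have "\<dots> = 2 * k * \<mu> + (integral\<^sup>L (lebesgue_on \<Omega>) A + integral\<^sup>L (lebesgue_on \<Omega>) B) / k"
        using AB by (simp add: \<mu>_def)
      also have "\<dots> \<le> e / 2 + (k * e / 4 + k * e / 4) / k"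
        using k AB k\<mu> by (intro add_mono divide_right_mono) auto
      also have "\<dots> = e" using k by (simp add: field_simps)
      finally show ?thesis .
    \<comment> \<open>Without integrability the integral is 0 by convention.\<close>
    qed (use e in \<open>simp add: not_integrable_integral_eq\<close>)
  qed
  then show ?thesis using U(1) W(1) T by (intro exI[of _ "min (min r r') T"]) auto
qed

text \<open>On a bounded time interval an essentially bounded norm is integrable once it is
  measurable in t, and measurability comes from integrating jointly measurable p-th powers over
  space.\<close>

lemma in_Linf_W01p_imp_in_L1_W01p:
  assumes u: "in_Linf_W01p \<Omega> p T u G" and p: "1 < p"
  shows "in_L1_W01p \<Omega> p T u G"
proof -
  let ?S = "{0<..<T} \<times> (UNIV :: 'a set)"
  obtain C where tw: "time_W01p \<Omega> p T u G" and C: "AE t in lebesgue_on {0<..<T}. W1p_norm p (u t) (G t) \<le> C"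
    using u by (auto simp: in_Linf_W01p_def)
  have S: "?S \<in> sets lebesgue" by (intro open_sets_lebesgue open_Times) auto
  have m: "(\<lambda>w. indicator ?S w * norm (F (fst w) (snd w)) powr p) \<in> borel_measurable lebesgue"
    if F: "(\<lambda>(t, x). F t x) \<in> borel_measurable (lebesgue_on ?S)" for F :: "real \<Rightarrow> 'a \<Rightarrow> 'b::euclidean_space"
  proof -
    have "(\<lambda>w. norm (F (fst w) (snd w)) powr p) \<in> borel_measurable (lebesgue_on ?S)"
      using F unfolding case_prod_beta' by (intro powr_real_measurable borel_measurable_norm) auto
    then show ?thesis using borel_measurable_restrict_space_iff[of ?S lebesgue "\<lambda>w. norm (F (fst w) (snd w)) powr p"] S by simp
  qed
  have mN: "(\<lambda>t. ((LINT x|lebesgue. indicator ?S (t, x) * norm (u (fst (t, x)) (snd (t, x))) powr p)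
       + (LINT x|lebesgue. indicator ?S (t, x) * norm (G (fst (t, x)) (snd (t, x))) powr p)) powr (1 / p)) \<in> borel_measurable lebesgue"
    using tw unfolding time_W01p_def
    by (intro powr_real_measurable borel_measurable_add borel_measurable_const borel_measurable_lebesgue_integral_Pair m) auto
  have mW: "(\<lambda>t. W1p_norm p (u t) (G t)) \<in> borel_measurable (lebesgue_on {0<..<T})"
    by (rule measurable_cong[THEN iffD1, OF _ measurable_restrict_space1[OF mN]])
      (auto simp: W1p_norm_def space_restrict_space)
  have "integrable (lebesgue_on {0<..<T}) (\<lambda>t. W1p_norm p (u t) (G t))"
  proof (rule bounded_integrable_lebesgue_on[OF mW])
    show "{0<..<T} \<in> lmeasurable" by (rule lmeasurable_open) auto
    show "AE t in lebesgue_on {0<..<T}. \<bar>W1p_norm p (u t) (G t)\<bar> \<le> C"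
      using C by eventually_elim (simp add: W1p_norm_nonneg)
  qed
  with tw show ?thesis by (simp add: in_L1_W01p_def)
qed

text \<open>The nonlocal term requires bounds on the whole space. Inside \<Omega> they are part of
  the definition; outside, membership in the Sobolev space forces zero at almost every time, and
  joint measurability makes this an almost everywhere statement in space-time.\<close>

lemma weak_solution_AE_bounds:
  assumes tw: "time_W01p \<Omega> p T u G" and p: "1 < p" and \<Omega>: "open \<Omega>"
    and inf: "(\<lambda>(t, x). u t x) \<in> Linf_space ({0<..<T} \<times> \<Omega>)"
    and pos: "AE (t, x) in lebesgue_on ({0<..<T} \<times> \<Omega>). 0 < u t x"
  obtains M where "0 < M" "AE w in lebesgue. fst w \<in> {0<..<T} \<longrightarrow>
     0 \<le> u (fst w) (snd w) \<and> u (fst w) (snd w) \<le> M \<and> (snd w \<in> \<Omega> \<longrightarrow> 0 < u (fst w) (snd w))"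
proof -
  let ?S = "{0<..<T} \<times> (UNIV :: 'a set)" and ?Q = "{0<..<T} \<times> \<Omega>"
  have S: "?S \<in> sets lebesgue" and Q: "?Q \<in> sets lebesgue" and Tl: "{0<..<T} \<in> sets lebesgue"
    using \<Omega> by (auto intro!: open_sets_lebesgue open_Times)
  have "AE t in lebesgue_on {0<..<T}. in_W01p \<Omega> p (u t) (G t)" using tw by (simp add: time_W01p_def)
  then have "AE t in lebesgue. t \<in> {0<..<T} \<longrightarrow> in_W01p \<Omega> p (u t) (G t)" using Tl by (simp add: AE_lebesgue_on_iff)
  then have ae: "AE t in lebesgue. AE x in lebesgue. (t, x) \<in> {0<..<T} \<times> (- \<Omega>) \<longrightarrow> u (fst (t, x)) (snd (t, x)) = 0"
  proof eventually_elim
    case (elim t)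
    show ?case
    proof (cases "t \<in> {0<..<T}")
      case True
      then have "AE x in lebesgue. x \<notin> \<Omega> \<longrightarrow> u t x = 0" using in_W01p_AE_eq_0[OF _ p] elim by blast
      then show ?thesis by eventually_elim auto
    next
      case False
      then show ?thesis by (intro AE_I2) auto
    qed
  qed
  have out: "AE w in lebesgue. w \<in> {0<..<T} \<times> (- \<Omega>) \<longrightarrow> u (fst w) (snd w) = 0"
  proof (rule AE_lebesgue_PairI[OF _ ae])
    have h: "(\<lambda>w. indicator ?S w * u (fst w) (snd w)) \<in> borel_measurable lebesgue"
      using tw borel_measurable_restrict_space_iff[of ?S lebesgue "\<lambda>w. u (fst w) (snd w)"] S
      by (simp add: time_W01p_def case_prod_beta')
    have 1: "(\<lambda>w. indicator ?S w * u (fst w) (snd w)) -` {0} \<in> sets lebesgue"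
      using measurable_sets[OF h, of "{0}"] by simp
    have "{w. w \<in> {0<..<T} \<times> (- \<Omega>) \<longrightarrow> u (fst w) (snd w) = 0} = (- ?S) \<union> ?Q \<union> (\<lambda>w. indicator ?S w * u (fst w) (snd w)) -` {0}"
      by (auto simp: indicator_def split: if_splits)
    moreover have "- ?S \<in> sets lebesgue" using S sets.compl_sets[of ?S lebesgue] by (simp add: Compl_eq_Diff_UNIV)
    ultimately show "{w. w \<in> {0<..<T} \<times> (- \<Omega>) \<longrightarrow> u (fst w) (snd w) = 0} \<in> sets lebesgue" using 1 Q by simp
  qed
  obtain C where C: "AE w in lebesgue. w \<in> ?Q \<longrightarrow> \<bar>u (fst w) (snd w)\<bar> \<le> C"
    using inf Q by (auto simp: Linf_space_def AE_lebesgue_on_iff case_prod_beta')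
  have pos': "AE w in lebesgue. w \<in> ?Q \<longrightarrow> 0 < u (fst w) (snd w)"
    using pos Q by (simp add: AE_lebesgue_on_iff case_prod_beta')
  \<comment> \<open>The maximum with 1 makes the bound positive and covers the zero values outside
    \<Omega>, whatever the sign of C.\<close>
  have "AE w in lebesgue. fst w \<in> {0<..<T} \<longrightarrow>
     0 \<le> u (fst w) (snd w) \<and> u (fst w) (snd w) \<le> max 1 C \<and> (snd w \<in> \<Omega> \<longrightarrow> 0 < u (fst w) (snd w))"
    using out C pos'
  proof eventually_elim
    case (elim w)
    then show ?case by (cases w; cases "snd w \<in> \<Omega>") auto
  qed
  then show ?thesis using that[of "max 1 C"] by simp
qed

text \<open>The test function is the truncated nonlinearity applied to u and w, so it is bounded,
  lies in the Sobolev space at almost every time and has a norm bound uniform in time. On the range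
  of the solutions the truncation is invisible. The gradient formula asks for positive values,
  because only these are interior to the interval of agreement.\<close>

lemma shifted_test_function:
  assumes u: "in_Linf_W01p \<Omega> p T u G" and w: "in_Linf_W01p \<Omega> p T w G'" and p: "1 < p" and m: "0 \<le> m"
    and \<epsilon>: "0 < \<epsilon>" and M: "0 < M" and \<Omega>: "open \<Omega>" "bounded \<Omega>"
  obtains \<phi> H where "in_L1_W01p \<Omega> p T \<phi> H" "(\<lambda>(t, x). \<phi> t x) \<in> Lp_space 2 ({0<..<T} \<times> \<Omega>)"
    "\<And>t x. 0 \<le> u t x \<Longrightarrow> u t x \<le> M \<Longrightarrow> 0 \<le> w t x \<Longrightarrow> w t x \<le> M \<Longrightarrow> \<phi> t x = shifted_test m \<epsilon> (u t x) (w t x)"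
    "\<And>t x. 0 < u t x \<Longrightarrow> u t x \<le> M \<Longrightarrow> 0 < w t x \<Longrightarrow> w t x \<le> M \<Longrightarrow>
       H t x = (1 + m * (w t x + \<epsilon>) powr (m + 1) * (u t x + \<epsilon>) powr - (m + 1)) *\<^sub>R G t x
         - ((m + 1) * (w t x + \<epsilon>) powr m * (u t x + \<epsilon>) powr - m) *\<^sub>R G' t x"
proof -
  let ?S = "{0<..<T} \<times> (UNIV :: 'a set)" and ?Q = "{0<..<T} \<times> \<Omega>"
  define P where "P = shifted_cutoff \<epsilon> M"
  define Q where "Q = (\<lambda>a. shifted_cutoff \<epsilon> M a powr (m + 1))"
  define R where "R = (\<lambda>a. shifted_cutoff \<epsilon> M a powr - m)"
  note pos = shifted_cutoff_pos[OF \<epsilon>, of M]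
  have s: "smooth_on UNIV P" "smooth_on UNIV Q" "smooth_on UNIV R"
    unfolding P_def Q_def R_def by (intro smooth_intros shifted_cutoff_smooth pos)+
  obtain P' where P': "\<And>x. (P has_real_derivative P' x) (at x)" by (rule smooth_on_real_has_derivative[OF s(1)]) blast
  obtain Q' where Q': "\<And>x. (Q has_real_derivative Q' x) (at x)" by (rule smooth_on_real_has_derivative[OF s(2)]) blast
  obtain R' where R': "\<And>x. (R has_real_derivative R' x) (at x)" by (rule smooth_on_real_has_derivative[OF s(3)]) blast
  have at0: "shifted_cutoff \<epsilon> M 0 = \<epsilon>" using shifted_cutoff_eq[OF \<epsilon>, of 0 M] M by simp
  have const: "P x = P 0" "Q x = Q 0" "R x = R 0" if "x \<notin> {- \<epsilon> / 2..M + 2}" for x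
    unfolding P_def Q_def R_def at0 shifted_cutoff_const[OF \<epsilon> that] by simp_all
  have zero: "P 0 = Q 0 * R 0" unfolding P_def Q_def R_def at0 using \<epsilon> by (simp flip: powr_add)
  have val: "P a = a + \<epsilon>" "Q a = (a + \<epsilon>) powr (m + 1)" "R a = (a + \<epsilon>) powr - m" if "0 \<le> a" "a \<le> M + 1" for a
    unfolding P_def Q_def R_def shifted_cutoff_eq[OF \<epsilon> that] by simp_all
  \<comment> \<open>Agreement on the open interval (0, M + 1) determines the derivative at every a
    in (0, M].\<close>
  have loc: "f' a = D" if "\<And>x. (f has_real_derivative f' x) (at x)" "(F has_real_derivative D) (at a)"
    "\<And>x. x \<in> {0<..<M + 1} \<Longrightarrow> F x = f x" "0 < a" "a \<le> M" for f f' F :: "real \<Rightarrow> real" and a D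
  proof -
    have "(f has_real_derivative D) (at a)"
      by (rule has_field_derivative_transform_within_open[OF that(2), where S = "{0<..<M + 1}"]) (use that in auto)
    then show ?thesis using that(1) DERIV_unique by blast
  qed
  have P'val: "P' a = 1" if "0 < a" "a \<le> M" for a
    by (rule loc[OF P' _ _ that, where F = "\<lambda>x. x + \<epsilon>"]) (auto intro!: derivative_eq_intros simp: val)
  have Q'val: "Q' a = (m + 1) * (a + \<epsilon>) powr m" if "0 < a" "a \<le> M" for a
    by (rule loc[OF Q' _ _ that, where F = "\<lambda>x. (x + \<epsilon>) powr (m + 1)"]) (use that \<epsilon> in \<open>auto intro!: derivative_eq_intros simp: val\<close>)
  have R'val: "R' a = - m * (a + \<epsilon>) powr - (m + 1)" if "0 < a" "a \<le> M" for a
    by (rule loc[OF R' _ _ that, where F = "\<lambda>x. (x + \<epsilon>) powr - m"]) (use that \<epsilon> in \<open>auto intro!: derivative_eq_intros simp: val\<close>)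
  define \<Phi> where "\<Phi> a b = P a - Q b * R a" for a b
  define \<Phi>1 where "\<Phi>1 a b = P' a - Q b * R' a" for a b
  define \<Phi>2 where "\<Phi>2 a b = - (Q' b * R a)" for a b
  obtain C where C: "0 \<le> C"
    and cont: "continuous_on UNIV (\<lambda>(a, b). \<Phi> a b)" "continuous_on UNIV (\<lambda>(a, b). \<Phi>1 a b)" "continuous_on UNIV (\<lambda>(a, b). \<Phi>2 a b)"
    and bd: "\<And>a b. \<bar>\<Phi> a b\<bar> \<le> C"
    and W: "\<And>(\<Omega>::'a set) f F g G. in_W01p \<Omega> p f F \<Longrightarrow> in_W01p \<Omega> p g G \<Longrightarrow>
      in_W01p \<Omega> p (\<lambda>x. \<Phi> (f x) (g x)) (\<lambda>x. \<Phi>1 (f x) (g x) *\<^sub>R F x + \<Phi>2 (f x) (g x) *\<^sub>R G x)"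
    and N: "\<And>(\<Omega>::'a set) f F g G. in_W01p \<Omega> p f F \<Longrightarrow> in_W01p \<Omega> p g G \<Longrightarrow>
      W1p_norm p (\<lambda>x. \<Phi> (f x) (g x)) (\<lambda>x. \<Phi>1 (f x) (g x) *\<^sub>R F x + \<Phi>2 (f x) (g x) *\<^sub>R G x) powr p
       \<le> C * (W1p_norm p f F powr p + W1p_norm p g G powr p)"
    unfolding \<Phi>_def \<Phi>1_def \<Phi>2_def
    by (rule in_W01p_chain_product[OF s P' Q' R' compact_Icc const zero p]) blast+
  define \<phi> where "\<phi> t x = \<Phi> (u t x) (w t x)" for t x
  define H where "H t x = \<Phi>1 (u t x) (w t x) *\<^sub>R G t x + \<Phi>2 (u t x) (w t x) *\<^sub>R G' t x" for t x
  obtain Cu where tu: "time_W01p \<Omega> p T u G" and Cu: "AE t in lebesgue_on {0<..<T}. W1p_norm p (u t) (G t) \<le> Cu"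
    using u by (auto simp: in_Linf_W01p_def)
  obtain Cw where tw: "time_W01p \<Omega> p T w G'" and Cw: "AE t in lebesgue_on {0<..<T}. W1p_norm p (w t) (G' t) \<le> Cw"
    using w by (auto simp: in_Linf_W01p_def)
  have mu: "(\<lambda>z. u (fst z) (snd z)) \<in> borel_measurable (lebesgue_on ?S)" "(\<lambda>z. G (fst z) (snd z)) \<in> borel_measurable (lebesgue_on ?S)"
    "(\<lambda>z. w (fst z) (snd z)) \<in> borel_measurable (lebesgue_on ?S)" "(\<lambda>z. G' (fst z) (snd z)) \<in> borel_measurable (lebesgue_on ?S)"
    using tu tw by (auto simp: time_W01p_def case_prod_beta')
  have mc: "(\<lambda>z. \<Psi> (u (fst z) (snd z)) (w (fst z) (snd z))) \<in> borel_measurable (lebesgue_on ?S)"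
    if "continuous_on UNIV (\<lambda>(a, b). \<Psi> a b)" for \<Psi> :: "real \<Rightarrow> real \<Rightarrow> real"
    by (rule borel_measurable_continuous_Pair[OF mu(1,3)]) (use that in \<open>simp add: case_prod_beta'\<close>)
  have m\<phi>: "(\<lambda>(t, x). \<phi> t x) \<in> borel_measurable (lebesgue_on ?S)"
    unfolding case_prod_beta' \<phi>_def by (rule mc[OF cont(1)])
  have mH: "(\<lambda>(t, x). H t x) \<in> borel_measurable (lebesgue_on ?S)"
    unfolding case_prod_beta' H_def
    by (intro borel_measurable_add borel_measurable_scaleR mc[OF cont(2)] mc[OF cont(3)] mu)
  have W\<phi>: "AE t in lebesgue_on {0<..<T}. in_W01p \<Omega> p (\<phi> t) (H t) \<and> W1p_norm p (\<phi> t) (H t) \<le> (C * (Cu powr p + Cw powr p)) powr (1 / p)"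
  proof -
    have "AE t in lebesgue_on {0<..<T}. in_W01p \<Omega> p (u t) (G t)" "AE t in lebesgue_on {0<..<T}. in_W01p \<Omega> p (w t) (G' t)"
      using tu tw by (auto simp: time_W01p_def)
    then show ?thesis using Cu Cw
    proof eventually_elim
      case (elim t)
      have 1: "in_W01p \<Omega> p (\<phi> t) (H t)" unfolding \<phi>_def[abs_def] H_def[abs_def] by (rule W[OF elim(1,2)])
      have "W1p_norm p (\<phi> t) (H t) powr p \<le> C * (W1p_norm p (u t) (G t) powr p + W1p_norm p (w t) (G' t) powr p)"
        unfolding \<phi>_def[abs_def] H_def[abs_def] by (rule N[OF elim(1,2)])
      also have "\<dots> \<le> C * (Cu powr p + Cw powr p)"
        using C p elim(3,4) by (intro mult_left_mono add_mono powr_mono2 W1p_norm_nonneg) auto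
      finally have "(W1p_norm p (\<phi> t) (H t) powr p) powr (1 / p) \<le> (C * (Cu powr p + Cw powr p)) powr (1 / p)"
        using p by (intro powr_mono2) auto
      then show ?case using 1 p W1p_norm_nonneg[of p "\<phi> t" "H t"] by (simp add: powr_powr)
    qed
  qed
  have "in_Linf_W01p \<Omega> p T \<phi> H"
    unfolding in_Linf_W01p_def time_W01p_def using m\<phi> mH W\<phi> by (auto elim: eventually_mono)
  then have L1: "in_L1_W01p \<Omega> p T \<phi> H" by (rule in_Linf_W01p_imp_in_L1_W01p[OF _ p])
  have Qm: "?Q \<in> lmeasurable" using \<Omega> by (intro lmeasurable_open open_Times bounded_Times) auto
  have m\<phi>Q: "(\<lambda>z. \<phi> (fst z) (snd z)) \<in> borel_measurable (lebesgue_on ?Q)"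
    by (rule borel_measurable_restrict_mono[OF m\<phi>[unfolded case_prod_beta']]) auto
  have "(\<lambda>z. norm (\<phi> (fst z) (snd z)) powr 2) \<in> borel_measurable (lebesgue_on ?Q)"
    by (intro powr_real_measurable measurable_compose[OF m\<phi>Q borel_measurable_norm] borel_measurable_const)
  then have "integrable (lebesgue_on ?Q) (\<lambda>z. norm (\<phi> (fst z) (snd z)) powr 2)"
  proof (rule bounded_integrable_lebesgue_on[OF _ Qm])
    show "AE z in lebesgue_on ?Q. \<bar>norm (\<phi> (fst z) (snd z)) powr 2\<bar> \<le> C powr 2"
      unfolding abs_of_nonneg[OF powr_ge_zero] \<phi>_def
      by (intro AE_I2 powr_mono2) (use bd in auto)
  qed
  with m\<phi>Q have L2: "(\<lambda>(t, x). \<phi> t x) \<in> Lp_space 2 ?Q" by (simp add: Lp_space_def case_prod_beta')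
  show ?thesis
  proof (rule that[OF L1 L2])
    show "\<phi> t x = shifted_test m \<epsilon> (u t x) (w t x)" if "0 \<le> u t x" "u t x \<le> M" "0 \<le> w t x" "w t x \<le> M" for t x
      using that by (simp add: \<phi>_def \<Phi>_def val shifted_test_def)
    show "H t x = (1 + m * (w t x + \<epsilon>) powr (m + 1) * (u t x + \<epsilon>) powr - (m + 1)) *\<^sub>R G t x
         - ((m + 1) * (w t x + \<epsilon>) powr m * (u t x + \<epsilon>) powr - m) *\<^sub>R G' t x"
      if "0 < u t x" "u t x \<le> M" "0 < w t x" "w t x \<le> M" for t x
    proof -
      have "\<Phi>1 (u t x) (w t x) = 1 + m * (w t x + \<epsilon>) powr (m + 1) * (u t x + \<epsilon>) powr - (m + 1)"
        using that unfolding \<Phi>1_def P'val[OF that(1,2)] R'val[OF that(1,2)] by (subst val(2)) (auto simp: algebra_simps)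
      moreover have "\<Phi>2 (u t x) (w t x) = - ((m + 1) * (w t x + \<epsilon>) powr m * (u t x + \<epsilon>) powr - m)"
        using that unfolding \<Phi>2_def Q'val[OF that(3,4)] by (subst val(3)) auto
      ultimately show ?thesis by (simp add: H_def)
    qed
  qed
qed

text \<open>The requirement for one test function, with u, G and v fixed. Set integrals become
  integrals over \<open>lebesgue_on\<close> and tuple patterns become projections, the form in which
  the integration lemmas are applied.\<close>

definition weak_equation ::
  "'a::euclidean_space set \<Rightarrow> real \<Rightarrow> real \<Rightarrow> real \<Rightarrow> real \<Rightarrow> real \<Rightarrow> (real \<Rightarrow> 'a \<Rightarrow> real) \<Rightarrow>
   (real \<Rightarrow> 'a \<Rightarrow> real) \<Rightarrow> (real \<Rightarrow> 'a \<Rightarrow> 'a) \<Rightarrow> (real \<Rightarrow> 'a \<Rightarrow> real) \<Rightarrow>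
   real \<Rightarrow> (real \<Rightarrow> 'a \<Rightarrow> real) \<Rightarrow> (real \<Rightarrow> 'a \<Rightarrow> 'a) \<Rightarrow> bool" where
  "weak_equation \<Omega> p s m \<delta> \<gamma> g u G v t \<phi> H \<longleftrightarrow>
      integrable (lebesgue_on ({0<..<t} \<times> \<Omega>)) (\<lambda>w. u (fst w) (snd w) powr m * v (fst w) (snd w) * \<phi> (fst w) (snd w)) \<and>
      integrable (lebesgue_on ({0<..<t} \<times> \<Omega>)) (\<lambda>w. norm (G (fst w) (snd w)) powr (p - 2) * (G (fst w) (snd w) \<bullet> H (fst w) (snd w))) \<and>
      integrable (lebesgue_on ({0<..<t} \<times> (UNIV :: ('a \<times> 'a) set)))
        (\<lambda>w. spow p (u (fst w) (fst (snd w)) - u (fst w) (snd (snd w))) * (\<phi> (fst w) (fst (snd w)) - \<phi> (fst w) (snd (snd w)))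
           / norm (fst (snd w) - snd (snd w)) powr (real DIM('a) + s * p)) \<and>
      integrable (lebesgue_on ({0<..<t} \<times> \<Omega>)) (\<lambda>w. (g (fst w) (snd w) * u (fst w) (snd w) powr m
           + m * infdist (snd w) (frontier \<Omega>) powr (- \<gamma>) * u (fst w) (snd w) powr \<delta>) * \<phi> (fst w) (snd w)) \<and>
      (LINT w|lebesgue_on ({0<..<t} \<times> \<Omega>). u (fst w) (snd w) powr m * v (fst w) (snd w) * \<phi> (fst w) (snd w))
      + (LINT w|lebesgue_on ({0<..<t} \<times> \<Omega>). norm (G (fst w) (snd w)) powr (p - 2) * (G (fst w) (snd w) \<bullet> H (fst w) (snd w)))
      + (LINT w|lebesgue_on ({0<..<t} \<times> (UNIV :: ('a \<times> 'a) set)).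
          spow p (u (fst w) (fst (snd w)) - u (fst w) (snd (snd w))) * (\<phi> (fst w) (fst (snd w)) - \<phi> (fst w) (snd (snd w)))
           / norm (fst (snd w) - snd (snd w)) powr (real DIM('a) + s * p))
      = (LINT w|lebesgue_on ({0<..<t} \<times> \<Omega>). (g (fst w) (snd w) * u (fst w) (snd w) powr m
           + m * infdist (snd w) (frontier \<Omega>) powr (- \<gamma>) * u (fst w) (snd w) powr \<delta>) * \<phi> (fst w) (snd w))"

lemma weak_solutionE:
  assumes sol: "weak_solution \<Omega> T p s m \<delta> \<gamma> g u0 (u :: real \<Rightarrow> 'a::euclidean_space \<Rightarrow> real)" and \<Omega>: "open \<Omega>"
  obtains G v where "in_Linf_W01p \<Omega> p T u G"
    "(\<lambda>(t, x). u t x) \<in> Linf_space ({0<..<T} \<times> \<Omega>)"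
    "AE (t, x) in lebesgue_on ({0<..<T} \<times> \<Omega>). 0 < u t x"
    "is_weak_time_derivative ({0<..<T} \<times> \<Omega>) (\<lambda>w. u (fst w) (snd w) powr (m + 1)) (\<lambda>w. v (fst w) (snd w))"
    "(\<lambda>w. v (fst w) (snd w)) \<in> Lp_space 2 ({0<..<T} \<times> \<Omega>)"
    "has_initial_value \<Omega> T m u u0"
    "\<And>t \<phi> H. 0 < t \<Longrightarrow> t \<le> T \<Longrightarrow> (\<lambda>(t, x). \<phi> t x) \<in> Lp_space 2 ({0<..<T} \<times> \<Omega>) \<Longrightarrow> in_L1_W01p \<Omega> p T \<phi> H \<Longrightarrow>
      weak_equation \<Omega> p s m \<delta> \<gamma> g u G v t \<phi> H"
proof -
  have Q: "{0<..<t} \<times> \<Omega> \<in> sets lebesgue" for t :: real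
    using \<Omega> by (intro open_sets_lebesgue open_Times) auto
  have Q2: "{0<..<t} \<times> (UNIV :: ('a \<times> 'a) set) \<in> sets lebesgue" for t :: real
    by (intro open_sets_lebesgue open_Times) auto
  note conv = integrable_lebesgue_on_iff[OF Q] integrable_lebesgue_on_iff[OF Q2]
  obtain G v where *: "in_Linf_W01p \<Omega> p T u G"
    "(\<lambda>(t, x). u t x) \<in> Linf_space ({0<..<T} \<times> \<Omega>)"
    "AE (t, x) in lebesgue_on ({0<..<T} \<times> \<Omega>). 0 < u t x"
    "is_weak_time_derivative ({0<..<T} \<times> \<Omega>) (\<lambda>(t, x). u t x powr (m + 1)) (\<lambda>(t, x). v t x)"
    "(\<lambda>(t, x). v t x) \<in> Lp_space 2 ({0<..<T} \<times> \<Omega>)"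
    "has_initial_value \<Omega> T m u u0"
    and eq: "\<forall>t\<in>{0<..T}. \<forall>\<phi> H.
        (\<lambda>(\<tau>, x). \<phi> \<tau> x) \<in> Lp_space 2 ({0<..<T} \<times> \<Omega>) \<and> in_L1_W01p \<Omega> p T \<phi> H \<longrightarrow>
        (let Q = {0<..<t} \<times> \<Omega>;
             Q2 = {0<..<t} \<times> (UNIV :: ('a \<times> 'a) set);
             A = (\<lambda>(\<tau>, x). u \<tau> x powr m * v \<tau> x * \<phi> \<tau> x);
             B = (\<lambda>(\<tau>, x). norm (G \<tau> x) powr (p - 2) * (G \<tau> x \<bullet> H \<tau> x));
             K = (\<lambda>(\<tau>, x, y). spow p (u \<tau> x - u \<tau> y) * (\<phi> \<tau> x - \<phi> \<tau> y)
                    / norm (x - y) powr (real DIM('a) + s * p));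
             R = (\<lambda>(\<tau>, x). (g \<tau> x * u \<tau> x powr m
                    + m * infdist x (frontier \<Omega>) powr (- \<gamma>) * u \<tau> x powr \<delta>) * \<phi> \<tau> x)
         in set_integrable lebesgue Q A \<and> set_integrable lebesgue Q B \<and>
            set_integrable lebesgue Q2 K \<and> set_integrable lebesgue Q R \<and>
            (LINT z:Q|lebesgue. A z) + (LINT z:Q|lebesgue. B z) + (LINT z:Q2|lebesgue. K z)
              = (LINT z:Q|lebesgue. R z))"
    using sol unfolding weak_solution_def by (elim exE conjE) (rule that)
  show ?thesis
  proof (rule that[OF *(1-3) _ _ *(6)])
    show "is_weak_time_derivative ({0<..<T} \<times> \<Omega>) (\<lambda>w. u (fst w) (snd w) powr (m + 1)) (\<lambda>w. v (fst w) (snd w))"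
      "(\<lambda>w. v (fst w) (snd w)) \<in> Lp_space 2 ({0<..<T} \<times> \<Omega>)"
      using *(4,5) by (simp_all add: case_prod_beta')
  next
    fix t :: real and \<phi> :: "real \<Rightarrow> 'a \<Rightarrow> real" and H :: "real \<Rightarrow> 'a \<Rightarrow> 'a"
    assume t: "0 < t" "t \<le> T" and \<phi>: "(\<lambda>(t, x). \<phi> t x) \<in> Lp_space 2 ({0<..<T} \<times> \<Omega>)" "in_L1_W01p \<Omega> p T \<phi> H"
    from t have t': "t \<in> {0<..T}" by simp
    note inst = eq[rule_format, OF t' conjI, OF \<phi>]
    show "weak_equation \<Omega> p s m \<delta> \<gamma> g u G v t \<phi> H"
      using inst unfolding weak_equation_def Let_def conv case_prod_beta' .
  qed
qed

text \<open>With a total integral, linearity is not automatic: the products have to be integrable.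
  They are, because a test function and its time derivative are bounded.\<close>

lemma is_weak_time_derivative_diff:
  fixes z1 z2 \<zeta>1 \<zeta>2 :: "real \<times> 'a::euclidean_space \<Rightarrow> real"
  assumes Q: "open Q" and 1: "is_weak_time_derivative Q z1 \<zeta>1" and 2: "is_weak_time_derivative Q z2 \<zeta>2"
    and i: "integrable (lebesgue_on Q) z1" "integrable (lebesgue_on Q) z2" "integrable (lebesgue_on Q) \<zeta>1" "integrable (lebesgue_on Q) \<zeta>2"
  shows "is_weak_time_derivative Q (\<lambda>w. z1 w - z2 w) (\<lambda>w. \<zeta>1 w - \<zeta>2 w)"
  unfolding is_weak_time_derivative_def
proof
  fix \<psi> assume \<psi>: "\<psi> \<in> test_functions Q"
  note conv = integrable_lebesgue_on_iff(2)[OF open_sets_lebesgue[OF Q]]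
  obtain K where K: "compact K" "\<And>x. x \<notin> K \<Longrightarrow> \<psi> x = 0" "\<And>x. x \<notin> K \<Longrightarrow> grad \<psi> x = 0"
    by (rule test_functions_support[OF \<psi>]) blast
  note s = test_functionsD(1)[OF \<psi>]
  have td: "time_deriv \<psi> w = grad \<psi> w \<bullet> (1, 0)" for w
    unfolding time_deriv_def by (rule frechet_derivative_grad[OF smooth_on_has_derivative[OF s]])
  have int: "integrable (lebesgue_on Q) (\<lambda>w. f w * h w)"
    if f: "integrable (lebesgue_on Q) f" and h: "continuous_on UNIV h" and h0: "\<And>x. x \<notin> K \<Longrightarrow> h x = 0" for f h :: "real \<times> 'a \<Rightarrow> real"
  proof -
    obtain C where C: "0 \<le> C" "\<And>x. norm (h x) \<le> C" using continuous_compact_support_bounded[OF h K(1) h0] by blast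
    have "h \<in> borel_measurable lborel" using borel_measurable_continuous_onI[OF h] by simp
    then have "h \<in> borel_measurable (lebesgue_on Q)" by (intro measurable_restrict_space1 measurable_completion)
    from integrable_mult_bounded[OF f this, of C] C(2) show ?thesis by simp
  qed
  have c: "continuous_on UNIV (time_deriv \<psi>)" "continuous_on UNIV \<psi>"
    unfolding td[abs_def] by (intro continuous_intros grad_continuous smooth_on_continuous s)+
  have t0: "x \<notin> K \<Longrightarrow> time_deriv \<psi> x = 0" for x by (simp add: td K(3))
  note int1 = int[OF _ c(1) t0] and int2 = int[OF _ c(2) K(2)]
  have "(LINT w:Q|lebesgue. (z1 w - z2 w) * time_deriv \<psi> w) = (LINT w:Q|lebesgue. z1 w * time_deriv \<psi> w) - (LINT w:Q|lebesgue. z2 w * time_deriv \<psi> w)"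
    unfolding conv left_diff_distrib by (rule Bochner_Integration.integral_diff[OF int1[OF i(1)] int1[OF i(2)]])
  moreover have "(LINT w:Q|lebesgue. (\<zeta>1 w - \<zeta>2 w) * \<psi> w) = (LINT w:Q|lebesgue. \<zeta>1 w * \<psi> w) - (LINT w:Q|lebesgue. \<zeta>2 w * \<psi> w)"
    unfolding conv left_diff_distrib by (rule Bochner_Integration.integral_diff[OF int2[OF i(3)] int2[OF i(4)]])
  ultimately show "(LINT w:Q|lebesgue. (z1 w - z2 w) * time_deriv \<psi> w) = - (LINT w:Q|lebesgue. (\<zeta>1 w - \<zeta>2 w) * \<psi> w)"
    using 1 2 \<psi> by (simp add: is_weak_time_derivative_def)
qed

lemma bounded_Lp_space_2:
  fixes f :: "'a::euclidean_space \<Rightarrow> real"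
  assumes f: "f \<in> borel_measurable (lebesgue_on S)" and S: "S \<in> lmeasurable" and b: "AE x in lebesgue_on S. \<bar>f x\<bar> \<le> C"
  shows "f \<in> Lp_space 2 S"
proof -
  have m: "(\<lambda>x. norm (f x) powr 2) \<in> borel_measurable (lebesgue_on S)"
    by (intro powr_real_measurable measurable_compose[OF f borel_measurable_norm] borel_measurable_const)
  have "AE x in lebesgue_on S. \<bar>norm (f x) powr 2\<bar> \<le> C powr 2"
    using b
  proof eventually_elim
    case (elim x)
    show ?case unfolding abs_of_nonneg[OF powr_ge_zero] by (rule powr_mono2) (use elim in auto)
  qed
  from bounded_integrable_lebesgue_on[OF m S this] f show ?thesis by (simp add: Lp_space_def)
qed

text \<open>The shift makes all values positive, including those outside \<Omega>, so
  \<open>local_picone_pair\<close> and \<open>discrete_picone_pair\<close> hold pointwise with q = m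
  + 1 < p. For the nonlocal term, the bounds at both space points come from
  \<open>AE_lebesgue_triple\<close>, and dividing by a power of the distance preserves the
  sign.\<close>

lemma diffusion_terms_nonneg:
  fixes \<Omega> :: "'a::euclidean_space set" and u u' :: "real \<Rightarrow> 'a \<Rightarrow> real"
  defines "Q \<equiv> \<lambda>t. {0<..<t::real} \<times> \<Omega>" and "Q2 \<equiv> \<lambda>t. {0<..<t::real} \<times> (UNIV :: ('a \<times> 'a) set)"
  assumes \<Omega>: "open \<Omega>" and p: "1 < p" and m: "0 \<le> m" "m < p - 1" and t: "0 < t" "t \<le> T" and \<epsilon>: "0 < \<epsilon>"
    and B: "AE w in lebesgue. fst w \<in> {0<..<T} \<longrightarrow> 0 \<le> u (fst w) (snd w) \<and> u (fst w) (snd w) \<le> M \<and>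
      0 \<le> u' (fst w) (snd w) \<and> u' (fst w) (snd w) \<le> M \<and> (snd w \<in> \<Omega> \<longrightarrow> 0 < u (fst w) (snd w) \<and> 0 < u' (fst w) (snd w))"
    and \<phi>: "\<And>t x. 0 \<le> u t x \<Longrightarrow> u t x \<le> M \<Longrightarrow> 0 \<le> u' t x \<Longrightarrow> u' t x \<le> M \<Longrightarrow> \<phi> t x = shifted_test m \<epsilon> (u t x) (u' t x)"
    and \<phi>': "\<And>t x. 0 \<le> u' t x \<Longrightarrow> u' t x \<le> M \<Longrightarrow> 0 \<le> u t x \<Longrightarrow> u t x \<le> M \<Longrightarrow> \<phi>' t x = shifted_test m \<epsilon> (u' t x) (u t x)"
    and H: "\<And>t x. 0 < u t x \<Longrightarrow> u t x \<le> M \<Longrightarrow> 0 < u' t x \<Longrightarrow> u' t x \<le> M \<Longrightarrow>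
       H t x = (1 + m * (u' t x + \<epsilon>) powr (m + 1) * (u t x + \<epsilon>) powr - (m + 1)) *\<^sub>R G t x
         - ((m + 1) * (u' t x + \<epsilon>) powr m * (u t x + \<epsilon>) powr - m) *\<^sub>R G' t x"
    and H': "\<And>t x. 0 < u' t x \<Longrightarrow> u' t x \<le> M \<Longrightarrow> 0 < u t x \<Longrightarrow> u t x \<le> M \<Longrightarrow>
       H' t x = (1 + m * (u t x + \<epsilon>) powr (m + 1) * (u' t x + \<epsilon>) powr - (m + 1)) *\<^sub>R G' t x
         - ((m + 1) * (u t x + \<epsilon>) powr m * (u' t x + \<epsilon>) powr - m) *\<^sub>R G t x"
    and iB: "integrable (lebesgue_on (Q t)) (\<lambda>w. norm (G (fst w) (snd w)) powr (p - 2) * (G (fst w) (snd w) \<bullet> H (fst w) (snd w)))"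
      "integrable (lebesgue_on (Q t)) (\<lambda>w. norm (G' (fst w) (snd w)) powr (p - 2) * (G' (fst w) (snd w) \<bullet> H' (fst w) (snd w)))"
    and iK: "integrable (lebesgue_on (Q2 t))
        (\<lambda>w. spow p (u (fst w) (fst (snd w)) - u (fst w) (snd (snd w))) * (\<phi> (fst w) (fst (snd w)) - \<phi> (fst w) (snd (snd w)))
           / norm (fst (snd w) - snd (snd w)) powr \<sigma>)"
      "integrable (lebesgue_on (Q2 t))
        (\<lambda>w. spow p (u' (fst w) (fst (snd w)) - u' (fst w) (snd (snd w))) * (\<phi>' (fst w) (fst (snd w)) - \<phi>' (fst w) (snd (snd w)))
           / norm (fst (snd w) - snd (snd w)) powr \<sigma>)"
  shows "0 \<le> (LINT w|lebesgue_on (Q t). norm (G (fst w) (snd w)) powr (p - 2) * (G (fst w) (snd w) \<bullet> H (fst w) (snd w)))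
      + (LINT w|lebesgue_on (Q t). norm (G' (fst w) (snd w)) powr (p - 2) * (G' (fst w) (snd w) \<bullet> H' (fst w) (snd w)))" (is ?local)
    and "0 \<le> (LINT w|lebesgue_on (Q2 t).
          spow p (u (fst w) (fst (snd w)) - u (fst w) (snd (snd w))) * (\<phi> (fst w) (fst (snd w)) - \<phi> (fst w) (snd (snd w)))
           / norm (fst (snd w) - snd (snd w)) powr \<sigma>)
      + (LINT w|lebesgue_on (Q2 t).
          spow p (u' (fst w) (fst (snd w)) - u' (fst w) (snd (snd w))) * (\<phi>' (fst w) (fst (snd w)) - \<phi>' (fst w) (snd (snd w)))
           / norm (fst (snd w) - snd (snd w)) powr \<sigma>)" (is ?nonlocal)
proof -
  have Ql: "Q t \<in> sets lebesgue" "Q2 t \<in> sets lebesgue"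
    unfolding Q_def Q2_def using \<Omega> by (auto intro!: open_sets_lebesgue open_Times)
  have q: "1 \<le> m + 1" "m + 1 < p" using m by auto
  define good where "good \<tau> x \<longleftrightarrow> (\<tau> \<in> {0<..<T} \<longrightarrow> 0 \<le> u \<tau> x \<and> u \<tau> x \<le> M \<and> 0 \<le> u' \<tau> x \<and> u' \<tau> x \<le> M \<and>
    (x \<in> \<Omega> \<longrightarrow> 0 < u \<tau> x \<and> 0 < u' \<tau> x))" for \<tau> x
  have B': "AE w in lebesgue. good (fst w) (snd w)" unfolding good_def by (rule B)
  have "AE w in lebesgue_on (Q t). 0 \<le> norm (G (fst w) (snd w)) powr (p - 2) * (G (fst w) (snd w) \<bullet> H (fst w) (snd w))
      + norm (G' (fst w) (snd w)) powr (p - 2) * (G' (fst w) (snd w) \<bullet> H' (fst w) (snd w))"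
    unfolding AE_lebesgue_on_iff[OF Ql(1)] using B'
  proof (eventually_elim, intro impI)
    fix w assume w: "good (fst w) (snd w)" "w \<in> Q t"
    then have uw: "0 < u (fst w) (snd w)" "u (fst w) (snd w) \<le> M" "0 < u' (fst w) (snd w)" "u' (fst w) (snd w) \<le> M"
      using t by (auto simp: Q_def good_def)
    have pos: "0 < u (fst w) (snd w) + \<epsilon>" "0 < u' (fst w) (snd w) + \<epsilon>" using uw \<epsilon> by auto
    show "0 \<le> norm (G (fst w) (snd w)) powr (p - 2) * (G (fst w) (snd w) \<bullet> H (fst w) (snd w))
      + norm (G' (fst w) (snd w)) powr (p - 2) * (G' (fst w) (snd w) \<bullet> H' (fst w) (snd w))"
      using local_picone_pair[OF q pos, of "G (fst w) (snd w)" "G' (fst w) (snd w)"]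
      unfolding H[OF uw] H'[OF uw(3,4,1,2)] add_diff_cancel_right' .
  qed
  from integral_nonneg_AE[OF this] show ?local using iB by simp
  have "AE w in lebesgue_on (Q2 t). 0 \<le> spow p (u (fst w) (fst (snd w)) - u (fst w) (snd (snd w))) * (\<phi> (fst w) (fst (snd w)) - \<phi> (fst w) (snd (snd w)))
           / norm (fst (snd w) - snd (snd w)) powr \<sigma>
     + spow p (u' (fst w) (fst (snd w)) - u' (fst w) (snd (snd w))) * (\<phi>' (fst w) (fst (snd w)) - \<phi>' (fst w) (snd (snd w)))
           / norm (fst (snd w) - snd (snd w)) powr \<sigma>"
    unfolding AE_lebesgue_on_iff[OF Ql(2)] using AE_lebesgue_triple[OF B', unfolded fst_conv snd_conv]
  proof (eventually_elim, intro impI)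
    fix w :: "real \<times> 'a \<times> 'a"
    define \<tau> x y where "\<tau> = fst w" and "x = fst (snd w)" and "y = snd (snd w)"
    assume "good (fst w) (fst (snd w)) \<and> good (fst w) (snd (snd w))" "w \<in> Q2 t"
    then have ux: "0 \<le> u \<tau> x" "u \<tau> x \<le> M" "0 \<le> u' \<tau> x" "u' \<tau> x \<le> M" and uy: "0 \<le> u \<tau> y" "u \<tau> y \<le> M" "0 \<le> u' \<tau> y" "u' \<tau> y \<le> M"
      using t by (auto simp: good_def \<tau>_def x_def y_def Q2_def)
    have pos: "0 < u \<tau> x + \<epsilon>" "0 < u \<tau> y + \<epsilon>" "0 < u' \<tau> x + \<epsilon>" "0 < u' \<tau> y + \<epsilon>" using ux uy \<epsilon> by auto
    have "0 \<le> spow p (u \<tau> x - u \<tau> y) * (\<phi> \<tau> x - \<phi> \<tau> y) + spow p (u' \<tau> x - u' \<tau> y) * (\<phi>' \<tau> x - \<phi>' \<tau> y)"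
      using discrete_picone_pair[OF q pos]
      unfolding \<phi>[OF ux] \<phi>[OF uy] \<phi>'[OF ux(3,4,1,2)] \<phi>'[OF uy(3,4,1,2)] shifted_test_def add_diff_cancel_right' add_diff_cancel_right .
    then have "0 \<le> (spow p (u \<tau> x - u \<tau> y) * (\<phi> \<tau> x - \<phi> \<tau> y) + spow p (u' \<tau> x - u' \<tau> y) * (\<phi>' \<tau> x - \<phi>' \<tau> y)) / norm (x - y) powr \<sigma>"
      by (intro divide_nonneg_nonneg) auto
    then show "0 \<le> spow p (u (fst w) (fst (snd w)) - u (fst w) (snd (snd w))) * (\<phi> (fst w) (fst (snd w)) - \<phi> (fst w) (snd (snd w)))
           / norm (fst (snd w) - snd (snd w)) powr \<sigma>
     + spow p (u' (fst w) (fst (snd w)) - u' (fst w) (snd (snd w))) * (\<phi>' (fst w) (fst (snd w)) - \<phi>' (fst w) (snd (snd w)))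
           / norm (fst (snd w) - snd (snd w)) powr \<sigma>"
      by (simp only: \<tau>_def x_def y_def add_divide_distrib)
  qed
  from integral_nonneg_AE[OF this] show ?nonlocal using iK by simp
qed

theorem corollary2p14:
  fixes \<Omega> :: "(real ^ 'n) set"
    and p s T m \<delta> \<gamma> :: real
    and u0 :: "real ^ 'n \<Rightarrow> real"
    and g u u' :: "real \<Rightarrow> real ^ 'n \<Rightarrow> real"
  assumes "smooth_bounded_domain \<Omega>"
    and "1 < p" and "0 < s" and "s < 1" and "p < real CARD('n)" and "0 < T"
    and "0 \<le> m" and "m < p - 1"
    and "0 < m \<Longrightarrow> 0 < \<delta> \<and> \<delta> < m \<and>
          (\<exists>dd::real. dd > real CARD('n) \<and> 2 * \<delta> - dd * \<gamma> > 2 * m - 1)"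
    and "AE x in lebesgue_on \<Omega>. 0 \<le> u0 x" and "u0 \<in> Lp_space (2 * (m + 1)) \<Omega>"
    and "(\<lambda>(t, x). g t x) \<in> Lp_space 2 ({0<..<T} \<times> \<Omega>)"
    and "weak_solution \<Omega> T p s m \<delta> \<gamma> g u0 u"
    and "weak_solution \<Omega> T p s m \<delta> \<gamma> g u0 u'"
  shows "AE (t, x) in lebesgue_on ({0<..<T} \<times> \<Omega>). u t x = u' t x"
proof -
  have \<Omega>: "open \<Omega>" "bounded \<Omega>" using assms(1) by (auto simp: smooth_bounded_domain_def)
  note p = \<open>1 < p\<close> and m = \<open>0 \<le> m\<close> \<open>m < p - 1\<close> and T = \<open>0 < T\<close>
  define Q where "Q t = {0<..<t::real} \<times> \<Omega>" for t
  have openQ: "open (Q t)" for t unfolding Q_def using \<Omega> by (intro open_Times) auto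
  have Qm: "Q t \<in> lmeasurable" for t
    by (rule lmeasurable_open[OF _ openQ]) (unfold Q_def, intro bounded_Times \<Omega>(2), simp)
  note Ql = open_sets_lebesgue[OF openQ]
  have Qsub: "Q t \<subseteq> Q T" "Q t \<subseteq> {0<..<T} \<times> UNIV" if "t \<le> T" for t using that by (auto simp: Q_def)
  obtain G v where u: "in_Linf_W01p \<Omega> p T u G" "(\<lambda>(t, x). u t x) \<in> Linf_space (Q T)"
      "AE (t, x) in lebesgue_on (Q T). 0 < u t x"
      "is_weak_time_derivative (Q T) (\<lambda>w. u (fst w) (snd w) powr (m + 1)) (\<lambda>w. v (fst w) (snd w))"
      "(\<lambda>w. v (fst w) (snd w)) \<in> Lp_space 2 (Q T)" "has_initial_value \<Omega> T m u u0"
    and equ: "\<And>t \<phi> H. 0 < t \<Longrightarrow> t \<le> T \<Longrightarrow> (\<lambda>(t, x). \<phi> t x) \<in> Lp_space 2 (Q T) \<Longrightarrow> in_L1_W01p \<Omega> p T \<phi> H \<Longrightarrow>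
      weak_equation \<Omega> p s m \<delta> \<gamma> g u G v t \<phi> H"
    unfolding Q_def by (rule weak_solutionE[OF assms(13) \<Omega>(1)]) blast
  obtain G' v' where u': "in_Linf_W01p \<Omega> p T u' G'" "(\<lambda>(t, x). u' t x) \<in> Linf_space (Q T)"
      "AE (t, x) in lebesgue_on (Q T). 0 < u' t x"
      "is_weak_time_derivative (Q T) (\<lambda>w. u' (fst w) (snd w) powr (m + 1)) (\<lambda>w. v' (fst w) (snd w))"
      "(\<lambda>w. v' (fst w) (snd w)) \<in> Lp_space 2 (Q T)" "has_initial_value \<Omega> T m u' u0"
    and equ': "\<And>t \<phi> H. 0 < t \<Longrightarrow> t \<le> T \<Longrightarrow> (\<lambda>(t, x). \<phi> t x) \<in> Lp_space 2 (Q T) \<Longrightarrow> in_L1_W01p \<Omega> p T \<phi> H \<Longrightarrow>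
      weak_equation \<Omega> p s m \<delta> \<gamma> g u' G' v' t \<phi> H"
    unfolding Q_def by (rule weak_solutionE[OF assms(14) \<Omega>(1)]) blast
  have tw: "time_W01p \<Omega> p T u G" "time_W01p \<Omega> p T u' G'" using u(1) u'(1) by (auto simp: in_Linf_W01p_def)
  obtain M1 where M1: "0 < M1" "AE w in lebesgue. fst w \<in> {0<..<T} \<longrightarrow>
     0 \<le> u (fst w) (snd w) \<and> u (fst w) (snd w) \<le> M1 \<and> (snd w \<in> \<Omega> \<longrightarrow> 0 < u (fst w) (snd w))"
    by (rule weak_solution_AE_bounds[OF tw(1) p \<Omega>(1) u(2,3)[unfolded Q_def]])
  obtain M2 where M2: "0 < M2" "AE w in lebesgue. fst w \<in> {0<..<T} \<longrightarrow>
     0 \<le> u' (fst w) (snd w) \<and> u' (fst w) (snd w) \<le> M2 \<and> (snd w \<in> \<Omega> \<longrightarrow> 0 < u' (fst w) (snd w))"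
    by (rule weak_solution_AE_bounds[OF tw(2) p \<Omega>(1) u'(2,3)[unfolded Q_def]])
  define M where "M = max M1 M2"
  have M: "0 < M" using M1(1) by (simp add: M_def)
  have B: "AE w in lebesgue. fst w \<in> {0<..<T} \<longrightarrow> 0 \<le> u (fst w) (snd w) \<and> u (fst w) (snd w) \<le> M \<and>
      0 \<le> u' (fst w) (snd w) \<and> u' (fst w) (snd w) \<le> M \<and> (snd w \<in> \<Omega> \<longrightarrow> 0 < u (fst w) (snd w) \<and> 0 < u' (fst w) (snd w))"
    using M1(2) M2(2) by eventually_elim (auto simp: M_def)
  define U where "U w = u (fst w) (snd w)" for w
  define U' where "U' w = u' (fst w) (snd w)" for w
  define V where "V w = v (fst w) (snd w)" for w
  define V' where "V' w = v' (fst w) (snd w)" for w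
  define g' where "g' w = g (fst w) (snd w)" for w
  \<comment> \<open>The weight contains the factor m, so at a point where it is nonzero one has m >
    0 and the conditions on \<delta> are available.\<close>
  define \<kappa> where "\<kappa> w = m * infdist (snd w) (frontier \<Omega>) powr (- \<gamma>)" for w :: "real \<times> (real ^ 'n)"
  have BQ: "AE w in lebesgue_on (Q t). 0 < U w \<and> U w \<le> M \<and> 0 < U' w \<and> U' w \<le> M" if "t \<le> T" for t
    unfolding AE_lebesgue_on_iff[OF Ql] using B
    by eventually_elim (use that in \<open>auto simp: Q_def U_def U'_def\<close>)
  have mU: "U \<in> borel_measurable (lebesgue_on (Q t))" "U' \<in> borel_measurable (lebesgue_on (Q t))" if "t \<le> T" for t
    unfolding U_def[abs_def] U'_def[abs_def] using tw unfolding time_W01p_def case_prod_beta'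
    by (auto intro: borel_measurable_restrict_mono[OF _ Qsub(2)[OF that]])
  have iT: "integrable (lebesgue_on (Q T)) V" "integrable (lebesgue_on (Q T)) V'" "integrable (lebesgue_on (Q T)) g'"
    using Lp_space_2_integrable(1)[OF u(5) Qm] Lp_space_2_integrable(1)[OF u'(5) Qm] Lp_space_2_integrable(1)[OF assms(12)[folded Q_def] Qm]
    by (simp_all add: V_def[abs_def] V'_def[abs_def] g'_def[abs_def] case_prod_beta')
  have it: "integrable (lebesgue_on (Q t)) V" "integrable (lebesgue_on (Q t)) V'" "integrable (lebesgue_on (Q t)) g'" if "t \<le> T" for t
    using iT by (auto intro: integrable_lebesgue_on_subset[OF _ Ql Ql Qsub(1)[OF that]])
  have mg: "g' \<in> borel_measurable (lebesgue_on (Q t))" if "t \<le> T" for t using it(3)[OF that] by (rule borel_measurable_integrable)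
  have m\<kappa>: "\<kappa> \<in> borel_measurable (lebesgue_on (Q t))" for t
  proof -
    have "(\<lambda>w::real \<times> (real ^ 'n). infdist (snd w) (frontier \<Omega>)) \<in> borel_measurable borel"
      by (intro borel_measurable_continuous_onI continuous_intros)
    then have "\<kappa> \<in> borel_measurable lborel" unfolding \<kappa>_def[abs_def] by simp
    then show ?thesis by (intro measurable_restrict_space1 measurable_completion)
  qed
  have \<kappa>0: "0 \<le> \<kappa> w" "\<kappa> w \<noteq> 0 \<Longrightarrow> 0 < \<delta> \<and> \<delta> < m" for w
    using m assms(9) by (auto simp: \<kappa>_def)
  \<comment> \<open>The hypothesis R comes from the equation tested with the solution itself.
    Subtracting the part with \<open>g\<close>, an integrable function times a bounded one, leaves
    the singular part with exponent \<delta> + 1.\<close>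
  have i\<kappa>: "integrable (lebesgue_on (Q t)) (\<lambda>w. \<kappa> w * f w powr (\<delta> + 1))"
    if t: "t \<le> T" and f: "f \<in> borel_measurable (lebesgue_on (Q t))" "AE w in lebesgue_on (Q t). 0 < f w \<and> f w \<le> M"
      and R: "integrable (lebesgue_on (Q t)) (\<lambda>w. (g' w * f w powr m + \<kappa> w * f w powr \<delta>) * f w)" for t f
  proof -
    have "AE w in lebesgue_on (Q t). \<forall>n::nat. \<bar>f w powr m * f w\<bar> \<le> M powr m * M"
      using f(2)
    proof eventually_elim
      case (elim w)
      then have "f w powr m * f w \<le> M powr m * M" using m by (intro mult_mono powr_mono2) auto
      then show ?case using elim by (simp add: abs_mult)
    qed
    from integral_dominated_mult_AE(2)[where f = "\<lambda>n w. f w powr m * f w" and g = "\<lambda>w. f w powr m * f w", OF it(3)[OF t] _ _ _ this]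
    have "integrable (lebesgue_on (Q t)) (\<lambda>w. g' w * (f w powr m * f w))" using f(1) by simp
    from Bochner_Integration.integrable_diff[OF R this]
    have i: "integrable (lebesgue_on (Q t)) (\<lambda>w. \<kappa> w * f w powr \<delta> * f w)" by (simp add: algebra_simps)
    show ?thesis
    proof (rule integrable_cong_AE_imp[OF i])
      show "(\<lambda>w. \<kappa> w * f w powr (\<delta> + 1)) \<in> borel_measurable (lebesgue_on (Q t))"
        by (intro borel_measurable_times m\<kappa> powr_real_measurable f borel_measurable_const)
      show "AE w in lebesgue_on (Q t). \<kappa> w * f w powr \<delta> * f w = \<kappa> w * f w powr (\<delta> + 1)"
        using f(2) by eventually_elim (simp add: powr_add)
    qed
  qed
  \<comment> \<open>This admits the solutions themselves as test functions.\<close>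
  have L2: "(\<lambda>(t, x). u t x) \<in> Lp_space 2 (Q T)" "(\<lambda>(t, x). u' t x) \<in> Lp_space 2 (Q T)"
  proof -
    have "AE w in lebesgue_on (Q T). \<bar>U w\<bar> \<le> M" "AE w in lebesgue_on (Q T). \<bar>U' w\<bar> \<le> M"
      using BQ[OF order_refl] by (eventually_elim, simp)+
    then have "U \<in> Lp_space 2 (Q T)" "U' \<in> Lp_space 2 (Q T)"
      using bounded_Lp_space_2[OF _ Qm] mU[OF order_refl] by blast+
    then show "(\<lambda>(t, x). u t x) \<in> Lp_space 2 (Q T)" "(\<lambda>(t, x). u' t x) \<in> Lp_space 2 (Q T)"
      by (simp_all add: U_def[abs_def] U'_def[abs_def] case_prod_beta')
  qed
  note L1 = in_Linf_W01p_imp_in_L1_W01p[OF u(1) p] in_Linf_W01p_imp_in_L1_W01p[OF u'(1) p]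
  have energy: "(LINT w|lebesgue_on (Q t). (V w - V' w) * (U w powr (m + 1) - U' w powr (m + 1))) \<le> 0 \<and>
      integrable (lebesgue_on (Q t)) (\<lambda>w. (V w - V' w) * (U w powr (m + 1) - U' w powr (m + 1)))" if t: "0 < t" "t \<le> T" for t
  proof -
    note BQt = BQ[OF t(2)] and mUt = mU[OF t(2)] and itt = it[OF t(2)]
    have B1: "AE w in lebesgue_on (Q t). 0 < U w \<and> U w \<le> M" "AE w in lebesgue_on (Q t). 0 < U' w \<and> U' w \<le> M"
      using BQt by (eventually_elim, simp)+
    have R1: "integrable (lebesgue_on (Q t)) (\<lambda>w. (g' w * U w powr m + \<kappa> w * U w powr \<delta>) * U w)"
      "integrable (lebesgue_on (Q t)) (\<lambda>w. (g' w * U' w powr m + \<kappa> w * U' w powr \<delta>) * U' w)"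
      using equ[OF t L2(1) L1(1)] equ'[OF t L2(2) L1(2)]
      unfolding weak_equation_def g'_def \<kappa>_def U_def U'_def Q_def by blast+
    define A where "A \<epsilon> w = U w powr m * V w * shifted_test m \<epsilon> (U w) (U' w) + U' w powr m * V' w * shifted_test m \<epsilon> (U' w) (U w)" for \<epsilon> w
    define R where "R \<epsilon> w = (g' w * U w powr m + \<kappa> w * U w powr \<delta>) * shifted_test m \<epsilon> (U w) (U' w)
        + (g' w * U' w powr m + \<kappa> w * U' w powr \<delta>) * shifted_test m \<epsilon> (U' w) (U w)" for \<epsilon> w
    \<comment> \<open>The two equations are added for a fixed shift; dropping the nonnegative
      diffusion terms leaves an inequality between the time terms and the source terms.\<close>
    have AR: "integrable (lebesgue_on (Q t)) (R \<epsilon>) \<and> (LINT w|lebesgue_on (Q t). A \<epsilon> w) \<le> (LINT w|lebesgue_on (Q t). R \<epsilon> w)" if \<epsilon>: "0 < \<epsilon>" for \<epsilon>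
    proof -
      obtain \<phi> H where \<phi>: "in_L1_W01p \<Omega> p T \<phi> H" "(\<lambda>(t, x). \<phi> t x) \<in> Lp_space 2 (Q T)"
        and \<phi>v: "\<And>t x. 0 \<le> u t x \<Longrightarrow> u t x \<le> M \<Longrightarrow> 0 \<le> u' t x \<Longrightarrow> u' t x \<le> M \<Longrightarrow> \<phi> t x = shifted_test m \<epsilon> (u t x) (u' t x)"
        and H: "\<And>t x. 0 < u t x \<Longrightarrow> u t x \<le> M \<Longrightarrow> 0 < u' t x \<Longrightarrow> u' t x \<le> M \<Longrightarrow>
       H t x = (1 + m * (u' t x + \<epsilon>) powr (m + 1) * (u t x + \<epsilon>) powr - (m + 1)) *\<^sub>R G t x
         - ((m + 1) * (u' t x + \<epsilon>) powr m * (u t x + \<epsilon>) powr - m) *\<^sub>R G' t x"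
        unfolding Q_def by (rule shifted_test_function[OF u(1) u'(1) p m(1) \<epsilon> M \<Omega>]) blast
      obtain \<phi>' H' where \<phi>': "in_L1_W01p \<Omega> p T \<phi>' H'" "(\<lambda>(t, x). \<phi>' t x) \<in> Lp_space 2 (Q T)"
        and \<phi>v': "\<And>t x. 0 \<le> u' t x \<Longrightarrow> u' t x \<le> M \<Longrightarrow> 0 \<le> u t x \<Longrightarrow> u t x \<le> M \<Longrightarrow> \<phi>' t x = shifted_test m \<epsilon> (u' t x) (u t x)"
        and H': "\<And>t x. 0 < u' t x \<Longrightarrow> u' t x \<le> M \<Longrightarrow> 0 < u t x \<Longrightarrow> u t x \<le> M \<Longrightarrow>
       H' t x = (1 + m * (u t x + \<epsilon>) powr (m + 1) * (u' t x + \<epsilon>) powr - (m + 1)) *\<^sub>R G' t x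
         - ((m + 1) * (u t x + \<epsilon>) powr m * (u' t x + \<epsilon>) powr - m) *\<^sub>R G t x"
        unfolding Q_def by (rule shifted_test_function[OF u'(1) u(1) p m(1) \<epsilon> M \<Omega>]) blast
      note E = equ[OF t \<phi>(2,1), unfolded weak_equation_def, folded Q_def] and E' = equ'[OF t \<phi>'(2,1), unfolded weak_equation_def, folded Q_def]
      note E1 = E[THEN conjunct1] E[THEN conjunct2, THEN conjunct1] E[THEN conjunct2, THEN conjunct2, THEN conjunct1]
        E[THEN conjunct2, THEN conjunct2, THEN conjunct2, THEN conjunct1] E[THEN conjunct2, THEN conjunct2, THEN conjunct2, THEN conjunct2]
      note E2 = E'[THEN conjunct1] E'[THEN conjunct2, THEN conjunct1] E'[THEN conjunct2, THEN conjunct2, THEN conjunct1]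
        E'[THEN conjunct2, THEN conjunct2, THEN conjunct2, THEN conjunct1] E'[THEN conjunct2, THEN conjunct2, THEN conjunct2, THEN conjunct2]
      note nonneg = diffusion_terms_nonneg[OF \<Omega>(1) p m t \<epsilon> B \<phi>v \<phi>v' H H'
          E1(2)[unfolded Q_def] E2(2)[unfolded Q_def] E1(3) E2(3), folded Q_def]
      define A1 where "A1 w = U w powr m * V w * \<phi> (fst w) (snd w)" for w
      define A2 where "A2 w = U' w powr m * V' w * \<phi>' (fst w) (snd w)" for w
      define R1 where "R1 w = (g' w * U w powr m + \<kappa> w * U w powr \<delta>) * \<phi> (fst w) (snd w)" for w
      define R2 where "R2 w = (g' w * U' w powr m + \<kappa> w * U' w powr \<delta>) * \<phi>' (fst w) (snd w)" for w
      have i: "integrable (lebesgue_on (Q t)) A1" "integrable (lebesgue_on (Q t)) A2" "integrable (lebesgue_on (Q t)) R1" "integrable (lebesgue_on (Q t)) R2"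
        using E1(1,4) E2(1,4) unfolding A1_def[abs_def] A2_def[abs_def] R1_def[abs_def] R2_def[abs_def] U_def U'_def V_def V'_def g'_def \<kappa>_def by blast+
      have le: "(LINT w|lebesgue_on (Q t). A1 w) + (LINT w|lebesgue_on (Q t). A2 w) \<le> (LINT w|lebesgue_on (Q t). R1 w) + (LINT w|lebesgue_on (Q t). R2 w)"
        using E1(5) E2(5) nonneg unfolding A1_def A2_def R1_def R2_def U_def U'_def V_def V'_def g'_def \<kappa>_def by linarith
      \<comment> \<open>The truncated test functions take the explicit form where the bounds on both
        solutions hold, that is, almost everywhere.\<close>
      have \<phi>ae: "AE w in lebesgue_on (Q t). \<phi> (fst w) (snd w) = shifted_test m \<epsilon> (U w) (U' w) \<and> \<phi>' (fst w) (snd w) = shifted_test m \<epsilon> (U' w) (U w)"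
        using BQt by eventually_elim (auto simp: U_def U'_def intro!: \<phi>v \<phi>v')
      have st: "(\<lambda>w. shifted_test m \<epsilon> (U w) (U' w)) \<in> borel_measurable (lebesgue_on (Q t))" "(\<lambda>w. shifted_test m \<epsilon> (U' w) (U w)) \<in> borel_measurable (lebesgue_on (Q t))"
        unfolding shifted_test_def by (intro borel_measurable_diff borel_measurable_add borel_measurable_times powr_real_measurable mUt borel_measurable_const)+
      have mV: "V \<in> borel_measurable (lebesgue_on (Q t))" "V' \<in> borel_measurable (lebesgue_on (Q t))"
        using itt by (auto intro: borel_measurable_integrable)
      have mA: "A \<epsilon> \<in> borel_measurable (lebesgue_on (Q t))" "R \<epsilon> \<in> borel_measurable (lebesgue_on (Q t))"
        unfolding A_def[abs_def] R_def[abs_def]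
        by (intro borel_measurable_add borel_measurable_times powr_real_measurable mUt mV st mg[OF t(2)] m\<kappa> borel_measurable_const)+
      have aeA: "AE w in lebesgue_on (Q t). A \<epsilon> w = A1 w + A2 w" and aeR: "AE w in lebesgue_on (Q t). R \<epsilon> w = R1 w + R2 w"
        using \<phi>ae by (eventually_elim, simp add: A_def A1_def A2_def R_def R1_def R2_def)+
      have iA12: "integrable (lebesgue_on (Q t)) (\<lambda>w. A1 w + A2 w)" "integrable (lebesgue_on (Q t)) (\<lambda>w. R1 w + R2 w)"
        using i by simp_all
      have "integrable (lebesgue_on (Q t)) (R \<epsilon>)"
        using integrable_cong_AE[OF mA(2) borel_measurable_integrable[OF iA12(2)] aeR] iA12(2) by simp
      moreover have "(LINT w|lebesgue_on (Q t). A \<epsilon> w) = (LINT w|lebesgue_on (Q t). A1 w) + (LINT w|lebesgue_on (Q t). A2 w)"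
        using integral_cong_AE[OF mA(1) borel_measurable_integrable[OF iA12(1)] aeA] i by simp
      moreover have "(LINT w|lebesgue_on (Q t). R \<epsilon> w) = (LINT w|lebesgue_on (Q t). R1 w) + (LINT w|lebesgue_on (Q t). R2 w)"
        using integral_cong_AE[OF mA(2) borel_measurable_integrable[OF iA12(2)] aeR] i by simp
      ultimately show ?thesis using le by simp
    qed
    note lim = shifted_inequality_limit[OF mUt m\<kappa> itt BQt m(1) \<kappa>0 i\<kappa>[OF t(2) mUt(1) B1(1) R1(1)] i\<kappa>[OF t(2) mUt(2) B1(2) R1(2)]]
    show ?thesis
      by (intro conjI lim) (use AR in \<open>auto simp: A_def R_def[abs_def]\<close>)
  qed
  define z where "z w = U w powr (m + 1) - U' w powr (m + 1)" for w
  define \<zeta> where "\<zeta> w = V w - V' w" for w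
  have iW: "integrable (lebesgue_on (Q T)) (\<lambda>w. U w powr (m + 1))" "integrable (lebesgue_on (Q T)) (\<lambda>w. U' w powr (m + 1))"
  proof -
    have "AE w in lebesgue_on (Q T). \<bar>U w powr (m + 1)\<bar> \<le> M powr (m + 1)" "AE w in lebesgue_on (Q T). \<bar>U' w powr (m + 1)\<bar> \<le> M powr (m + 1)"
      using BQ[OF order_refl] by (eventually_elim, use m in \<open>auto intro!: powr_mono2\<close>)+
    then show "integrable (lebesgue_on (Q T)) (\<lambda>w. U w powr (m + 1))" "integrable (lebesgue_on (Q T)) (\<lambda>w. U' w powr (m + 1))"
      using mU[OF order_refl]
      by (auto intro!: bounded_integrable_lebesgue_on[OF _ Qm] powr_real_measurable)
  qed
  have "is_weak_time_derivative (Q T) z \<zeta>"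
    unfolding z_def[abs_def] \<zeta>_def[abs_def]
    by (rule is_weak_time_derivative_diff[OF openQ u(4)[folded U_def V_def] u'(4)[folded U'_def V'_def] iW iT(1,2)])
  moreover have "integrable (lebesgue_on (Q T)) z" "integrable (lebesgue_on (Q T)) \<zeta>"
    unfolding z_def[abs_def] \<zeta>_def[abs_def] using iW iT by simp_all
  moreover have "\<exists>r>0. AE t in lebesgue. 0 < t \<and> t < r \<longrightarrow> (LINT x|lebesgue_on \<Omega>. \<bar>z (t, x)\<bar>) \<le> e" if "0 < e" for e
    using has_initial_value_difference[OF u(6) u'(6) T lmeasurable_open[OF \<Omega>(2,1)] that] by (simp add: z_def U_def U'_def)
  ultimately have "AE w in lebesgue. w \<in> Q T \<longrightarrow> z w = 0"
    unfolding Q_def using energy T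
    by (intro energy_uniqueness[OF \<Omega>(1)]) (auto simp: Q_def z_def[abs_def] \<zeta>_def[abs_def])
  then have "AE w in lebesgue_on (Q T). z w = 0" by (simp add: AE_lebesgue_on_iff[OF Ql])
  with BQ[OF order_refl] have "AE w in lebesgue_on (Q T). U w = U' w"
  proof eventually_elim
    case (elim w)
    then have "(U w powr (m + 1)) powr (1 / (m + 1)) = (U' w powr (m + 1)) powr (1 / (m + 1))" by (simp add: z_def)
    then show ?case using elim m by (simp add: powr_powr)
  qed
  then show ?thesis unfolding Q_def U_def U'_def case_prod_beta' .
qed

end
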